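(* Let $p,q>1$, $\sigma\in(0,\frac1p)$ and $\alpha\in(0,\frac1q)$. Define $u_0\in C(\mathbb Z)$ by $u_0(0)=0$ and $u_0(x)=|x|^{-1+q\alpha}$ for $x\ne0$, and $$w_0=\frac{\mathbf L_p^\sigma u_0}{u_0^{p-1}}\quad\text{on }\mathbb Z\setminus\{0\}.$$ For $\gamma\in[1,\infty)$ define $u_\gamma\in C(\mathbb Z)$ by $u_\gamma(0)=\gamma$ and $u_\gamma(x)=|x|^{-1+q\alpha}$ for $x\ne0$, and $$w_\gamma=\frac{\mathbf L_p^\sigma u_\gamma}{u_\gamma^{p-1}}\quad\text{on }\mathbb Z.$$ (a) If $p(\sigma+1-q\alpha)\ge1$, then $w_0$ and $w_\gamma$ are $p$-critical with respect to $\mathbf E_p^\sigma$ on $C_c(\mathbb Z\setminus\{0\})$ and on $C_c(\mathbb Z)$, respectively. (b) If $p(\sigma+1-q\alpha)\le1$, then $u_\beta\notin\ell^p(\mathbb Z\setminus\{0\},|w_\beta|)$, i.e. $\sum_{x\ne0}|w_\beta(x)|u_\beta(x)^p=\infty$, for $\beta\in\{0,\gamma\}$. In particular, if $p(\sigma+1-q\alpha)=1$, then $w_0$ and $w_\gamma$ are optimal Hardy-type weights on $\mathbb Z\setminus\{0\}$ and $\mathbb Z$, respectively. Assume in addition that $\alpha>\frac{p-2+p\sigma}{(p-1)q}$. Then: (i) for $\beta\in\{0,\gamma\}$, $w_\beta>0$ outside a compact (finite) set, and $w_\beta(x)\gtrsim|x|^{-p\sigma}$ as $|x|\to\infty$;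 (ii) $\mathbf L_p^\sigma u_0(0)<0$ and $\mathbf L_p^\sigma u_0>0$ on $\mathbb Z\setminus\{0\}$, i.e. $w_0$ is a Hardy weight on $\mathbb Z\setminus\{0\}$; (iii) $w_\gamma(0)>0$ for $\gamma\in[1,\infty)$, and $w_\gamma(\pm1)>0$ if $\gamma\in\{0\}\cup[1,1+C^{\frac1{p-1}})$, where $$C=\Bigl(1+\bigl(\tfrac23\bigr)^{1+p\sigma}\Bigr)\bigl(2^{1-q\alpha}-1\bigr)^{p-1}\,\frac{2^{-p\sigma-(p-1)(1-q\alpha)}}{p\sigma+(p-1)(1-q\alpha)}.$$
   Context: $C(\mathbb Z)$ is the space of real functions on $\mathbb Z$, $C_c(\mathbb Z)$ those of finite support, and $C_c(\mathbb Z\setminus\{0\})$ the functions in $C_c(\mathbb Z)$ vanishing at $0$. $t^{\langle p-1\rangle}:=|t|^{p-1}\operatorname{sgn}(t)$. The graph $b_{p,\sigma}$ over $(\mathbb Z,1)$ has edge weights $b_{p,\sigma}(x,y)=|x-y|^{-1-p\sigma}$ for $x\neq y$ and $b_{p,\sigma}(x,x)=0$. $\mathcal F_p$ is the set of $f\in C(\mathbb Z)$ with $\sum_yb_{p,\sigma}(x,y)|f(x)-f(y)|^{p-1}<\infty$ for all $x$. The restricted (Riesz) fractional $p$-Laplacian and its energy are $$\mathbf L_p^\sigma f(x)=\sum_{y\in\mathbb Z}b_{p,\sigma}(x,y)(f(x)-f(y))^{\langle p-1\rangle}\ (f\in\mathcal F_p),\qquad \mathbf E_p^\sigma(\varphi)=\frac12\sum_{x,y\in\mathbb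 Z}b_{p,\sigma}(x,y)|\varphi(x)-\varphi(y)|^p\ (\varphi\in C_c(\mathbb Z)).$$ Let $Y=\mathbb Z$ or $Y=\mathbb Z\setminus\{0\}$ (functions on $Y=\mathbb Z\setminus\{0\}$ are extended by $0$ to $\mathbb Z$). A function $w\colon Y\to\mathbb R$ is a Hardy-type weight on $Y$ if $\mathbf E_p^\sigma(\varphi)\ge\sum_{x\in Y}w(x)|\varphi(x)|^p$ for all $\varphi\in C_c(Y)$; it is a Hardy weight on $Y$ if moreover $w>0$ on $Y$. A Hardy-type weight $w$ on $Y$ is $p$-critical (with respect to $\mathbf E_p^\sigma$ on $C_c(Y)$) if there is no Hardy-type weight $\tilde w$ on $Y$ with $\tilde w\ge w$, $\tilde w\ne w$. Criticality is equivalent to the existence of an Agmon ground state: a function $u\in\mathcal F_p$, positive on $Y$ (and zero off $Y$), unique up to positive multiples, with $\mathbf L_p^\sigma u\ge wu^{p-1}$ on $Y$ (then in fact equality holds on $Y$). A $p$-critical $w$ is $p$-null-critical if its Agmon ground state $u$ satisfies $\sum_{x\in Y}|w(x)|u(x)^p=\infty$. A Hardy-type weight is optimal if it is $p$-critical and $p$-null-critical. $f\gtrsim g$ means $f\ge cg$ for some constant $c>0$. *)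

theory Defs
  imports "HOL-Analysis.Analysis"
begin

text \<open>
  The space \<open>C(\<int>)\<close> is the type \<^typ>\<open>int \<Rightarrow> real\<close>. A function on \<open>Y \<subseteq> \<int>\<close> which is to be extended
  by zero is a function of this type vanishing off \<open>Y\<close>; for weights on \<open>Y\<close> only the values
  on \<open>Y\<close> matter.
\<close>

definition C_c :: "int set \<Rightarrow> (int \<Rightarrow> real) set" where
  "C_c Y = {\<phi>. finite {x. \<phi> x \<noteq> 0} \<and> (\<forall>x. x \<notin> Y \<longrightarrow> \<phi> x = 0)}"

definition signed_pow :: "real \<Rightarrow> real \<Rightarrow> real" where
  "signed_pow t r = \<bar>t\<bar> powr r * sgn t"

definition edge_weight :: "real \<Rightarrow> real \<Rightarrow> int \<Rightarrow> int \<Rightarrow> real" where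
  "edge_weight p \<sigma> x y = (if x = y then 0 else \<bar>real_of_int (x - y)\<bar> powr (-1 - p * \<sigma>))"

definition F_space :: "real \<Rightarrow> real \<Rightarrow> (int \<Rightarrow> real) set" where
  "F_space p \<sigma> =
     {f. \<forall>x. (\<lambda>y. edge_weight p \<sigma> x y * \<bar>f x - f y\<bar> powr (p - 1)) summable_on UNIV}"

text \<open>The sums in the next two definitions converge absolutely for \<open>f\<close> in \<open>F_space p \<sigma>\<close>, and for
  finitely supported \<open>\<phi>\<close> if \<open>p > 1\<close> and \<open>\<sigma> > 0\<close>, respectively; they are used only there.\<close>

definition frac_p_Laplacian :: "real \<Rightarrow> real \<Rightarrow> (int \<Rightarrow> real) \<Rightarrow> int \<Rightarrow> real" where
  "frac_p_Laplacian p \<sigma> f x =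
     (\<Sum>\<^sub>\<infinity>y\<in>UNIV. edge_weight p \<sigma> x y * signed_pow (f x - f y) (p - 1))"

definition frac_p_energy :: "real \<Rightarrow> real \<Rightarrow> (int \<Rightarrow> real) \<Rightarrow> real" where
  "frac_p_energy p \<sigma> \<phi> =
     (1 / 2) * (\<Sum>\<^sub>\<infinity>(x, y)\<in>UNIV. edge_weight p \<sigma> x y * \<bar>\<phi> x - \<phi> y\<bar> powr p)"

definition hardy_type_weight :: "real \<Rightarrow> real \<Rightarrow> int set \<Rightarrow> (int \<Rightarrow> real) \<Rightarrow> bool" where
  "hardy_type_weight p \<sigma> Y w \<longleftrightarrow>
     (\<forall>\<phi>\<in>C_c Y. frac_p_energy p \<sigma> \<phi> \<ge> (\<Sum>\<^sub>\<infinity>x\<in>Y. w x * \<bar>\<phi> x\<bar> powr p))"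

definition hardy_weight :: "real \<Rightarrow> real \<Rightarrow> int set \<Rightarrow> (int \<Rightarrow> real) \<Rightarrow> bool" where
  "hardy_weight p \<sigma> Y w \<longleftrightarrow> hardy_type_weight p \<sigma> Y w \<and> (\<forall>x\<in>Y. w x > 0)"

definition p_critical :: "real \<Rightarrow> real \<Rightarrow> int set \<Rightarrow> (int \<Rightarrow> real) \<Rightarrow> bool" where
  "p_critical p \<sigma> Y w \<longleftrightarrow>
     hardy_type_weight p \<sigma> Y w \<and>
     \<not> (\<exists>w'. hardy_type_weight p \<sigma> Y w' \<and> (\<forall>x\<in>Y. w' x \<ge> w x) \<and> (\<exists>x\<in>Y. w' x \<noteq> w x))"

definition positive_supersolution ::
    "real \<Rightarrow> real \<Rightarrow> int set \<Rightarrow> (int \<Rightarrow> real) \<Rightarrow> (int \<Rightarrow> real) \<Rightarrow> bool" where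
  "positive_supersolution p \<sigma> Y w u \<longleftrightarrow>
     u \<in> F_space p \<sigma> \<and> (\<forall>x\<in>Y. u x > 0) \<and> (\<forall>x. x \<notin> Y \<longrightarrow> u x = 0) \<and>
     (\<forall>x\<in>Y. frac_p_Laplacian p \<sigma> u x \<ge> w x * u x powr (p - 1))"

definition agmon_ground_state ::
    "real \<Rightarrow> real \<Rightarrow> int set \<Rightarrow> (int \<Rightarrow> real) \<Rightarrow> (int \<Rightarrow> real) \<Rightarrow> bool" where
  "agmon_ground_state p \<sigma> Y w u \<longleftrightarrow>
     positive_supersolution p \<sigma> Y w u \<and>
     (\<forall>v. positive_supersolution p \<sigma> Y w v \<longrightarrow> (\<exists>c>0. \<forall>x. v x = c * u x))"

definition weighted_lp :: "real \<Rightarrow> int set \<Rightarrow> (int \<Rightarrow> real) \<Rightarrow> (int \<Rightarrow> real) set" where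
  "weighted_lp p Y m = {f. (\<lambda>x. m x * \<bar>f x\<bar> powr p) summable_on Y}"

text \<open>For the nonnegative weight \<open>\<bar>w\<bar>\<close>, not belonging to the weighted space means that the sum of
  \<open>\<bar>w\<bar> \<bar>u\<bar>\<^sup>p\<close> over \<open>Y\<close> is infinite.\<close>

definition p_null_critical :: "real \<Rightarrow> real \<Rightarrow> int set \<Rightarrow> (int \<Rightarrow> real) \<Rightarrow> bool" where
  "p_null_critical p \<sigma> Y w \<longleftrightarrow>
     p_critical p \<sigma> Y w \<and>
     (\<exists>u. agmon_ground_state p \<sigma> Y w u \<and> u \<notin> weighted_lp p Y (\<lambda>x. \<bar>w x\<bar>))"

definition optimal_hardy_type_weight :: "real \<Rightarrow> real \<Rightarrow> int set \<Rightarrow> (int \<Rightarrow> real) \<Rightarrow> bool" where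
  "optimal_hardy_type_weight p \<sigma> Y w \<longleftrightarrow>
     hardy_type_weight p \<sigma> Y w \<and> p_critical p \<sigma> Y w \<and> p_null_critical p \<sigma> Y w"

definition u_fun :: "real \<Rightarrow> real \<Rightarrow> real \<Rightarrow> int \<Rightarrow> real" where
  "u_fun q \<alpha> \<gamma> x = (if x = 0 then \<gamma> else \<bar>real_of_int x\<bar> powr (-1 + q * \<alpha>))"

text \<open>For \<open>\<gamma> = 0\<close> this is a weight on \<open>\<int> \<setminus> {0}\<close> only; its value at \<open>0\<close> is meaningless.\<close>

definition w_fun :: "real \<Rightarrow> real \<Rightarrow> real \<Rightarrow> real \<Rightarrow> real \<Rightarrow> int \<Rightarrow> real" where
  "w_fun p \<sigma> q \<alpha> \<gamma> x =
     frac_p_Laplacian p \<sigma> (u_fun q \<alpha> \<gamma>) x / u_fun q \<alpha> \<gamma> x powr (p - 1)"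

definition C_const :: "real \<Rightarrow> real \<Rightarrow> real \<Rightarrow> real \<Rightarrow> real" where
  "C_const p \<sigma> q \<alpha> =
     (1 + (2 / 3) powr (1 + p * \<sigma>)) * (2 powr (1 - q * \<alpha>) - 1) powr (p - 1) *
     (2 powr (- p * \<sigma> - (p - 1) * (1 - q * \<alpha>)) / (p * \<sigma> + (p - 1) * (1 - q * \<alpha>)))"

end

theory Submission
  imports Defs
begin

text \<open>
  Write \<open>a = 1 - q \<alpha>\<close>, \<open>s = p \<sigma>\<close>, \<open>r = p - 1\<close> and \<open>\<kappa> = s + r a\<close>, where \<open>0 < a < 1\<close> and \<open>0 < s < 1\<close>,
  and let \<open>u\<close> be \<open>\<bar>x\<bar> powr (- a)\<close> off \<open>0\<close> with the value \<open>\<beta>\<close> at \<open>0\<close>. The hypothesis of part (a) is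
  \<open>s + p a \<ge> 1\<close>, that of part (b) is \<open>s + p a \<le> 1\<close>, and the additional hypothesis on \<open>\<alpha>\<close> is \<open>\<kappa> < 1\<close>;
  as \<open>\<kappa> = s + p a - a\<close>, the latter follows from the hypothesis of (b).

  \<^bold>\<open>Criticality.\<close> For the weight \<open>w\<close>, the quotient of the Laplacian of \<open>u\<close> and \<open>u powr r\<close>, the energy of
  \<open>\<phi>\<close> exceeds \<open>\<Sum> w \<bar>\<phi>\<bar>\<^sup>p\<close> by half a double sum of nonnegative Picone terms (\<open>ground_state_identity\<close>).
  Hence \<open>w\<close> is a Hardy-type weight; and it is critical with a unique ground state \<open>u\<close> once some finitely
  supported functions tend to \<open>u\<close> pointwise while this excess tends to \<open>0\<close> (\<open>null_family_critical\<close>).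
  The functions \<open>u (1 + \<epsilon> ln u)\<^sub>+\<close> do this. Their Picone terms are at most
  \<open>o(\<epsilon>) \<bar>u x - u y\<bar>\<^sup>p\<close> (\<open>picone_log_cut\<close>, \<open>powr_second_order\<close>), they vanish unless \<open>x\<close> or \<open>y\<close> is bounded by
  \<open>exp (1 / (a \<epsilon>))\<close> in modulus, and the energy of \<open>u\<close> on the edges from \<open>x\<close> to smaller values of \<open>u\<close> is
  \<open>O(\<bar>x\<bar> powr (- s - p a))\<close>, thus \<open>O(1 / \<bar>x\<bar>)\<close> (\<open>pow_fun_row_bound\<close>). The harmonic sum contributes \<open>O(1 / \<epsilon>)\<close>, and the excess is \<open>o(1)\<close>.

  \<^bold>\<open>Positivity.\<close> Parts (b), (i) and (ii) rest on one estimate (\<open>laplacian_lower_bound\<close>): if \<open>\<kappa> < 1\<close>, then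
  the Laplacian of \<open>u\<close> with \<open>\<beta> = 0\<close> is at least \<open>c \<bar>x\<bar> powr (- \<kappa>)\<close> for all \<open>x \<noteq> 0\<close>. By homogeneity its
  value at \<open>n \<ge> 1\<close> is \<open>n powr (- 1 - \<kappa>)\<close> times the sum over the integers \<open>y\<close> of \<open>K (y / n)\<close>, where
  \<open>K t = \<bar>1 - t\<bar> powr (- 1 - s) * signed_pow (1 - \<bar>t\<bar> powr (- a)) r\<close>; as powers of \<open>0\<close> are \<open>0\<close>,
  \<open>K 1 = 0\<close>, and \<open>K 0 = 1\<close> in accordance with \<open>u 0 = 0\<close>. The principal value integral of
  \<open>K\<close> is positive: the inversion \<open>t \<mapsto> 1 / t\<close> turns the negative part, which lives on \<open>\<bar>t\<bar> < 1\<close>, into the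
  positive part on \<open>\<bar>t\<bar> > 1\<close> weighted by \<open>\<bar>t\<bar> powr (\<kappa> - 1) < 1\<close>. It remains to pass from the integral to the
  sum for every single \<open>n\<close>. The terms at \<open>1 - x\<close> and \<open>1 + x\<close> with \<open>0 < x < 1\<close> are taken together,
  which removes the singularity; up to sign, the pair is the sum of a decreasing and an increasing
  nonnegative function (\<open>pair_term_decomposition\<close>), so its sum is bounded by \<open>n\<close> times its integral.
  On \<open>t \<ge> 2\<close> and on \<open>t < 0\<close> the sums fall short of \<open>n\<close> times the integrals by at most \<open>1 / 2\<close> each,
  and the term \<open>K 0 = 1\<close> pays for both losses.
\<close>

section \<open>The Picone inequality\<close>

text \<open>Strictness is needed for the equality case of Picone's inequality, which yields uniqueness of
  the ground state.\<close>

lemma powr_above_tangent: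
  fixes p X Y :: real
  assumes "p > 1" "X \<ge> 0" "Y > 0"
  shows "Y powr p + p * Y powr (p - 1) * (X - Y) \<le> X powr p"
    and "X \<noteq> Y \<Longrightarrow> Y powr p + p * Y powr (p - 1) * (X - Y) < X powr p"
proof -
  have strict: "Y powr p + p * Y powr (p - 1) * (X - Y) < X powr p" if ne: "X \<noteq> Y"
  proof -
    have d: "((\<lambda>z. z powr p) has_real_derivative p * z powr (p - 1)) (at z)" if "z > 0" for z
      using that by (auto intro!: derivative_eq_intros)
    consider "X = 0" | "0 < X" "X < Y" | "Y < X" using assms ne by fastforce
    then show ?thesis
    proof cases
      case 1
      have "Y powr (p - 1) * Y = Y powr p"
        using assms by (simp add: powr_mult_base mult.commute)
      then have "Y powr p + p * Y powr (p - 1) * (X - Y) = (1 - p) * Y powr p"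
        using 1 by (simp add: algebra_simps)
      also have "\<dots> < 0" using assms by (intro mult_neg_pos) auto
      finally show ?thesis using 1 assms by simp
    next
      case 2
      obtain z where z: "X < z" "z < Y" "Y powr p - X powr p = (Y - X) * (p * z powr (p - 1))"
        using MVT2[of X Y "\<lambda>z. z powr p" "\<lambda>z. p * z powr (p - 1)"] 2 d by force
      have "z powr (p - 1) < Y powr (p - 1)" using z 2 assms by (intro powr_less_mono2) auto
      then have "(Y - X) * (p * z powr (p - 1)) < (Y - X) * (p * Y powr (p - 1))"
        using 2 assms by (intro mult_strict_left_mono) auto
      then show ?thesis using z by (simp add: algebra_simps)
    next
      case 3
      obtain z where z: "Y < z" "z < X" "X powr p - Y powr p = (X - Y) * (p * z powr (p - 1))"
        using MVT2[of Y X "\<lambda>z. z powr p" "\<lambda>z. p * z powr (p - 1)"] 3 d assms by force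
      have "Y powr (p - 1) < z powr (p - 1)" using z assms by (intro powr_less_mono2) auto
      then have "(X - Y) * (p * Y powr (p - 1)) < (X - Y) * (p * z powr (p - 1))"
        using 3 assms by (intro mult_strict_left_mono) auto
      then show ?thesis using z by (simp add: algebra_simps)
    qed
  qed
  then show "X \<noteq> Y \<Longrightarrow> Y powr p + p * Y powr (p - 1) * (X - Y) < X powr p" .
  show "Y powr p + p * Y powr (p - 1) * (X - Y) \<le> X powr p"
    using strict by (cases "X = Y") auto
qed

lemma powr_convex_combination:
  fixes p l X Y :: real
  assumes "p > 1" "X \<ge> 0" "Y \<ge> 0" "0 < l" "l < 1"
  shows "((1 - l) * X + l * Y) powr p \<le> (1 - l) * X powr p + l * Y powr p"
    and "X \<noteq> Y \<Longrightarrow> ((1 - l) * X + l * Y) powr p < (1 - l) * X powr p + l * Y powr p"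
proof -
  define M where "M = (1 - l) * X + l * Y"
  have *: "(1 - l) * (M powr p + p * M powr (p - 1) * (X - M)) + l * (M powr p + p * M powr (p - 1) * (Y - M))
     = M powr p" (is "?L = _")
  proof -
    have "?L = M powr p + p * M powr (p - 1) * ((1 - l) * X + l * Y - M)" by algebra
    then show ?thesis by (simp add: M_def)
  qed
  have M0: "M > 0" if "X \<noteq> 0 \<or> Y \<noteq> 0"
  proof -
    have "(1 - l) * X \<ge> 0" "l * Y \<ge> 0" using assms by auto
    moreover have "(1 - l) * X > 0 \<or> l * Y > 0" using that assms by auto
    ultimately show ?thesis unfolding M_def by linarith
  qed
  have le: "M powr p \<le> (1 - l) * X powr p + l * Y powr p"
  proof (cases "X = 0 \<and> Y = 0")
    case True then show ?thesis by (simp add: M_def)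
  next
    case False
    then have "M > 0" using M0 by auto
    then have "(1 - l) * (M powr p + p * M powr (p - 1) * (X - M)) + l * (M powr p + p * M powr (p - 1) * (Y - M))
       \<le> (1 - l) * X powr p + l * Y powr p"
      using assms by (intro add_mono mult_left_mono powr_above_tangent) auto
    then show ?thesis using * by simp
  qed
  then show "((1 - l) * X + l * Y) powr p \<le> (1 - l) * X powr p + l * Y powr p"
    by (simp add: M_def)
  have "M powr p < (1 - l) * X powr p + l * Y powr p" if ne: "X \<noteq> Y"
  proof -
    have "M > 0" using M0 ne by auto
    have "Y - M = (1 - l) * (Y - X)" by (simp add: M_def algebra_simps)
    then have "Y \<noteq> M" using ne assms by auto
    have "(1 - l) * (M powr p + p * M powr (p - 1) * (X - M)) + l * (M powr p + p * M powr (p - 1) * (Y - M))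
       < (1 - l) * X powr p + l * Y powr p"
      using assms \<open>M > 0\<close> \<open>Y \<noteq> M\<close>
      by (intro add_le_less_mono mult_left_mono mult_strict_left_mono powr_above_tangent) auto
    then show ?thesis using * by simp
  qed
  then show "X \<noteq> Y \<Longrightarrow> ((1 - l) * X + l * Y) powr p < (1 - l) * X powr p + l * Y powr p"
    by (simp add: M_def)
qed

text \<open>One summand of the difference between the energy of \<open>\<phi>\<close> and the weighted norm belonging to
  \<open>u\<close>, symmetrised over an edge: here \<open>a\<close>, \<open>b\<close> are the values of \<open>u\<close> at the two ends and \<open>s\<close>, \<open>t\<close> those of
  \<open>\<phi>\<close>. If \<open>u\<close> and \<open>\<phi>\<close> vanish at one end, division by zero gives the correct value.\<close>

definition picone :: "real \<Rightarrow> real \<Rightarrow> real \<Rightarrow> real \<Rightarrow> real \<Rightarrow> real" where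
  "picone p a b s t = \<bar>s - t\<bar> powr p -
     signed_pow (a - b) (p - 1) * (\<bar>s\<bar> powr p / a powr (p - 1) - \<bar>t\<bar> powr p / b powr (p - 1))"

lemma signed_pow_minus: "signed_pow (- t) r = - signed_pow t r"
  by (simp add: signed_pow_def sgn_minus)

lemma picone_commute: "picone p a b s t = picone p b a t s"
proof -
  have "signed_pow (a - b) (p - 1) = - signed_pow (b - a) (p - 1)"
    using signed_pow_minus[of "b - a"] by simp
  then show ?thesis by (simp add: picone_def abs_minus_commute[of s t] algebra_simps)
qed

text \<open>Picone's inequality is convexity of \<open>t powr p\<close>: with \<open>l = b / a\<close>, the quotient \<open>s / a\<close> is the convex
  combination of \<open>(s - t) / (a - b)\<close> and \<open>t / b\<close> with weights \<open>1 - l\<close> and \<open>l\<close>. Equality forces these two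
  points to coincide, hence \<open>s / a = t / b\<close>.\<close>

lemma picone_of_greater:
  assumes "p > 1" "0 < b" "b < a"
  shows "picone p a b s t \<ge> 0"
    and "0 \<le> t \<Longrightarrow> t \<le> s \<Longrightarrow> picone p a b s t \<le> 0 \<Longrightarrow> s * b = t * a"
proof -
  define l where "l = b / a"
  define X where "X = \<bar>s - t\<bar> / (a - b)"
  define Y where "Y = \<bar>t\<bar> / b"
  have l: "0 < l" "l < 1" using assms by (auto simp: l_def)
  have XY: "X \<ge> 0" "Y \<ge> 0" using assms by (auto simp: X_def Y_def)
  have e1: "(1 - l) * X + l * Y = (\<bar>s - t\<bar> + \<bar>t\<bar>) / a"
    using assms by (simp add: l_def X_def Y_def field_simps)
  have conv: "Z * (W / Z) powr p = W powr p / Z powr (p - 1)" if "Z > 0" "W \<ge> 0" for Z W :: real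
  proof -
    have "Z powr p = Z * Z powr (p - 1)" using that by (simp add: powr_mult_base)
    then show ?thesis using that by (simp add: powr_divide field_simps)
  qed
  have e2: "a * ((1 - l) * X powr p + l * Y powr p)
      = \<bar>s - t\<bar> powr p / (a - b) powr (p - 1) + \<bar>t\<bar> powr p / b powr (p - 1)"
  proof -
    have "a * ((1 - l) * X powr p + l * Y powr p) = (a - b) * X powr p + b * Y powr p"
      using assms by (simp add: l_def field_simps)
    then show ?thesis using assms by (simp add: X_def Y_def conv)
  qed
  have e3: "a * ((\<bar>s - t\<bar> + \<bar>t\<bar>) / a) powr p = (\<bar>s - t\<bar> + \<bar>t\<bar>) powr p / a powr (p - 1)"
    using assms by (intro conv) auto
  have sp: "signed_pow (a - b) (p - 1) = (a - b) powr (p - 1)"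
    using assms by (simp add: signed_pow_def)
  have pos: "(a - b) powr (p - 1) > 0" using assms by simp
  have D: "picone p a b s t = (a - b) powr (p - 1) *
     (\<bar>s - t\<bar> powr p / (a - b) powr (p - 1) + \<bar>t\<bar> powr p / b powr (p - 1) - \<bar>s\<bar> powr p / a powr (p - 1))"
    unfolding picone_def sp using pos by (simp add: field_simps)
  have s1: "\<bar>s\<bar> powr p / a powr (p - 1) \<le> (\<bar>s - t\<bar> + \<bar>t\<bar>) powr p / a powr (p - 1)"
    using assms by (intro divide_right_mono powr_mono2) auto
  have s2: "a * ((\<bar>s - t\<bar> + \<bar>t\<bar>) / a) powr p \<le> a * ((1 - l) * X powr p + l * Y powr p)"
    using powr_convex_combination(1)[OF assms(1) XY l] assms unfolding e1 by (intro mult_left_mono) auto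
  show "picone p a b s t \<ge> 0"
    unfolding D using s1 s2 e2 e3 pos by (intro mult_nonneg_nonneg) auto
  assume st: "0 \<le> t" "t \<le> s" and le: "picone p a b s t \<le> 0"
  have "X = Y"
  proof (rule ccontr)
    assume "X \<noteq> Y"
    then have "a * ((\<bar>s - t\<bar> + \<bar>t\<bar>) / a) powr p < a * ((1 - l) * X powr p + l * Y powr p)"
      using powr_convex_combination(2)[OF assms(1) XY l] assms unfolding e1 by (intro mult_strict_left_mono) auto
    then have "picone p a b s t > 0"
      unfolding D using s1 e2 e3 pos by (intro mult_pos_pos) auto
    then show False using le by simp
  qed
  then show "s * b = t * a"
    using st assms by (simp add: X_def Y_def field_simps)
qed

lemma picone_nonneg:
  assumes "p > 1" "0 < a" "0 < b"
  shows "picone p a b s t \<ge> 0"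
proof -
  consider "a = b" | "b < a" | "a < b" by linarith
  then show ?thesis
  proof cases
    case 1 then show ?thesis by (simp add: picone_def signed_pow_def)
  next
    case 2 then show ?thesis using picone_of_greater assms by auto
  next
    case 3 then show ?thesis using picone_of_greater[of p a b t s] assms picone_commute by metis
  qed
qed

lemma picone_equality:
  assumes "p > 1" "0 < a" "0 < b" "0 < s" "0 < t" "picone p a b s t \<le> 0"
  shows "s * b = t * a"
proof -
  have main: "s * b = t * a" if "0 < b" "b < a" "0 < s" "0 < t" "picone p a b s t \<le> 0" for a b s t
  proof (cases "t \<le> s")
    case True
    then show ?thesis using picone_of_greater(2)[of p b a t s] that assms(1) by auto
  next
    case False
    have "s powr p / a powr (p - 1) < t powr p / b powr (p - 1)"
      using that assms(1) False
      by (intro frac_less powr_less_mono2 powr_mono2) auto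
    then have "signed_pow (a - b) (p - 1) * (\<bar>s\<bar> powr p / a powr (p - 1) - \<bar>t\<bar> powr p / b powr (p - 1)) < 0"
      using that by (intro mult_pos_neg) (auto simp: signed_pow_def)
    then have "picone p a b s t > 0" unfolding picone_def
      by (smt (verit) powr_ge_zero)
    then show ?thesis using that by simp
  qed
  consider "a = b" | "b < a" | "a < b" by linarith
  then show ?thesis
  proof cases
    case 1 
    then have "\<bar>s - t\<bar> powr p \<le> 0" using assms(6) by (simp add: picone_def signed_pow_def)
    then show ?thesis using 1 by (simp add: order_le_less)
  next
    case 2 then show ?thesis using main assms by auto
  next
    case 3 then show ?thesis using main[of a b t s] assms picone_commute by metis
  qed
qed

section \<open>Energy, Hardy weights and ground states\<close>

lemma signed_pow_abs: "\<bar>signed_pow t r\<bar> = \<bar>t\<bar> powr r"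
  by (cases "t = 0") (auto simp: signed_pow_def abs_mult abs_sgn_eq)

lemma int_abs_summable_onI:
  fixes k :: "int \<Rightarrow> real"
  assumes "summable (\<lambda>j. \<bar>k (int (Suc j))\<bar>)" "summable (\<lambda>j. \<bar>k (- int (Suc j))\<bar>)"
  shows "k summable_on UNIV"
proof -
  have U: "(UNIV :: int set) = {0} \<union> (range (\<lambda>j. int (Suc j)) \<union> range (\<lambda>j. - int (Suc j)))"
  proof (intro equalityI subsetI)
    fix x :: int
    consider "x = 0" | "x > 0" | "x < 0" by linarith
    then show "x \<in> {0} \<union> (range (\<lambda>j. int (Suc j)) \<union> range (\<lambda>j. - int (Suc j)))"
    proof cases
      case 2 then have "x = int (Suc (nat (x - 1)))" by simp
      then show ?thesis by blast
    next
      case 3 then have "x = - int (Suc (nat (- x - 1)))" by simp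
      then show ?thesis by blast
    qed auto
  qed auto
  have "(k \<circ> (\<lambda>j. int (Suc j))) summable_on UNIV" "(k \<circ> (\<lambda>j. - int (Suc j))) summable_on UNIV"
    using assms by (auto intro!: norm_summable_imp_summable_on simp: o_def)
  then have "k summable_on range (\<lambda>j. int (Suc j))" "k summable_on range (\<lambda>j. - int (Suc j))"
    by (subst summable_on_reindex; auto simp: inj_on_def)+
  then show ?thesis unfolding U by (intro summable_on_Un_disjoint) auto
qed

lemma int_infsum_split:
  fixes k :: "int \<Rightarrow> real"
  assumes "k summable_on UNIV"
  shows "summable (\<lambda>j. k (int (Suc j)))" "summable (\<lambda>j. k (- int (Suc j)))"
    and "infsum k UNIV = k 0 + (\<Sum>j. k (int (Suc j))) + (\<Sum>j. k (- int (Suc j)))"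
proof -
  have U: "(UNIV :: int set) = {0} \<union> ({0<..} \<union> {..<0})" by auto
  have A: "(\<lambda>j. k (int (Suc j))) summable_on UNIV \<and> infsum (\<lambda>j. k (int (Suc j))) UNIV = infsum k {0<..}"
  proof -
    have "bij_betw (\<lambda>j. int (Suc j)) UNIV {0<..}"
      by (rule bij_betw_byWitness[where f' = "\<lambda>x. nat (x - 1)"]) auto
    from summable_on_reindex_bij_betw[OF this, of k] infsum_reindex_bij_betw[OF this, of k]
    show ?thesis using summable_on_subset_banach[OF assms, of "{0<..}"] by simp
  qed
  have B: "(\<lambda>j. k (- int (Suc j))) summable_on UNIV \<and> infsum (\<lambda>j. k (- int (Suc j))) UNIV = infsum k {..<0}"
  proof -
    have "bij_betw (\<lambda>j. - int (Suc j)) UNIV {..<0}"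
      by (rule bij_betw_byWitness[where f' = "\<lambda>x. nat (- x - 1)"]) auto
    from summable_on_reindex_bij_betw[OF this, of k] infsum_reindex_bij_betw[OF this, of k]
    show ?thesis using summable_on_subset_banach[OF assms, of "{..<0}"] by simp
  qed
  have sA: "(\<lambda>j. k (int (Suc j))) sums infsum k {0<..}"
    using A has_sum_imp_sums[OF has_sum_infsum] by fastforce
  have sB: "(\<lambda>j. k (- int (Suc j))) sums infsum k {..<0}"
    using B has_sum_imp_sums[OF has_sum_infsum] by fastforce
  show "summable (\<lambda>j. k (int (Suc j)))" "summable (\<lambda>j. k (- int (Suc j)))"
    using sA sB by (auto simp: sums_iff)
  have "infsum k UNIV = infsum k {0} + infsum k ({0<..} \<union> {..<0})"
    unfolding U by (intro infsum_Un_disjoint) (auto intro: summable_on_subset_banach[OF assms])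
  also have "infsum k ({0<..} \<union> {..<0}) = infsum k {0<..} + infsum k {..<0}"
    by (intro infsum_Un_disjoint) (auto intro: summable_on_subset_banach[OF assms])
  finally show "infsum k UNIV = k 0 + (\<Sum>j. k (int (Suc j))) + (\<Sum>j. k (- int (Suc j)))"
    using sA sB by (simp add: sums_iff)
qed

lemma edge_weight_alt: "edge_weight p \<sigma> x y = \<bar>real_of_int (x - y)\<bar> powr (-1 - p * \<sigma>)"
  by (simp add: edge_weight_def)

lemma edge_weight_commute: "edge_weight p \<sigma> x y = edge_weight p \<sigma> y x"
  unfolding edge_weight_alt by (simp add: abs_minus_commute)

lemma edge_weight_nonneg: "edge_weight p \<sigma> x y \<ge> 0"
  by (simp add: edge_weight_def)

lemma edge_weight_pos: "x \<noteq> y \<Longrightarrow> edge_weight p \<sigma> x y > 0"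
  by (simp add: edge_weight_def)

lemma edge_weight_summable:
  assumes "p * \<sigma> > 0"
  shows "edge_weight p \<sigma> x summable_on UNIV"
proof -
  have "summable (\<lambda>j. real (Suc j) powr (-1 - p * \<sigma>))"
    using summable_Suc_iff[of "\<lambda>j. real j powr (-1 - p * \<sigma>)"] assms by (simp add: summable_real_powr_iff)
  then have "(\<lambda>z::int. \<bar>real_of_int z\<bar> powr (-1 - p * \<sigma>)) summable_on UNIV"
    by (intro int_abs_summable_onI) (auto simp: add.commute)
  moreover have "bij_betw (\<lambda>y. x - y) UNIV (UNIV :: int set)"
    by (rule bij_betw_byWitness[where f' = "\<lambda>y. x - y"]) auto
  ultimately show ?thesis
    using summable_on_reindex_bij_betw[of "\<lambda>y. x - y" UNIV UNIV "\<lambda>z::int. \<bar>real_of_int z\<bar> powr (-1 - p * \<sigma>)"]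
    unfolding edge_weight_alt by auto
qed

lemma bounded_in_F_space:
  assumes "p * \<sigma> > 0" "p > 1" "\<And>x. \<bar>u x\<bar> \<le> M"
  shows "u \<in> F_space p \<sigma>"
  unfolding F_space_def
proof (clarify)
  fix x
  have "(\<lambda>y. edge_weight p \<sigma> x y * (2 * M) powr (p - 1)) summable_on UNIV"
    using edge_weight_summable[OF assms(1)] by (intro summable_on_cmult_left) auto
  then show "(\<lambda>y. edge_weight p \<sigma> x y * \<bar>u x - u y\<bar> powr (p - 1)) summable_on UNIV"
  proof (rule summable_on_comparison_test)
    fix y
    have "\<bar>u x - u y\<bar> \<le> 2 * M" using assms(3)[of x] assms(3)[of y] by linarith
    then show "edge_weight p \<sigma> x y * \<bar>u x - u y\<bar> powr (p - 1) \<le> edge_weight p \<sigma> x y * (2 * M) powr (p - 1)"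
      using assms edge_weight_nonneg by (intro mult_left_mono powr_mono2) auto
  qed (use edge_weight_nonneg in auto)
qed

lemma F_space_summable:
  assumes "u \<in> F_space p \<sigma>"
  shows "(\<lambda>y. edge_weight p \<sigma> x y * signed_pow (u x - u y) (p - 1)) summable_on UNIV"
proof (rule abs_summable_summable)
  have "(\<lambda>y. edge_weight p \<sigma> x y * \<bar>u x - u y\<bar> powr (p - 1)) summable_on UNIV"
    using assms by (auto simp: F_space_def)
  then show "(\<lambda>y. norm (edge_weight p \<sigma> x y * signed_pow (u x - u y) (p - 1))) summable_on UNIV"
    by (simp add: abs_mult signed_pow_abs edge_weight_nonneg)
qed

text \<open>A double sum over pairs is only used when one index runs over a finite
  support, so that no absolute summability in both variables has to be checked.\<close>

lemma has_sum_finite_rows: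
  fixes F :: "'a \<Rightarrow> real"
  assumes "finite S" "\<And>x. x \<notin> S \<Longrightarrow> F x = 0" "\<And>x. (k x) summable_on UNIV"
  shows "((\<lambda>(x, y). F x * k x y) has_sum (\<Sum>x\<in>S. F x * infsum (k x) UNIV)) UNIV"
proof -
  have row: "((\<lambda>(x', y). if x' = x then F x' * k x' y else 0) has_sum F x * infsum (k x) UNIV) UNIV" for x
  proof -
    have "((\<lambda>y. F x * k x y) has_sum F x * infsum (k x) UNIV) UNIV"
      using assms(3) by (intro has_sum_cmult_right) (auto intro: has_sum_infsum)
    then have "((\<lambda>(x', y). F x' * k x' y) has_sum F x * infsum (k x) UNIV) (Pair x ` UNIV)"
      by (subst has_sum_reindex) (auto simp: inj_on_def o_def)
    then show ?thesis
      by (subst has_sum_cong_neutral[where S = UNIV and T = "Pair x ` UNIV"]) (auto split: if_splits)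
  qed
  have "((\<lambda>z. \<Sum>x\<in>S. (\<lambda>(x', y). if x' = x then F x' * k x' y else 0) z) has_sum
      (\<Sum>x\<in>S. F x * infsum (k x) UNIV)) UNIV"
    using assms(1)
  proof (induction S rule: finite_induct)
    case (insert x S)
    then show ?case using has_sum_add[OF row[of x] insert.IH] by simp
  qed auto
  moreover have "(\<Sum>x\<in>S. (\<lambda>(x', y). if x' = x then F x' * k x' y else 0) z) = (\<lambda>(x, y). F x * k x y) z" for z
    using assms(1,2) by (cases z) (auto simp: sum.delta')
  ultimately show ?thesis by simp
qed

lemma powr_diff_bound:
  assumes "p > (0::real)"
  shows "\<bar>s - t\<bar> powr p \<le> 2 powr p * (\<bar>s\<bar> powr p + \<bar>t\<bar> powr p)"
proof -
  have "\<bar>s - t\<bar> powr p \<le> (2 * max \<bar>s\<bar> \<bar>t\<bar>) powr p"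
    using assms by (intro powr_mono2) auto
  also have "\<dots> = 2 powr p * (max \<bar>s\<bar> \<bar>t\<bar>) powr p" by (simp add: powr_mult)
  also have "\<dots> \<le> 2 powr p * (\<bar>s\<bar> powr p + \<bar>t\<bar> powr p)"
    by (intro mult_left_mono) (auto simp: max_def)
  finally show ?thesis .
qed

lemma has_sum_swap_pairs:
  fixes f :: "'a \<Rightarrow> 'a \<Rightarrow> real"
  assumes "((\<lambda>(x, y). f x y) has_sum a) UNIV"
  shows "((\<lambda>(x, y). f y x) has_sum a) UNIV"
proof -
  have "bij_betw prod.swap UNIV (UNIV :: ('a \<times> 'a) set)" by (rule bij_swap)
  from has_sum_reindex_bij_betw[OF this, of "\<lambda>(x, y). f x y" a] assms
  show ?thesis by (simp add: case_prod_unfold)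
qed

lemma energy_has_sum:
  assumes "p > 1" "p * \<sigma> > 0" "finite {x. \<phi> x \<noteq> 0}"
  shows "((\<lambda>(x, y). edge_weight p \<sigma> x y * \<bar>\<phi> x - \<phi> y\<bar> powr p) has_sum 2 * frac_p_energy p \<sigma> \<phi>) UNIV"
proof -
  have r: "((\<lambda>(x, y). \<bar>\<phi> x\<bar> powr p * edge_weight p \<sigma> x y) has_sum
      (\<Sum>x\<in>{x. \<phi> x \<noteq> 0}. \<bar>\<phi> x\<bar> powr p * infsum (edge_weight p \<sigma> x) UNIV)) UNIV"
    using assms edge_weight_summable by (intro has_sum_finite_rows) auto
  have "((\<lambda>z. 2 powr p * ((\<lambda>(x, y). \<bar>\<phi> x\<bar> powr p * edge_weight p \<sigma> x y) z +
        (\<lambda>(x, y). \<bar>\<phi> y\<bar> powr p * edge_weight p \<sigma> y x) z))) summable_on UNIV"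
    using r has_sum_swap_pairs[OF r] by (intro summable_on_cmult_right summable_on_add) (auto simp: summable_on_def)
  then have "(\<lambda>(x, y). edge_weight p \<sigma> x y * \<bar>\<phi> x - \<phi> y\<bar> powr p) summable_on UNIV"
  proof (rule summable_on_comparison_test, goal_cases)
    case (1 z)
    obtain x y where z: "z = (x, y)" by force
    have "edge_weight p \<sigma> x y * \<bar>\<phi> x - \<phi> y\<bar> powr p
        \<le> edge_weight p \<sigma> x y * (2 powr p * (\<bar>\<phi> x\<bar> powr p + \<bar>\<phi> y\<bar> powr p))"
      using assms by (intro mult_left_mono powr_diff_bound edge_weight_nonneg) auto
    then show ?case unfolding z using edge_weight_commute[of p \<sigma> x y] by (simp add: algebra_simps)
  qed (auto simp: edge_weight_nonneg)
  then show ?thesis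
    by (simp add: frac_p_energy_def has_sum_infsum)
qed

lemma has_sum_subtract:
  fixes f g :: "'a \<Rightarrow> real"
  assumes "(f has_sum a) A" "(g has_sum b) A"
  shows "((\<lambda>x. f x - g x) has_sum (a - b)) A"
  using has_sum_add[OF assms(1), of "\<lambda>x. - g x" "- b"] assms(2) by (simp add: has_sum_uminus)

text \<open>The weighted norm is a discrete integration by parts against
  \<open>\<bar>\<phi>\<bar> powr p / u powr (p - 1)\<close>: the double sum defining it is symmetrised over the two ends of each edge, where the
  kernel is antisymmetric, and then subtracted from the energy edge by edge.\<close>

lemma ground_state_identity:
  assumes "p > 1" "p * \<sigma> > 0" "u \<in> F_space p \<sigma>" and S: "finite {x. \<phi> x \<noteq> 0}"
  shows "((\<lambda>(x, y). edge_weight p \<sigma> x y * picone p (u x) (u y) (\<phi> x) (\<phi> y)) has_sum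
     2 * (frac_p_energy p \<sigma> \<phi> -
        (\<Sum>x | \<phi> x \<noteq> 0. frac_p_Laplacian p \<sigma> u x / u x powr (p - 1) * \<bar>\<phi> x\<bar> powr p))) UNIV"
proof -
  define F where "F x = \<bar>\<phi> x\<bar> powr p / u x powr (p - 1)" for x
  define k where "k x y = edge_weight p \<sigma> x y * signed_pow (u x - u y) (p - 1)" for x y
  define R where "R = (\<Sum>x | \<phi> x \<noteq> 0. F x * frac_p_Laplacian p \<sigma> u x)"
  have r: "((\<lambda>(x, y). F x * k x y) has_sum R) UNIV"
    unfolding R_def frac_p_Laplacian_def k_def using F_space_summable[OF assms(3)] S
    by (intro has_sum_finite_rows) (auto simp: F_def)
  have "((\<lambda>z. (\<lambda>(x, y). edge_weight p \<sigma> x y * \<bar>\<phi> x - \<phi> y\<bar> powr p) z -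
      ((\<lambda>(x, y). F x * k x y) z + (\<lambda>(x, y). F y * k y x) z)) has_sum (2 * frac_p_energy p \<sigma> \<phi> - (R + R))) UNIV"
    by (intro has_sum_subtract energy_has_sum has_sum_add r has_sum_swap_pairs[OF r] assms)
  moreover have "(\<lambda>(x, y). edge_weight p \<sigma> x y * \<bar>\<phi> x - \<phi> y\<bar> powr p) z -
      ((\<lambda>(x, y). F x * k x y) z + (\<lambda>(x, y). F y * k y x) z) =
      (\<lambda>(x, y). edge_weight p \<sigma> x y * picone p (u x) (u y) (\<phi> x) (\<phi> y)) z" for z
  proof -
    obtain x y where z: "z = (x, y)" by force
    have "signed_pow (u y - u x) (p - 1) = - signed_pow (u x - u y) (p - 1)"
      using signed_pow_minus[of "u x - u y"] by simp
    then have "k y x = - k x y" by (simp add: k_def edge_weight_commute[of p \<sigma> y x])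
    then show ?thesis by (simp add: z picone_def F_def[symmetric]) (simp add: k_def algebra_simps)
  qed
  moreover have "R = (\<Sum>x | \<phi> x \<noteq> 0. frac_p_Laplacian p \<sigma> u x / u x powr (p - 1) * \<bar>\<phi> x\<bar> powr p)"
    unfolding R_def F_def by (intro sum.cong) auto
  ultimately show ?thesis by simp
qed

lemma infsum_support:
  assumes "\<phi> \<in> C_c Y"
  shows "(\<Sum>\<^sub>\<infinity>x\<in>Y. w x * \<bar>\<phi> x\<bar> powr p) = (\<Sum>x | \<phi> x \<noteq> 0. w x * \<bar>\<phi> x\<bar> powr p)"
proof -
  have "(\<Sum>\<^sub>\<infinity>x\<in>Y. w x * \<bar>\<phi> x\<bar> powr p) = (\<Sum>\<^sub>\<infinity>x\<in>{x. \<phi> x \<noteq> 0}. w x * \<bar>\<phi> x\<bar> powr p)"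
    using assms by (intro infsum_cong_neutral) (auto simp: C_c_def)
  then show ?thesis using assms by (simp add: C_c_def)
qed

text \<open>If one end lies outside \<open>Y\<close>, the two parts of the Picone term cancel.\<close>

lemma picone_supersolution_nonneg:
  assumes "p > 1" "\<And>x. x \<in> Y \<Longrightarrow> v x > 0" "\<And>x. x \<notin> Y \<Longrightarrow> v x = 0" "\<And>x. x \<notin> Y \<Longrightarrow> \<phi> x = 0"
  shows "picone p (v x) (v y) (\<phi> x) (\<phi> y) \<ge> 0"
proof -
  have one: "picone p (v x) (v y) (\<phi> x) (\<phi> y) = 0" if "x \<in> Y" "y \<notin> Y" for x y
    using that assms(1,4) assms(2)[of x] assms(3)[of y] by (simp add: picone_def signed_pow_def)
  consider "x \<in> Y" "y \<in> Y" | "x \<in> Y" "y \<notin> Y" | "x \<notin> Y" "y \<in> Y" | "x \<notin> Y" "y \<notin> Y" by blast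
  then show ?thesis
  proof cases
    case 1 then show ?thesis using picone_nonneg assms by simp
  next
    case 2 then show ?thesis using one by simp
  next
    case 3 then show ?thesis using one[of y x] picone_commute by (metis order_refl)
  next
    case 4 then show ?thesis using assms by (simp add: picone_def)
  qed
qed

text \<open>All Picone terms are nonnegative, so each of them is bounded by the whole double sum. The
  diagonal term is zero and gives the Hardy inequality; the others give uniqueness of the ground state.\<close>

lemma hardy_gap:
  assumes "p > 1" "p * \<sigma> > 0" "positive_supersolution p \<sigma> Y w v" "\<phi> \<in> C_c Y"
  shows "edge_weight p \<sigma> x y * picone p (v x) (v y) (\<phi> x) (\<phi> y)
     \<le> 2 * (frac_p_energy p \<sigma> \<phi> - (\<Sum>\<^sub>\<infinity>x\<in>Y. w x * \<bar>\<phi> x\<bar> powr p))"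
proof -
  let ?k = "\<lambda>(x, y). edge_weight p \<sigma> x y * picone p (v x) (v y) (\<phi> x) (\<phi> y)"
  have v: "v \<in> F_space p \<sigma>" "\<And>x. x \<in> Y \<Longrightarrow> v x > 0" "\<And>x. x \<notin> Y \<Longrightarrow> v x = 0"
      "\<And>x. x \<in> Y \<Longrightarrow> w x * v x powr (p - 1) \<le> frac_p_Laplacian p \<sigma> v x"
    using assms by (auto simp: positive_supersolution_def)
  have \<phi>: "finite {x. \<phi> x \<noteq> 0}" "\<And>x. x \<notin> Y \<Longrightarrow> \<phi> x = 0"
    using assms by (auto simp: C_c_def)
  note h = ground_state_identity[OF assms(1,2) v(1) \<phi>(1)]
  have nn: "?k z \<ge> 0" for z
  proof -
    have "edge_weight p \<sigma> (fst z) (snd z) * picone p (v (fst z)) (v (snd z)) (\<phi> (fst z)) (\<phi> (snd z)) \<ge> 0"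
      by (intro mult_nonneg_nonneg edge_weight_nonneg picone_supersolution_nonneg[where Y = Y] v \<phi> assms(1))
    then show ?thesis by (simp add: case_prod_unfold)
  qed
  have "?k (x, y) \<le> 2 * (frac_p_energy p \<sigma> \<phi> -
        (\<Sum>x | \<phi> x \<noteq> 0. frac_p_Laplacian p \<sigma> v x / v x powr (p - 1) * \<bar>\<phi> x\<bar> powr p))"
    using finite_sum_le_has_sum[OF h, of "{(x, y)}"] nn by simp
  also have "\<dots> \<le> 2 * (frac_p_energy p \<sigma> \<phi> - (\<Sum>x | \<phi> x \<noteq> 0. w x * \<bar>\<phi> x\<bar> powr p))"
  proof -
    have "(\<Sum>x | \<phi> x \<noteq> 0. w x * \<bar>\<phi> x\<bar> powr p)
       \<le> (\<Sum>x | \<phi> x \<noteq> 0. frac_p_Laplacian p \<sigma> v x / v x powr (p - 1) * \<bar>\<phi> x\<bar> powr p)"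
    proof (intro sum_mono mult_right_mono)
      fix x assume "x \<in> {x. \<phi> x \<noteq> 0}"
      then have "x \<in> Y" using \<phi> by blast
      then show "w x \<le> frac_p_Laplacian p \<sigma> v x / v x powr (p - 1)"
        using v(2,4)[of x] by (simp add: pos_le_divide_eq)
    qed auto
    then show ?thesis by simp
  qed
  finally show ?thesis using infsum_support[OF assms(4)] by simp
qed

lemma supersolution_hardy:
  assumes "p > 1" "p * \<sigma> > 0" "positive_supersolution p \<sigma> Y w v"
  shows "hardy_type_weight p \<sigma> Y w"
  unfolding hardy_type_weight_def
proof
  fix \<phi> assume "\<phi> \<in> C_c Y"
  from hardy_gap[OF assms this, of 0 0] 
  show "(\<Sum>\<^sub>\<infinity>x\<in>Y. w x * \<bar>\<phi> x\<bar> powr p) \<le> frac_p_energy p \<sigma> \<phi>"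
    by (simp add: edge_weight_def)
qed

lemma tendsto_picone:
  assumes "p > 0" "(s \<longlongrightarrow> s0) F" "(t \<longlongrightarrow> t0) F"
  shows "((\<lambda>n. picone p a b (s n) (t n)) \<longlongrightarrow> picone p a b s0 t0) F"
proof -
  have P: "((\<lambda>n. \<bar>f n\<bar> powr p) \<longlongrightarrow> \<bar>l\<bar> powr p) F" if "(f \<longlongrightarrow> l) F" for f l
    using assms(1) by (intro tendsto_powr' tendsto_rabs that tendsto_const) auto
  have D: "((\<lambda>n. c * (\<bar>s n\<bar> powr p * k1 - \<bar>t n\<bar> powr p * k2)) \<longlongrightarrow> c * (\<bar>s0\<bar> powr p * k1 - \<bar>t0\<bar> powr p * k2)) F"
    for c k1 k2
    by (intro tendsto_mult_left tendsto_diff tendsto_mult_right P assms)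
  show ?thesis
    using tendsto_diff[OF P[OF tendsto_diff[OF assms(2,3)]]
       D[of "signed_pow (a - b) (p - 1)" "inverse (a powr (p - 1))" "inverse (b powr (p - 1))"]]
    by (simp add: picone_def divide_inverse)
qed

text \<open>A larger Hardy-type weight \<open>w'\<close> would lower the excess of \<open>e n\<close> by
  at least \<open>(w' x - w x) \<bar>e n x\<bar>\<^sup>p\<close>, whose limit is positive if \<open>w' x > w x\<close>; this would make the excess of \<open>w'\<close>
  negative. If \<open>v\<close> is another positive supersolution, the excess also
  dominates every Picone term of \<open>v\<close>; in the limit these vanish at \<open>u\<close>, and the equality case makes
  \<open>v\<close> a multiple of \<open>u\<close>.\<close>

lemma null_family_critical:
  assumes "p > 1" "p * \<sigma> > 0" "positive_supersolution p \<sigma> Y w u"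
    and F: "F \<noteq> bot"
    and e: "\<forall>\<^sub>F n in F. e n \<in> C_c Y" "\<And>x. x \<in> Y \<Longrightarrow> ((\<lambda>n. e n x) \<longlongrightarrow> u x) F"
    and gap: "((\<lambda>n. frac_p_energy p \<sigma> (e n) - (\<Sum>\<^sub>\<infinity>x\<in>Y. w x * \<bar>e n x\<bar> powr p)) \<longlongrightarrow> 0) F"
  shows "p_critical p \<sigma> Y w" "agmon_ground_state p \<sigma> Y w u"
proof -
  have up: "\<And>x. x \<in> Y \<Longrightarrow> u x > 0" "\<And>x. x \<notin> Y \<Longrightarrow> u x = 0"
    using assms by (auto simp: positive_supersolution_def)
  have False if h: "hardy_type_weight p \<sigma> Y w'" and ge: "\<And>x. x \<in> Y \<Longrightarrow> w x \<le> w' x" and x: "x \<in> Y" "w' x \<noteq> w x"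
    for w' x
  proof -
    have "\<forall>\<^sub>F n in F. (w' x - w x) * \<bar>e n x\<bar> powr p
       \<le> frac_p_energy p \<sigma> (e n) - (\<Sum>\<^sub>\<infinity>x\<in>Y. w x * \<bar>e n x\<bar> powr p)"
      using e(1)
    proof eventually_elim
      case (elim n)
      have fin: "finite {x. e n x \<noteq> 0}" and sub: "{x. e n x \<noteq> 0} \<subseteq> Y" using elim by (auto simp: C_c_def)
      have "(\<Sum>\<^sub>\<infinity>x\<in>Y. w' x * \<bar>e n x\<bar> powr p) \<le> frac_p_energy p \<sigma> (e n)"
        using h elim by (auto simp: hardy_type_weight_def)
      moreover have "(w' x - w x) * \<bar>e n x\<bar> powr p \<le> (\<Sum>x | e n x \<noteq> 0. (w' x - w x) * \<bar>e n x\<bar> powr p)"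
      proof (cases "e n x = 0")
        case False
        then show ?thesis
          using fin sub ge by (intro member_le_sum) (auto intro!: mult_nonneg_nonneg)
      qed (use fin sub ge in \<open>auto intro!: sum_nonneg mult_nonneg_nonneg\<close>)
      ultimately show ?case
        unfolding infsum_support[OF elim] by (simp add: left_diff_distrib sum_subtractf)
    qed
    moreover have "((\<lambda>n. (w' x - w x) * \<bar>e n x\<bar> powr p) \<longlongrightarrow> (w' x - w x) * \<bar>u x\<bar> powr p) F"
      using up(1)[OF x(1)] e(2)[OF x(1)] by (intro tendsto_intros) auto
    ultimately have "(w' x - w x) * \<bar>u x\<bar> powr p \<le> 0"
      using gap F by (intro tendsto_le[OF F gap]) auto
    moreover have "(w' x - w x) * \<bar>u x\<bar> powr p > 0"
      using ge[OF x(1)] x up(1)[OF x(1)] by (intro mult_pos_pos) auto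
    ultimately show False by simp
  qed
  then show "p_critical p \<sigma> Y w"
    unfolding p_critical_def using supersolution_hardy[OF assms(1-3)] by blast
  have "\<exists>c>0. \<forall>x. v x = c * u x" if v: "positive_supersolution p \<sigma> Y w v" for v
  proof (cases "Y = {}")
    case True
    then show ?thesis using v up by (intro exI[of _ 1]) (auto simp: positive_supersolution_def)
  next
    case False
    then obtain x0 where x0: "x0 \<in> Y" by auto
    have vp: "\<And>x. x \<in> Y \<Longrightarrow> v x > 0" "\<And>x. x \<notin> Y \<Longrightarrow> v x = 0"
      using v by (auto simp: positive_supersolution_def)
    have eq: "u x * v x0 = u x0 * v x" if x: "x \<in> Y" for x
    proof (cases "x = x0")
      case False
      have "((\<lambda>n. edge_weight p \<sigma> x x0 * picone p (v x) (v x0) (e n x) (e n x0)) \<longlongrightarrow>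
         edge_weight p \<sigma> x x0 * picone p (v x) (v x0) (u x) (u x0)) F"
        using assms(1) by (intro tendsto_mult_left tendsto_picone e x x0) auto
      moreover have "((\<lambda>n. 2 * (frac_p_energy p \<sigma> (e n) - (\<Sum>\<^sub>\<infinity>x\<in>Y. w x * \<bar>e n x\<bar> powr p))) \<longlongrightarrow> 2 * 0) F"
        by (intro tendsto_intros gap)
      moreover have "\<forall>\<^sub>F n in F. edge_weight p \<sigma> x x0 * picone p (v x) (v x0) (e n x) (e n x0)
         \<le> 2 * (frac_p_energy p \<sigma> (e n) - (\<Sum>\<^sub>\<infinity>x\<in>Y. w x * \<bar>e n x\<bar> powr p))"
        using e(1) by eventually_elim (rule hardy_gap[OF assms(1,2) v])
      ultimately have "edge_weight p \<sigma> x x0 * picone p (v x) (v x0) (u x) (u x0) \<le> 2 * 0"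
        by (intro tendsto_le[OF F])
      then have "picone p (v x) (v x0) (u x) (u x0) \<le> 0"
        using edge_weight_pos[OF False, of p \<sigma>] by (simp add: mult_le_0_iff)
      then show ?thesis using picone_equality[OF assms(1) vp(1)[OF x] vp(1)[OF x0] up(1)[OF x] up(1)[OF x0]] by simp
    qed simp
    have cx: "v x = v x0 / u x0 * u x" for x
      using eq[of x] up(1)[OF x0] up(2)[of x] vp(2)[of x] by (cases "x \<in> Y") (auto simp: field_simps)
    show ?thesis
    proof (intro exI conjI allI)
      show "v x0 / u x0 > 0" using vp(1)[OF x0] up(1)[OF x0] by simp
    qed (rule cx)
  qed
  then show "agmon_ground_state p \<sigma> Y w u"
    using assms(3) by (auto simp: agmon_ground_state_def)
qed

section \<open>Logarithmic cut-offs and criticality\<close>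

definition pow_fun :: "real \<Rightarrow> real \<Rightarrow> int \<Rightarrow> real" where
  "pow_fun a \<beta> x = (if x = 0 then \<beta> else \<bar>real_of_int x\<bar> powr (- a))"

lemma u_fun_eq: "u_fun q \<alpha> \<beta> = pow_fun (1 - q * \<alpha>) \<beta>"
  by (auto simp: u_fun_def pow_fun_def fun_eq_iff)

lemma pow_fun_le_1:
  assumes "a > 0" "x \<noteq> 0"
  shows "pow_fun a \<beta> x \<le> 1"
proof -
  have "\<bar>real_of_int x\<bar> powr (- a) \<le> \<bar>real_of_int x\<bar> powr 0" using assms by (intro powr_mono) auto
  then show ?thesis using assms by (simp add: pow_fun_def)
qed

lemma pow_fun_F_space:
  assumes "p > 1" "p * \<sigma> > 0" "a > 0" "\<beta> \<ge> 0"
  shows "pow_fun a \<beta> \<in> F_space p \<sigma>"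
proof (rule bounded_in_F_space[where M = "max 1 \<beta>"])
  show "\<bar>pow_fun a \<beta> x\<bar> \<le> max 1 \<beta>" for x
    using pow_fun_le_1[OF assms(3), of x \<beta>] assms(4) by (cases "x = 0") (auto simp: pow_fun_def)
qed (use assms in auto)

definition log_cut :: "real \<Rightarrow> real \<Rightarrow> real" where
  "log_cut \<epsilon> z = max 0 (1 + \<epsilon> * ln z)"

lemma log_cut_mono: "0 < \<epsilon> \<Longrightarrow> 0 < z \<Longrightarrow> z \<le> z' \<Longrightarrow> log_cut \<epsilon> z \<le> log_cut \<epsilon> z'"
  unfolding log_cut_def by (intro max.mono add_mono mult_left_mono) auto

text \<open>Put \<open>g z = z * \<psi> z\<close> with \<open>\<psi> z = 1 + \<epsilon> ln z\<close>, and let \<open>c\<close> be the slope of \<open>g\<close> between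
  \<open>b\<close> and \<open>a\<close>. With \<open>\<Phi>\<close> as in the proof, the Picone term is \<open>(a - b) powr (p - 1) * (\<Phi> a - \<Phi> b)\<close>: the
  linear part of \<open>\<Phi>\<close> contributes \<open>c powr p\<close>, and the part \<open>g z - c * z\<close> cancels by the choice of \<open>c\<close>. By the tangent
  inequality at \<open>c\<close>, and as \<open>g' = \<psi> + \<epsilon>\<close>, the derivative of \<open>\<Phi>\<close> is at most the second order remainder
  bounded in the hypothesis. The logarithm is what makes \<open>z * \<psi>' z\<close> the constant \<open>\<epsilon>\<close>.\<close>

lemma picone_log_cut_above_threshold:
  fixes p \<epsilon> b a B \<delta> :: real
  assumes "p > 1" "\<epsilon> > 0" "0 < b" "b < a" and b: "1 + \<epsilon> * ln b \<ge> 0" and B: "1 + \<epsilon> * ln a \<le> B"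
    and H: "\<And>\<psi>. 0 \<le> \<psi> \<Longrightarrow> \<psi> \<le> B \<Longrightarrow> (\<psi> + \<epsilon>) powr p - \<psi> powr p - p * \<epsilon> * \<psi> powr (p - 1) \<le> \<delta>"
  shows "picone p a b (a * log_cut \<epsilon> a) (b * log_cut \<epsilon> b) \<le> \<delta> * (a - b) powr p"
proof -
  define \<psi> where "\<psi> r = 1 + \<epsilon> * ln r" for r
  define g where "g r = r * \<psi> r" for r
  have \<psi>_mono: "\<psi> r < \<psi> r'" if "0 < r" "r < r'" for r r'
    using that assms(2) by (simp add: \<psi>_def)
  have \<psi>0: "\<psi> b \<ge> 0" using b by (simp add: \<psi>_def)
  have \<psi>p: "\<psi> r > 0" if "b < r" for r using \<psi>_mono[of b r] that \<psi>0 assms(3) by linarith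
  have cut: "log_cut \<epsilon> a = \<psi> a" "log_cut \<epsilon> b = \<psi> b"
    using \<psi>p[OF assms(4)] \<psi>0 by (auto simp: log_cut_def \<psi>_def)
  \<comment> \<open>The slope \<open>c\<close> is the point at which the tangent inequality is applied.\<close>
  define c where "c = (g a - g b) / (a - b)"
  have "g b < g a" unfolding g_def
    using assms \<psi>0 \<psi>_mono[of b a] by (intro mult_strict_mono) auto
  then have c: "c > 0" using assms(4) by (simp add: c_def)
  define \<Phi> where "\<Phi> r = c powr p * r + p * c powr (p - 1) * (g r - c * r) - r * \<psi> r powr p" for r
  define \<Phi>' where "\<Phi>' r = c powr p + p * c powr (p - 1) * (\<psi> r + \<epsilon> - c) -
      (\<psi> r powr p + p * \<epsilon> * \<psi> r powr (p - 1))" for r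
  have d\<psi>: "(\<psi> has_real_derivative \<epsilon> / r) (at r)" if "0 < r" for r
    unfolding \<psi>_def using that by (auto intro!: derivative_eq_intros)
  have dg: "(g has_real_derivative \<psi> r + \<epsilon>) (at r)" if "0 < r" for r
    unfolding g_def using that by (auto intro!: derivative_eq_intros d\<psi> simp: field_simps)
  have dp: "((\<lambda>r. r * \<psi> r powr p) has_real_derivative (\<psi> r powr p + p * \<epsilon> * \<psi> r powr (p - 1))) (at r)"
    if "b < r" for r
  proof -
    have r: "0 < r" using that assms by simp
    have "((\<lambda>r. \<psi> r powr p) has_real_derivative p * \<psi> r powr (p - 1) * (\<epsilon> / r)) (at r)"
      using DERIV_fun_powr[OF d\<psi>[OF r] \<psi>p[OF that], of p] by simp
    from DERIV_mult[OF DERIV_ident this] show ?thesis using r by (simp add: field_simps)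
  qed
  have d\<Phi>: "(\<Phi> has_real_derivative \<Phi>' r) (at r)" if "b < r" for r
  proof -
    have r: "0 < r" using that assms by simp
    have "((\<lambda>r. c powr p * r + p * c powr (p - 1) * (g r - c * r) - r * \<psi> r powr p) has_real_derivative
      c powr p * 1 + p * c powr (p - 1) * ((\<psi> r + \<epsilon>) - c * 1) - (\<psi> r powr p + p * \<epsilon> * \<psi> r powr (p - 1))) (at r)"
      by (intro DERIV_diff DERIV_add DERIV_cmult DERIV_ident dg dp that r)
    then show ?thesis unfolding \<Phi>_def \<Phi>'_def by simp
  qed
  have c1: "continuous_on {b..a} \<psi>" unfolding \<psi>_def using assms by (intro continuous_intros) auto
  have c2: "continuous_on {b..a} (\<lambda>x. \<psi> x powr p)"
  proof (rule continuous_on_powr'[OF c1 continuous_on_const], intro ballI conjI impI)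
    fix x assume x: "x \<in> {b..a}"
    show "0 \<le> \<psi> x" using x \<psi>0 \<psi>p[of x] by (cases "x = b") auto
    show "0 < p" using assms by simp
  qed
  have "continuous_on {b..a} \<Phi>"
    unfolding \<Phi>_def g_def
    by (intro continuous_on_diff continuous_on_add continuous_on_mult continuous_on_const continuous_on_id c1 c2)
  then obtain z where z: "b < z" "z < a" "\<Phi> a - \<Phi> b = (a - b) * \<Phi>' z"
    using mvt[of b a \<Phi> "\<lambda>z. (*) (\<Phi>' z)"] assms(4) d\<Phi>
    by (auto simp: has_field_derivative_def mult.commute)
  have "\<Phi>' z \<le> (\<psi> z + \<epsilon>) powr p - \<psi> z powr p - p * \<epsilon> * \<psi> z powr (p - 1)"
    unfolding \<Phi>'_def using powr_above_tangent(1)[OF assms(1) _ c, of "\<psi> z + \<epsilon>"] \<psi>p[OF z(1)] assms(2) by simp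
  also have "\<dots> \<le> \<delta>"
  proof (rule H)
    show "0 \<le> \<psi> z" using \<psi>p[OF z(1)] by simp
    show "\<psi> z \<le> B" using \<psi>_mono[of z a] z assms(3) B by (simp add: \<psi>_def)
  qed
  finally have le: "\<Phi> a - \<Phi> b \<le> (a - b) * \<delta>"
    unfolding z(3) using assms by (intro mult_left_mono) auto
  have gc: "g a - g b = c * (a - b)" using assms by (simp add: c_def)
  have \<Phi>d: "\<Phi> a - \<Phi> b = c powr p * (a - b) - (a * \<psi> a powr p - b * \<psi> b powr p)"
  proof -
    have "\<Phi> a - \<Phi> b = c powr p * (a - b) + p * c powr (p - 1) * (g a - g b - c * (a - b))
        - (a * \<psi> a powr p - b * \<psi> b powr p)"
      unfolding \<Phi>_def by (simp add: algebra_simps)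
    then show ?thesis using gc by simp
  qed
  have pw: "z powr p = z * z powr (p - 1)" if "z > 0" for z :: real
    using that by (simp add: powr_mult_base)
  have fr: "\<bar>z * \<psi> z\<bar> powr p / z powr (p - 1) = z * \<psi> z powr p" if "z > 0" "\<psi> z \<ge> 0" for z
  proof -
    have "\<bar>z * \<psi> z\<bar> powr p = z powr p * \<psi> z powr p" using that by (simp add: abs_mult powr_mult)
    then show ?thesis using that pw[of z] by simp
  qed
  have "picone p a b (a * \<psi> a) (b * \<psi> b) =
      (g a - g b) powr p - (a - b) powr (p - 1) * (a * \<psi> a powr p - b * \<psi> b powr p)"
  proof -
    have "\<bar>g a - g b\<bar> = g a - g b" using \<open>g b < g a\<close> by simp
    moreover have "signed_pow (a - b) (p - 1) = (a - b) powr (p - 1)"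
      using assms(4) by (simp add: signed_pow_def)
    ultimately show ?thesis
      using fr[of a] fr[of b] \<psi>p[OF assms(4)] \<psi>0 assms(3,4) by (simp add: picone_def g_def)
  qed
  also have "\<dots> = (a - b) powr (p - 1) * (\<Phi> a - \<Phi> b)"
  proof -
    have "(g a - g b) powr p = c powr p * (a - b) powr p"
      unfolding gc using c assms by (simp add: powr_mult)
    then show ?thesis unfolding \<Phi>d using pw[of "a - b"] assms(4) by (simp add: algebra_simps)
  qed
  also have "\<dots> \<le> (a - b) powr (p - 1) * ((a - b) * \<delta>)"
    using le by (intro mult_left_mono) auto
  also have "\<dots> = \<delta> * (a - b) powr p" using assms(4) by (subst pw) auto
  finally show ?thesis unfolding cut .
qed

text \<open>Below the threshold \<open>r = exp (- 1 / \<epsilon>)\<close> the cut-off vanishes, and moving \<open>b\<close> up to the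
  threshold only increases the Picone term.\<close>

lemma picone_log_cut:
  fixes p \<epsilon> b a B \<delta> :: real
  assumes "p > 1" "\<epsilon> > 0" "0 \<le> b" "b \<le> a" and B: "1 + \<epsilon> * ln a \<le> B" and "0 \<le> \<delta>"
    and H: "\<And>\<psi>. 0 \<le> \<psi> \<Longrightarrow> \<psi> \<le> B \<Longrightarrow> (\<psi> + \<epsilon>) powr p - \<psi> powr p - p * \<epsilon> * \<psi> powr (p - 1) \<le> \<delta>"
  shows "picone p a b (a * log_cut \<epsilon> a) (b * log_cut \<epsilon> b)
     \<le> (if a * log_cut \<epsilon> a = 0 then 0 else \<delta> * \<bar>a - b\<bar> powr p)"
proof (cases "a * log_cut \<epsilon> a = 0")
  case True
  have "b * log_cut \<epsilon> b = 0"
  proof (cases "b = 0")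
    case False
    then have "0 < b" "log_cut \<epsilon> a = 0" using assms True by auto
    then show ?thesis using log_cut_mono[of \<epsilon> b a] assms by (auto simp: log_cut_def)
  qed simp
  then have "picone p a b (a * log_cut \<epsilon> a) (b * log_cut \<epsilon> b) = 0"
    unfolding True by (simp only: picone_def) simp
  then show ?thesis unfolding True by simp
next
  case False
  then have "a > 0" "log_cut \<epsilon> a > 0" using assms by (auto simp: log_cut_def max_def split: if_splits)
  then have pa: "1 + \<epsilon> * ln a > 0" by (auto simp: log_cut_def)
  define r where "r = exp (- 1 / \<epsilon>)"
  have r: "r > 0" "1 + \<epsilon> * ln r = 0" using assms by (auto simp: r_def)
  have ra: "r < a"
  proof -
    have "ln r < ln a" using pa r(2) assms(2) by (smt (verit) mult_less_cancel_left_pos)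
    then show ?thesis using r \<open>a > 0\<close> by simp
  qed
  show ?thesis
  proof (cases "r \<le> b")
    case True
    then have "1 + \<epsilon> * ln b \<ge> 0" using r assms(2)
      by (smt (verit) ln_le_cancel_iff mult_left_mono)
    then show ?thesis
      using picone_log_cut_above_threshold[OF assms(1,2) _ _ _ B H, of b] True r assms False
      by (cases "b = a") (auto simp: picone_def signed_pow_def)
  next
    case b: False
    have cr: "log_cut \<epsilon> r = 0" using r by (simp add: log_cut_def)
    have cb: "b * log_cut \<epsilon> b = 0"
    proof (cases "b = 0")
      case False
      then show ?thesis using log_cut_mono[of \<epsilon> b r] b assms cr by (auto simp: log_cut_def)
    qed simp
    have "picone p a b (a * log_cut \<epsilon> a) (b * log_cut \<epsilon> b) \<le> picone p a r (a * log_cut \<epsilon> a) (r * log_cut \<epsilon> r)"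
    proof -
      have "(a - r) powr (p - 1) * (\<bar>a * log_cut \<epsilon> a\<bar> powr p / a powr (p - 1))
        \<le> (a - b) powr (p - 1) * (\<bar>a * log_cut \<epsilon> a\<bar> powr p / a powr (p - 1))"
        using ra b assms(1) by (intro mult_right_mono powr_mono2) auto
      then show ?thesis unfolding cb cr using ra b by (simp add: picone_def signed_pow_def)
    qed
    also have "\<dots> \<le> \<delta> * (a - r) powr p"
      using picone_log_cut_above_threshold[OF assms(1,2) r(1) ra _ B H] r by simp
    also have "\<dots> \<le> \<delta> * \<bar>a - b\<bar> powr p"
      using ra b assms by (intro mult_left_mono powr_mono2) auto
    finally show ?thesis using False by simp
  qed
qed

text \<open>For \<open>p < 2\<close> the remainder is not \<open>O(\<epsilon>\<^sup>2)\<close> uniformly down to \<open>\<psi> = 0\<close>; uniform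
  continuity of the derivative gives \<open>o(\<epsilon>)\<close> for all \<open>p > 1\<close>, which suffices.\<close>

lemma powr_second_order:
  fixes p B \<eta> :: real
  assumes "p > 1" "\<eta> > 0" "B \<ge> 0"
  shows "\<forall>\<^sub>F \<epsilon> in at_right 0. \<forall>\<psi>. 0 \<le> \<psi> \<longrightarrow> \<psi> \<le> B \<longrightarrow>
           (\<psi> + \<epsilon>) powr p - \<psi> powr p - p * \<epsilon> * \<psi> powr (p - 1) \<le> \<eta> * \<epsilon>"
proof -
  have "continuous_on {0..B + 1} (\<lambda>z::real. z powr (p - 1))"
    using assms by (intro continuous_on_powr' continuous_intros) auto
  then have "uniformly_continuous_on {0..B + 1} (\<lambda>z::real. z powr (p - 1))"
    by (intro compact_uniformly_continuous) auto
  moreover have "\<eta> / p > 0" using assms by simp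
  ultimately obtain d where d: "d > 0"
    "\<And>z z'. z \<in> {0..B + 1} \<Longrightarrow> z' \<in> {0..B + 1} \<Longrightarrow> dist z' z < d \<Longrightarrow> dist (z' powr (p - 1)) (z powr (p - 1)) < \<eta> / p"
    unfolding uniformly_continuous_on_def by metis
  have "\<forall>\<^sub>F \<epsilon> in at_right 0. \<epsilon> < min d 1"
    using d(1) by (intro eventually_at_right_real[THEN eventually_mono, of 0 "min d 1"]) auto
  moreover have "\<forall>\<^sub>F \<epsilon> in at_right (0::real). \<epsilon> > 0"
    by (rule eventually_at_right_less)
  ultimately show ?thesis
  proof eventually_elim
    case (elim \<epsilon>)
    show ?case
    proof (intro allI impI)
      fix \<psi> assume \<psi>: "0 \<le> \<psi>" "\<psi> \<le> B"
      have "dist ((\<psi> + \<epsilon>) powr (p - 1)) (\<psi> powr (p - 1)) < \<eta> / p"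
        using \<psi> elim by (intro d) (auto simp: dist_real_def)
      then have "(\<psi> + \<epsilon>) powr (p - 1) - \<psi> powr (p - 1) \<le> \<eta> / p" by (simp add: dist_real_def)
      then have "p * \<epsilon> * ((\<psi> + \<epsilon>) powr (p - 1) - \<psi> powr (p - 1)) \<le> p * \<epsilon> * (\<eta> / p)"
        using elim assms by (intro mult_left_mono) auto
      then show "(\<psi> + \<epsilon>) powr p - \<psi> powr p - p * \<epsilon> * \<psi> powr (p - 1) \<le> \<eta> * \<epsilon>"
        using powr_above_tangent(1)[OF assms(1) \<psi>(1), of "\<psi> + \<epsilon>"] \<psi> elim assms by (simp add: algebra_simps)
    qed
  qed
qed

lemma powr_le_telescoping_increment:
  fixes s k :: real
  assumes "0 < s" "s < 1" "k \<ge> 1"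
  shows "k powr (- s) \<le> (k powr (1 - s) - (k - 1) powr (1 - s)) / (1 - s)"
proof -
  have "\<exists>z. k - 1 < z \<and> z < k \<and> k powr (1 - s) - (k - 1) powr (1 - s) = (*) ((1 - s) * z powr (- s)) (k - (k - 1))"
  proof (rule mvt[of "k - 1" k, where f = "\<lambda>z. z powr (1 - s)" and f' = "\<lambda>z. (*) ((1 - s) * z powr (- s))"], goal_cases)
    case 2
    show "continuous_on {k - 1..k} (\<lambda>z. z powr (1 - s))"
      using assms by (intro continuous_on_powr' continuous_intros) auto
  next
    case (3 z)
    then have "((\<lambda>z. z powr (1 - s)) has_real_derivative ((1 - s) * z powr (- s))) (at z)"
      using assms by (auto intro!: derivative_eq_intros)
    then show "((\<lambda>z. z powr (1 - s)) has_derivative (*) ((1 - s) * z powr (- s))) (at z)"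
      by (simp add: has_field_derivative_def)
  next
    case (4 z) then show ?case by blast
  qed simp
  then obtain z where z: "k - 1 < z" "z < k" "k powr (1 - s) - (k - 1) powr (1 - s) = (1 - s) * z powr (- s)"
    by auto
  have "k powr (- s) \<le> z powr (- s)" using z assms by (intro powr_mono2') auto
  then show ?thesis using z assms by simp
qed

lemma powr_le_telescoping_decrement:
  fixes s k :: real
  assumes "0 < s" "k > 1"
  shows "k powr (- 1 - s) \<le> ((k - 1) powr (- s) - k powr (- s)) / s"
proof -
  obtain z where z: "k - 1 < z" "z < k" "k powr (- s) - (k - 1) powr (- s) = (k - (k - 1)) * (- s * z powr (- s - 1))"
    using MVT2[of "k - 1" k "\<lambda>z. z powr (- s)" "\<lambda>z. - s * z powr (- s - 1)"] assms
    by (force intro!: derivative_eq_intros)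
  have "k powr (- 1 - s) \<le> z powr (- 1 - s)" using z assms by (intro powr_mono2') auto
  then have "s * k powr (- 1 - s) \<le> s * z powr (- 1 - s)" using assms by simp
  moreover have "z powr (- 1 - s) = z powr (- s - 1)" by (rule arg_cong[where f = "\<lambda>t. z powr t"]) simp
  ultimately have "s * k powr (- 1 - s) \<le> (k - 1) powr (- s) - k powr (- s)" using z(3) by simp
  then show ?thesis using assms by (simp add: field_simps)
qed

text \<open>The summands are compared with the increments of \<open>V\<close>, the integral of the same
  kernel, which decreases.\<close>

lemma truncated_kernel_sum:
  fixes s :: real and X :: nat
  assumes "0 < s" "s < 1" "X \<ge> 1"
  shows "summable (\<lambda>j. real (Suc j) powr (- 1 - s) * min 1 (real (Suc j) / real X))"
    and "(\<Sum>j. real (Suc j) powr (- 1 - s) * min 1 (real (Suc j) / real X)) \<le> (1 / (1 - s) + 1 / s) * real X powr (- s)"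
proof -
  define V where "V k = (if k \<le> X then real k powr (1 - s) / (1 - s) / real X
      else real X powr (- s) / (1 - s) + (real X powr (- s) - real k powr (- s)) / s)" for k :: nat
  have XX: "real X powr (1 - s) = real X * real X powr (- s)"
    using assms by (simp add: powr_mult_base)
  have VX: "V X = real X powr (- s) / (1 - s) + (real X powr (- s) - real X powr (- s)) / s"
    using assms by (simp add: V_def XX)
  have step: "real (Suc j) powr (- 1 - s) * min 1 (real (Suc j) / real X) \<le> V (Suc j) - V j" for j
  proof (cases "Suc j \<le> X")
    case True
    have "real (Suc j) powr (- 1 - s) * min 1 (real (Suc j) / real X)
        = real (Suc j) * real (Suc j) powr (- 1 - s) / real X"
      using True assms by (simp add: min_absorb2)
    also have "\<dots> = real (Suc j) powr (- s) / real X" by (subst powr_mult_base) auto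
    also have "\<dots> \<le> (real (Suc j) powr (1 - s) - (real (Suc j) - 1) powr (1 - s)) / (1 - s) / real X"
      using assms by (intro divide_right_mono powr_le_telescoping_increment) auto
    also have "\<dots> = V (Suc j) - V j" using True by (simp add: V_def diff_divide_distrib)
    finally show ?thesis .
  next
    case False
    then have jX: "j \<ge> X" by simp
    have "real (Suc j) powr (- 1 - s) * min 1 (real (Suc j) / real X) \<le> real (Suc j) powr (- 1 - s) * 1"
      by (intro mult_left_mono) auto
    also have "\<dots> \<le> ((real (Suc j) - 1) powr (- s) - real (Suc j) powr (- s)) / s"
      using assms jX unfolding mult_1_right by (intro powr_le_telescoping_decrement) auto
    also have "\<dots> = V (Suc j) - V j"
    proof -
      have "V j = real X powr (- s) / (1 - s) + (real X powr (- s) - real j powr (- s)) / s"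
        using jX VX by (cases "j = X") (auto simp: V_def)
      then show ?thesis using False by (simp add: V_def diff_divide_distrib)
    qed
    finally show ?thesis .
  qed
  have V0: "V 0 = 0" by (simp add: V_def)
  have Vle: "V k \<le> (1 / (1 - s) + 1 / s) * real X powr (- s)" for k
  proof (cases "k \<le> X")
    case True
    have "real k powr (1 - s) \<le> real X powr (1 - s)" using True assms by (intro powr_mono2) auto
    then have "real k powr (1 - s) / (1 - s) / real X \<le> real X powr (1 - s) / (1 - s) / real X"
      using assms by (intro divide_right_mono) auto
    also have "\<dots> = 1 / (1 - s) * real X powr (- s)" using assms by (simp add: XX)
    also have "\<dots> \<le> (1 / (1 - s) + 1 / s) * real X powr (- s)"
      using assms by (intro mult_right_mono) auto
    finally show ?thesis using True by (simp add: V_def)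
  next
    case False
    have "(real X powr (- s) - real k powr (- s)) / s \<le> real X powr (- s) / s"
      using assms by (intro divide_right_mono) auto
    then show ?thesis using False by (simp add: V_def algebra_simps)
  qed
  have partial: "(\<Sum>j<n. real (Suc j) powr (- 1 - s) * min 1 (real (Suc j) / real X))
      \<le> (1 / (1 - s) + 1 / s) * real X powr (- s)" for n
  proof -
    have "(\<Sum>j<n. real (Suc j) powr (- 1 - s) * min 1 (real (Suc j) / real X)) \<le> (\<Sum>j<n. V (Suc j) - V j)"
      by (intro sum_mono step)
    also have "\<dots> = V n" by (simp add: sum_lessThan_telescope V0)
    finally show ?thesis using Vle[of n] by simp
  qed
  show S: "summable (\<lambda>j. real (Suc j) powr (- 1 - s) * min 1 (real (Suc j) / real X))"
    by (rule summableI_nonneg_bounded[OF _ partial]) auto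
  show "(\<Sum>j. real (Suc j) powr (- 1 - s) * min 1 (real (Suc j) / real X)) \<le> (1 / (1 - s) + 1 / s) * real X powr (- s)"
    by (rule suminf_le_const[OF S partial])
qed

text \<open>If \<open>u y \<le> u x\<close>, then \<open>u x - u y\<close> is at most \<open>u x * min 1 (\<bar>x - y\<bar> / \<bar>x\<bar>)\<close>, because
  \<open>a < 1\<close>. Only edges towards smaller values of \<open>u\<close> are counted, so that each edge is charged to the
  endpoint with the larger value, where the cut-off is positive if it is so at either end.\<close>

lemma pow_fun_row_bound:
  fixes p \<sigma> a \<beta> :: real and x :: int
  assumes p: "p > 1" and s: "0 < p * \<sigma>" "p * \<sigma> < 1" and a: "0 < a" "a < 1"
    and \<beta>: "\<beta> = 0 \<or> \<beta> \<ge> 1" and crit: "p * \<sigma> + p * a \<ge> 1" and x: "x \<noteq> 0"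
  defines "k \<equiv> \<lambda>y. edge_weight p \<sigma> x y *
      (if pow_fun a \<beta> y \<le> pow_fun a \<beta> x then \<bar>pow_fun a \<beta> x - pow_fun a \<beta> y\<bar> powr p else 0)"
  shows "k summable_on UNIV"
    and "infsum k UNIV \<le> 2 * (1 / (1 - p * \<sigma>) + 1 / (p * \<sigma>)) / \<bar>real_of_int x\<bar>"
proof -
  define X where "X = nat \<bar>x\<bar>"
  have X: "X \<ge> 1" "real X = \<bar>real_of_int x\<bar>" using x by (auto simp: X_def)
  define \<kappa> where "\<kappa> z = \<bar>real_of_int z\<bar> powr (- 1 - p * \<sigma>) * min 1 (\<bar>real_of_int z\<bar> / real X)" for z :: int
  note tk = truncated_kernel_sum[OF s X(1)]
  have \<kappa>S: "\<kappa> (int (Suc j)) = real (Suc j) powr (- 1 - p * \<sigma>) * min 1 (real (Suc j) / real X)"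
      "\<kappa> (- int (Suc j)) = real (Suc j) powr (- 1 - p * \<sigma>) * min 1 (real (Suc j) / real X)" for j
    by (auto simp: \<kappa>_def add.commute)
  have \<kappa>sum: "\<kappa> summable_on UNIV"
  proof (rule int_abs_summable_onI)
    have "\<bar>real (Suc j) powr (- 1 - p * \<sigma>) * min 1 (real (Suc j) / real X)\<bar>
        = real (Suc j) powr (- 1 - p * \<sigma>) * min 1 (real (Suc j) / real X)" for j
      by (rule abs_of_nonneg) simp
    then show "summable (\<lambda>j. \<bar>\<kappa> (int (Suc j))\<bar>)" "summable (\<lambda>j. \<bar>\<kappa> (- int (Suc j))\<bar>)"
      using tk(1) unfolding \<kappa>S by presburger+
  qed
  have \<kappa>le: "infsum \<kappa> UNIV \<le> 2 * ((1 / (1 - p * \<sigma>) + 1 / (p * \<sigma>)) * real X powr (- (p * \<sigma>)))"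
    using tk(2) unfolding int_infsum_split(3)[OF \<kappa>sum] \<kappa>S by (simp add: \<kappa>_def)
  have bij: "bij_betw (\<lambda>y. x - y) UNIV (UNIV :: int set)"
    by (rule bij_betw_byWitness[where f' = "\<lambda>y. x - y"]) auto
  have sh: "(\<lambda>y. \<kappa> (x - y)) summable_on UNIV" "infsum (\<lambda>y. \<kappa> (x - y)) UNIV = infsum \<kappa> UNIV"
    using summable_on_reindex_bij_betw[OF bij, of \<kappa>] infsum_reindex_bij_betw[OF bij, of \<kappa>] \<kappa>sum by auto
  have ux: "pow_fun a \<beta> x = real X powr (- a)" using x X by (simp add: pow_fun_def)
  have diff: "\<bar>pow_fun a \<beta> x - pow_fun a \<beta> y\<bar> \<le> real X powr (- a) * min 1 (\<bar>real_of_int (x - y)\<bar> / real X)"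
    if le: "pow_fun a \<beta> y \<le> pow_fun a \<beta> x" for y
  proof (cases "y = 0")
    case True
    have "real X powr (- a) \<le> 1" using pow_fun_le_1[OF a(1) x, of \<beta>] ux by simp
    then have "\<beta> = 0 \<or> \<beta> = pow_fun a \<beta> x" using le True \<beta> ux by (auto simp: pow_fun_def)
    then show ?thesis using True X ux by (auto simp: pow_fun_def)
  next
    case False
    define Z where "Z = \<bar>real_of_int y\<bar>"
    have Z: "Z \<ge> 1" using False by (simp add: Z_def)
    have uy: "pow_fun a \<beta> y = Z powr (- a)" using False by (simp add: pow_fun_def Z_def)
    have XZ: "real X \<le> Z"
    proof (rule ccontr)
      assume "\<not> real X \<le> Z"
      then have "real X powr (- a) < Z powr (- a)" using Z a by (intro powr_less_mono2_neg) auto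
      then show False using le ux uy by simp
    qed
    have "real X / Z \<le> (real X / Z) powr a"
    proof -
      have "(real X / Z) powr 1 \<le> (real X / Z) powr a" using XZ X Z a by (intro powr_mono') auto
      then show ?thesis using X Z by simp
    qed
    then have "1 - (real X / Z) powr a \<le> (Z - real X) / Z" using Z by (simp add: field_simps)
    also have "\<dots> \<le> min 1 (\<bar>real_of_int (x - y)\<bar> / real X)"
    proof -
      have "(Z - real X) / Z \<le> 1" using Z by simp
      moreover have "(Z - real X) / Z \<le> \<bar>real_of_int (x - y)\<bar> / real X"
        using X XZ Z by (intro frac_le) (auto simp: Z_def)
      ultimately show ?thesis by simp
    qed
    finally have "real X powr (- a) * (1 - (real X / Z) powr a)
       \<le> real X powr (- a) * min 1 (\<bar>real_of_int (x - y)\<bar> / real X)"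
      by (intro mult_left_mono) auto
    moreover have "real X powr (- a) * (1 - (real X / Z) powr a) = pow_fun a \<beta> x - pow_fun a \<beta> y"
      using X Z unfolding ux uy by (simp add: powr_divide powr_minus field_simps)
    ultimately show ?thesis using le by simp
  qed
  have kle: "k y \<le> real X powr (- (p * a)) * \<kappa> (x - y)" for y
  proof (cases "pow_fun a \<beta> y \<le> pow_fun a \<beta> x")
    case True
    define m where "m = min 1 (\<bar>real_of_int (x - y)\<bar> / real X)"
    have m: "0 \<le> m" "m \<le> 1" by (auto simp: m_def)
    have "\<bar>pow_fun a \<beta> x - pow_fun a \<beta> y\<bar> powr p \<le> (real X powr (- a) * m) powr p"
      using diff[OF True] p unfolding m_def by (intro powr_mono2) auto
    also have "\<dots> = real X powr (- (p * a)) * m powr p"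
      using m by (simp add: powr_mult powr_powr mult.commute)
    also have "\<dots> \<le> real X powr (- (p * a)) * m"
      using powr_mono'[of 1 p m] m p by (intro mult_left_mono) auto
    finally have "k y \<le> edge_weight p \<sigma> x y * (real X powr (- (p * a)) * m)"
      unfolding k_def using True by (auto intro: mult_left_mono edge_weight_nonneg)
    then show ?thesis by (simp add: \<kappa>_def m_def edge_weight_alt algebra_simps)
  qed (auto simp: k_def \<kappa>_def)
  have k0: "k y \<ge> 0" for y by (auto simp: k_def edge_weight_nonneg)
  show ks: "k summable_on UNIV"
    using summable_on_cmult_right[OF sh(1)] by (rule summable_on_comparison_test) (use kle k0 in auto)
  have "infsum k UNIV \<le> infsum (\<lambda>y. real X powr (- (p * a)) * \<kappa> (x - y)) UNIV"
    using ks summable_on_cmult_right[OF sh(1)] kle by (intro infsum_mono) auto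
  also have "\<dots> = real X powr (- (p * a)) * infsum \<kappa> UNIV"
    using sh by (simp add: infsum_cmult_right)
  also have "\<dots> \<le> real X powr (- (p * a)) * (2 * ((1 / (1 - p * \<sigma>) + 1 / (p * \<sigma>)) * real X powr (- (p * \<sigma>))))"
    by (intro mult_left_mono \<kappa>le) auto
  also have "\<dots> = 2 * (1 / (1 - p * \<sigma>) + 1 / (p * \<sigma>)) * real X powr (- (p * \<sigma> + p * a))"
    using X by (simp add: powr_add[symmetric] algebra_simps)
  also have "\<dots> \<le> 2 * (1 / (1 - p * \<sigma>) + 1 / (p * \<sigma>)) * real X powr (- 1)"
    using X s crit by (intro mult_left_mono powr_mono) auto
  also have "\<dots> = 2 * (1 / (1 - p * \<sigma>) + 1 / (p * \<sigma>)) / \<bar>real_of_int x\<bar>"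
    using X by (simp add: powr_minus divide_inverse)
  finally show "infsum k UNIV \<le> 2 * (1 / (1 - p * \<sigma>) + 1 / (p * \<sigma>)) / \<bar>real_of_int x\<bar>" .
qed

lemma sum_inverse_abs_bound:
  fixes L :: real
  assumes "L \<ge> 0" "finite S" "\<And>x. x \<in> S \<Longrightarrow> x \<noteq> 0 \<and> \<bar>real_of_int x\<bar> \<le> exp L"
  shows "(\<Sum>x\<in>S. 1 / \<bar>real_of_int x\<bar>) \<le> 2 * (1 + L)"
proof -
  define n where "n = nat \<lfloor>exp L\<rfloor>"
  have n1: "n \<ge> 1" "real n \<le> exp L" using assms(1) by (auto simp: n_def le_nat_iff le_floor_iff)
  have h: "(\<Sum>k=1..m. 1 / real k) \<le> 1 + ln (real m)" if "m \<ge> 1" for m :: nat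
    using that
  proof (induction m rule: dec_induct)
    case (step m)
    have "ln (real m / real (Suc m)) \<le> real m / real (Suc m) - 1"
      using step by (intro ln_le_minus_one) auto
    then have "1 / real (Suc m) \<le> ln (real (Suc m)) - ln (real m)"
      using step by (simp add: ln_div field_simps)
    then show ?case using step by simp
  qed simp
  have "S \<subseteq> int ` {1..n} \<union> (\<lambda>k. - int k) ` {1..n}"
  proof
    fix x assume x: "x \<in> S"
    then have "\<bar>real_of_int x\<bar> \<le> exp L" "x \<noteq> 0" using assms by auto
    then have "nat \<bar>x\<bar> \<le> n" "nat \<bar>x\<bar> \<ge> 1" unfolding n_def by (auto simp: le_floor_iff intro!: nat_mono)
    moreover have "x = int (nat \<bar>x\<bar>) \<or> x = - int (nat \<bar>x\<bar>)" by auto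
    ultimately show "x \<in> int ` {1..n} \<union> (\<lambda>k. - int k) ` {1..n}" by (metis UnI1 UnI2 atLeastAtMost_iff image_eqI)
  qed
  then have "(\<Sum>x\<in>S. 1 / \<bar>real_of_int x\<bar>) \<le> (\<Sum>x\<in>int ` {1..n} \<union> (\<lambda>k. - int k) ` {1..n}. 1 / \<bar>real_of_int x\<bar>)"
    by (intro sum_mono2) auto
  also have "\<dots> \<le> (\<Sum>x\<in>int ` {1..n}. 1 / \<bar>real_of_int x\<bar>) + (\<Sum>x\<in>(\<lambda>k. - int k) ` {1..n}. 1 / \<bar>real_of_int x\<bar>)"
    using sum.union_inter[of "int ` {1..n}" "(\<lambda>k. - int k) ` {1..n}" "\<lambda>x. 1 / \<bar>real_of_int x\<bar>"]
    by (smt (verit) divide_nonneg_nonneg finite_atLeastAtMost finite_imageI sum_nonneg abs_ge_zero)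
  also have "\<dots> = 2 * (\<Sum>k=1..n. 1 / real k)"
    by (subst (1 2) sum.reindex) (auto simp: inj_on_def)
  also have "\<dots> \<le> 2 * (1 + ln (real n))" using h[OF n1(1)] by simp
  also have "\<dots> \<le> 2 * (1 + L)" using n1 by (metis add_left_mono ln_exp ln_mono mult_left_mono of_nat_0_less_iff order_less_le_trans zero_le_numeral zero_less_one)
  finally show ?thesis .
qed


text \<open>The excess of the cut-off at scale \<open>\<epsilon>\<close> is at most \<open>\<eta> \<epsilon>\<close> times the energy of \<open>u\<close> inside
  \<open>\<bar>x\<bar> \<le> exp (1 / (a \<epsilon>))\<close>, which is \<open>O(1 / \<epsilon>)\<close>; and \<open>\<eta>\<close> is arbitrary.\<close>

lemma pow_fun_critical:
  fixes p \<sigma> a \<beta> :: real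
  assumes p: "p > 1" and s: "0 < p * \<sigma>" "p * \<sigma> < 1" and a: "0 < a" "a < 1"
    and Y: "\<beta> = 0 \<and> Y = UNIV - {0} \<or> \<beta> \<ge> 1 \<and> Y = UNIV" and crit: "p * \<sigma> + p * a \<ge> 1"
  defines "u \<equiv> pow_fun a \<beta>"
  defines "w \<equiv> \<lambda>x. frac_p_Laplacian p \<sigma> u x / u x powr (p - 1)"
  shows "p_critical p \<sigma> Y w" "agmon_ground_state p \<sigma> Y w u"
proof -
  define e where "e \<epsilon> x = u x * log_cut \<epsilon> (u x)" for \<epsilon> x
  define M where "M = max 1 \<beta>"
  have \<beta>: "\<beta> = 0 \<or> \<beta> \<ge> 1" using Y by auto
  have upos: "u x > 0" if "x \<in> Y" for x using that Y by (auto simp: u_def pow_fun_def)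
  have uoff: "u x = 0" if "x \<notin> Y" for x using that Y by (auto simp: u_def pow_fun_def)
  have u0: "u x \<ge> 0" for x using \<beta> by (auto simp: u_def pow_fun_def)
  have uM: "u x \<le> M" for x
    using pow_fun_le_1[OF a(1), of x \<beta>] by (cases "x = 0") (auto simp: u_def pow_fun_def M_def)
  have uF: "u \<in> F_space p \<sigma>" unfolding u_def using \<beta> by (intro pow_fun_F_space p s a) auto
  have sup: "positive_supersolution p \<sigma> Y w u"
    unfolding positive_supersolution_def w_def using uF uoff upos by (auto simp: less_imp_neq[THEN not_sym])
  have eY: "e \<epsilon> x = 0" if "x \<notin> Y" for \<epsilon> x using uoff[OF that] by (simp add: e_def)
  have supp: "\<bar>real_of_int x\<bar> \<le> exp (1 / (a * \<epsilon>))" if "\<epsilon> > 0" "e \<epsilon> x \<noteq> 0" for \<epsilon> x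
  proof (cases "x = 0")
    case False
    have "1 + \<epsilon> * ln (u x) > 0" using that by (auto simp: e_def log_cut_def max_def split: if_splits)
    moreover have "ln (u x) = - a * ln \<bar>real_of_int x\<bar>" using False by (simp add: u_def pow_fun_def ln_powr)
    ultimately have "ln \<bar>real_of_int x\<bar> < 1 / (a * \<epsilon>)" using that a by (simp add: field_simps)
    then have "exp (ln \<bar>real_of_int x\<bar>) \<le> exp (1 / (a * \<epsilon>))" by (subst exp_le_cancel_iff) simp
    then show ?thesis using False by simp
  qed simp
  have efin: "finite {x. e \<epsilon> x \<noteq> 0}" if "\<epsilon> > 0" for \<epsilon>
  proof (rule finite_subset)
    show "{x. e \<epsilon> x \<noteq> 0} \<subseteq> {- \<lfloor>exp (1 / (a * \<epsilon>))\<rfloor>..\<lfloor>exp (1 / (a * \<epsilon>))\<rfloor>}"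
    proof
      fix x assume "x \<in> {x. e \<epsilon> x \<noteq> 0}"
      then have "\<bar>real_of_int x\<bar> \<le> exp (1 / (a * \<epsilon>))" using supp[OF that] by simp
      then have "\<bar>x\<bar> \<le> \<lfloor>exp (1 / (a * \<epsilon>))\<rfloor>" by (simp add: le_floor_iff)
      then show "x \<in> {- \<lfloor>exp (1 / (a * \<epsilon>))\<rfloor>..\<lfloor>exp (1 / (a * \<epsilon>))\<rfloor>}" by auto
    qed
  qed simp
  have eC: "e \<epsilon> \<in> C_c Y" if "\<epsilon> > 0" for \<epsilon>
    using efin[OF that] eY by (auto simp: C_c_def)
  have lim: "((\<lambda>\<epsilon>. e \<epsilon> x) \<longlongrightarrow> u x) (at_right 0)" for x
  proof -
    have "((\<lambda>\<epsilon>. u x * max 0 (1 + \<epsilon> * ln (u x))) \<longlongrightarrow> u x * max 0 (1 + 0 * ln (u x))) (at_right 0)"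
      by (intro tendsto_intros)
    then show ?thesis by (simp add: e_def log_cut_def)
  qed
  define k where "k x y = edge_weight p \<sigma> x y * (if u y \<le> u x then \<bar>u x - u y\<bar> powr p else 0)" for x y
  have k0: "k x y \<ge> 0" for x y by (simp add: k_def edge_weight_nonneg)
  have krow: "k x summable_on UNIV" for x
  proof -
    have "(\<lambda>y. edge_weight p \<sigma> x y * M powr p) summable_on UNIV"
      by (intro summable_on_cmult_left edge_weight_summable s)
    then show ?thesis
    proof (rule summable_on_comparison_test)
      fix y
      have "\<bar>u x - u y\<bar> \<le> M" using u0[of x] u0[of y] uM[of x] uM[of y] by linarith
      then have "\<bar>u x - u y\<bar> powr p \<le> M powr p" using p by (intro powr_mono2) auto
      then show "k x y \<le> edge_weight p \<sigma> x y * M powr p"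
        unfolding k_def by (intro mult_left_mono edge_weight_nonneg) auto
    qed (rule k0)
  qed
  define C where "C = 2 * (1 / (1 - p * \<sigma>) + 1 / (p * \<sigma>))"
  have C: "C \<ge> 0" using s by (simp add: C_def)
  have kle: "infsum (k x) UNIV \<le> C / \<bar>real_of_int x\<bar>" if "x \<noteq> 0" for x
    using pow_fun_row_bound(2)[OF p s a \<beta> crit that] unfolding k_def u_def C_def by simp
  have R0: "infsum (k x) UNIV \<ge> 0" for x by (intro infsum_nonneg k0)
  define R where "R = infsum (k 0) UNIV + 2 * C * (1 + 1 / a)"
  have R: "R \<ge> 0" using R0[of 0] C a by (simp add: R_def)
  define gap where "gap \<epsilon> = frac_p_energy p \<sigma> (e \<epsilon>) - (\<Sum>\<^sub>\<infinity>x\<in>Y. w x * \<bar>e \<epsilon> x\<bar> powr p)" for \<epsilon>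
  have upper: "gap \<epsilon> \<le> \<eta> * R"
    if \<epsilon>: "0 < \<epsilon>" "\<epsilon> \<le> 1" and \<eta>: "\<eta> > 0"
      and H: "\<And>\<psi>. 0 \<le> \<psi> \<Longrightarrow> \<psi> \<le> 1 + ln M \<Longrightarrow> (\<psi> + \<epsilon>) powr p - \<psi> powr p - p * \<epsilon> * \<psi> powr (p - 1) \<le> \<eta> * \<epsilon>"
    for \<epsilon> \<eta>
  proof -
    define S where "S = {x. e \<epsilon> x \<noteq> 0}"
    have S: "finite S" using efin[OF \<epsilon>(1)] by (simp add: S_def)
    define F where "F x = (if x \<in> S then \<eta> * \<epsilon> else 0)" for x
    have F0: "F x \<ge> 0" for x using \<eta> \<epsilon> by (simp add: F_def)
    have one: "picone p (u x) (u y) (e \<epsilon> x) (e \<epsilon> y) \<le> F x * \<bar>u x - u y\<bar> powr p"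
      if "u y \<le> u x" for x y
    proof -
      have "1 + \<epsilon> * ln (u x) \<le> 1 + ln M"
      proof (cases "u x = 0")
        case False
        then have ux: "u x > 0" using u0[of x] by linarith
        have "ln M \<ge> 0" by (simp add: M_def)
        have "\<epsilon> * ln (u x) \<le> \<epsilon> * ln M" using ux uM[of x] \<epsilon> by (intro mult_left_mono) auto
        also have "\<dots> \<le> 1 * ln M" using \<epsilon> \<open>ln M \<ge> 0\<close> by (intro mult_right_mono) auto
        finally show ?thesis by simp
      qed (simp add: M_def)
      from picone_log_cut[OF p \<epsilon>(1) u0 that this _ H]
      have "picone p (u x) (u y) (e \<epsilon> x) (e \<epsilon> y) \<le> (if e \<epsilon> x = 0 then 0 else \<eta> * \<epsilon> * \<bar>u x - u y\<bar> powr p)"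
        using \<eta> \<epsilon> unfolding e_def by auto
      then show ?thesis by (simp add: F_def S_def split: if_splits)
    qed
    have pw: "edge_weight p \<sigma> x y * picone p (u x) (u y) (e \<epsilon> x) (e \<epsilon> y) \<le> F x * k x y + F y * k y x" for x y
    proof (cases "u y \<le> u x")
      case True
      have "edge_weight p \<sigma> x y * picone p (u x) (u y) (e \<epsilon> x) (e \<epsilon> y)
          \<le> edge_weight p \<sigma> x y * (F x * \<bar>u x - u y\<bar> powr p)"
        by (intro mult_left_mono one True edge_weight_nonneg)
      also have "\<dots> = F x * k x y" using True by (simp add: k_def)
      finally show ?thesis using F0[of y] k0[of y x] by (smt (verit) mult_nonneg_nonneg)
    next
      case False
      have "edge_weight p \<sigma> x y * picone p (u x) (u y) (e \<epsilon> x) (e \<epsilon> y)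
          = edge_weight p \<sigma> y x * picone p (u y) (u x) (e \<epsilon> y) (e \<epsilon> x)"
        by (simp add: edge_weight_commute[of p \<sigma> y x] picone_commute[of p "u y"])
      also have "\<dots> \<le> edge_weight p \<sigma> y x * (F y * \<bar>u y - u x\<bar> powr p)"
        using False by (intro mult_left_mono one edge_weight_nonneg) auto
      also have "\<dots> = F y * k y x" using False by (simp add: k_def)
      finally show ?thesis using F0[of x] k0[of x y] by (smt (verit) mult_nonneg_nonneg)
    qed
    have r: "((\<lambda>(x, y). F x * k x y) has_sum (\<Sum>x\<in>S. F x * infsum (k x) UNIV)) UNIV"
      using S krow by (intro has_sum_finite_rows) (auto simp: F_def)
    note id = ground_state_identity[OF p s(1) uF efin[OF \<epsilon>(1)]]
    have "2 * (frac_p_energy p \<sigma> (e \<epsilon>) -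
        (\<Sum>x | e \<epsilon> x \<noteq> 0. frac_p_Laplacian p \<sigma> u x / u x powr (p - 1) * \<bar>e \<epsilon> x\<bar> powr p))
       \<le> (\<Sum>x\<in>S. F x * infsum (k x) UNIV) + (\<Sum>x\<in>S. F x * infsum (k x) UNIV)"
      by (rule has_sum_mono[OF id has_sum_add[OF r has_sum_swap_pairs[OF r]]]) (auto intro: pw)
    then have "gap \<epsilon> \<le> (\<Sum>x\<in>S. F x * infsum (k x) UNIV)"
      unfolding gap_def infsum_support[OF eC[OF \<epsilon>(1)]] w_def by simp
    also have "\<dots> = \<eta> * \<epsilon> * (\<Sum>x\<in>S. infsum (k x) UNIV)"
      by (simp add: F_def sum_distrib_left)
    also have "(\<Sum>x\<in>S. infsum (k x) UNIV) \<le> (\<Sum>x\<in>insert 0 S. infsum (k x) UNIV)"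
      using S R0 by (intro sum_mono2) auto
    also have "\<dots> = infsum (k 0) UNIV + (\<Sum>x\<in>S - {0}. infsum (k x) UNIV)"
      using S by (subst sum.insert_remove) auto
    also have "(\<Sum>x\<in>S - {0}. infsum (k x) UNIV) \<le> (\<Sum>x\<in>S - {0}. C * (1 / \<bar>real_of_int x\<bar>))"
      using kle by (intro sum_mono) auto
    also have "\<dots> = C * (\<Sum>x\<in>S - {0}. 1 / \<bar>real_of_int x\<bar>)" by (simp add: sum_distrib_left)
    also have "\<dots> \<le> C * (2 * (1 + 1 / (a * \<epsilon>)))"
      using S a \<epsilon> C supp[OF \<epsilon>(1)] by (intro mult_left_mono sum_inverse_abs_bound) (auto simp: S_def)
    finally have "gap \<epsilon> \<le> \<eta> * \<epsilon> * (infsum (k 0) UNIV + C * (2 * (1 + 1 / (a * \<epsilon>))))"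
      using \<eta> \<epsilon> by (simp add: mult_left_mono)
    also have "\<dots> = \<eta> * (\<epsilon> * infsum (k 0) UNIV + 2 * C * (\<epsilon> + 1 / a))"
      using \<epsilon> a by (simp add: field_simps)
    also have "\<dots> \<le> \<eta> * (1 * infsum (k 0) UNIV + 2 * C * (1 + 1 / a))"
      using \<eta> \<epsilon> C R0[of 0] by (intro mult_left_mono add_mono mult_right_mono) auto
    finally show ?thesis by (simp add: R_def)
  qed
  have lower: "gap \<epsilon> \<ge> 0" if "\<epsilon> > 0" for \<epsilon>
    using hardy_gap[OF p s(1) sup eC[OF that], of 0 0] by (simp add: gap_def edge_weight_def)
  have gap: "(gap \<longlongrightarrow> 0) (at_right 0)"
  proof (rule tendstoI)
    fix d :: real assume d: "d > 0"
    define \<eta> where "\<eta> = d / (2 * (R + 1))"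
    have \<eta>: "\<eta> > 0" using d R by (simp add: \<eta>_def)
    have "\<eta> * R < d" using d R by (simp add: \<eta>_def field_simps) (smt (verit) mult_nonneg_nonneg)
    have "1 + ln M \<ge> 0" by (simp add: M_def)
    have "\<forall>\<^sub>F \<epsilon> in at_right (0::real). \<epsilon> > 0" by (rule eventually_at_right_less)
    moreover have "\<forall>\<^sub>F \<epsilon> in at_right (0::real). \<epsilon> \<le> 1"
      by (rule eventually_at_right_real[THEN eventually_mono, of 0 1]) auto
    ultimately show "\<forall>\<^sub>F \<epsilon> in at_right 0. dist (gap \<epsilon>) 0 < d"
      using powr_second_order[OF p \<eta> \<open>1 + ln M \<ge> 0\<close>]
    proof eventually_elim
      case (elim \<epsilon>)
      then have "gap \<epsilon> \<le> \<eta> * R" using \<eta> by (intro upper) auto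
      then show ?case using lower[of \<epsilon>] elim \<open>\<eta> * R < d\<close> by simp
    qed
  qed
  have ev: "\<forall>\<^sub>F \<epsilon> in at_right 0. e \<epsilon> \<in> C_c Y"
    using eventually_at_right_less[of "0::real"] by (rule eventually_mono) (rule eC)
  have nb: "at_right (0::real) \<noteq> bot" by simp
  show "p_critical p \<sigma> Y w" "agmon_ground_state p \<sigma> Y w u"
    using null_family_critical[OF p s(1) sup nb ev lim] gap unfolding gap_def by auto
qed

section \<open>The paired term near the diagonal\<close>

text \<open>The power series of \<open>((1 - x) powr (- a) - 1) / x\<close>.\<close>

definition shifted_binomial_fps :: "real \<Rightarrow> real fps" where
  "shifted_binomial_fps a = Abs_fps (\<lambda>j. pochhammer a (Suc j) / fact (Suc j))"

text \<open>The power series of the derivative of \<open>ln (((1 - x) powr (- a) - 1) / x)\<close>.\<close>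

definition log_deriv_fps :: "real \<Rightarrow> real fps" where
  "log_deriv_fps a = fps_deriv (shifted_binomial_fps a) * inverse (shifted_binomial_fps a)"

lemma shifted_binomial_0: "fps_nth (shifted_binomial_fps a) 0 = a"
  by (simp add: shifted_binomial_fps_def)

lemma shifted_binomial_Suc:
  "fps_nth (shifted_binomial_fps a) (Suc j) = fps_nth (shifted_binomial_fps a) j * ((a + real j + 1) / (real j + 2))"
  by (simp add: shifted_binomial_fps_def pochhammer_rec' field_simps)

lemma shifted_binomial_pos: "a > 0 \<Longrightarrow> fps_nth (shifted_binomial_fps a) j > 0"
  by (simp add: shifted_binomial_fps_def pochhammer_pos)

lemma shifted_binomial_le:
  assumes "0 < a" "a < 1"
  shows "fps_nth (shifted_binomial_fps a) j \<le> a"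
proof (induction j)
  case (Suc j)
  have "fps_nth (shifted_binomial_fps a) j * ((a + real j + 1) / (real j + 2)) \<le> fps_nth (shifted_binomial_fps a) j * 1"
    using assms shifted_binomial_pos[OF assms(1), of j] by (intro mult_left_mono) (auto simp: divide_simps)
  then show ?case using Suc by (simp only: shifted_binomial_Suc)
qed (simp add: shifted_binomial_0)

lemma log_deriv_fps_mult:
  assumes "a > 0"
  shows "fps_deriv (shifted_binomial_fps a) = log_deriv_fps a * shifted_binomial_fps a"
  using assms by (simp add: log_deriv_fps_def mult.assoc inverse_mult_eq_1 shifted_binomial_0)

lemma log_deriv_fps_rec:
  assumes "a > 0"
  shows "real (Suc m) * fps_nth (shifted_binomial_fps a) (Suc m) = (\<Sum>i\<le>m. fps_nth (log_deriv_fps a) i * fps_nth (shifted_binomial_fps a) (m - i))"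
proof -
  have "fps_nth (fps_deriv (shifted_binomial_fps a)) m = fps_nth (log_deriv_fps a * shifted_binomial_fps a) m"
    using log_deriv_fps_mult[OF assms] by simp
  then show ?thesis by (simp add: fps_mult_nth atLeast0AtMost)
qed

text \<open>Kaluza's argument: the ratios \<open>\<rho> j\<close> of consecutive coefficients of the shifted
  binomial series increase with \<open>j\<close>, since \<open>a < 1\<close>. Multiplying the recursion for the previous
  coefficient by \<open>\<rho> m\<close> therefore dominates all but the last term of the next recursion, and what is
  left for the last term is positive. The upper bound serves only to have radius of convergence \<open>1\<close>.\<close>

lemma log_deriv_fps_bounds:
  assumes "0 < a" "a < 1"
  shows "0 \<le> fps_nth (log_deriv_fps a) m \<and> fps_nth (log_deriv_fps a) m \<le> real (Suc m)"
proof (induction m rule: less_induct)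
  case (less m)
  let ?s = "\<lambda>j. fps_nth (shifted_binomial_fps a) j" and ?d = "\<lambda>j. fps_nth (log_deriv_fps a) j"
  define \<rho> where "\<rho> j = (a + real j + 1) / (real j + 2)" for j
  have \<rho>mono: "\<rho> i \<le> \<rho> j" if "i \<le> j" for i j
  proof -
    have e: "\<rho> j = 1 - (1 - a) / (real j + 2)" for j by (simp add: \<rho>_def field_simps)
    show ?thesis unfolding e using that assms by (intro diff_left_mono divide_left_mono) auto
  qed
  have \<rho>: "?s (Suc j) = ?s j * \<rho> j" for j by (simp only: shifted_binomial_Suc \<rho>_def)
  have spos: "?s j > 0" for j using shifted_binomial_pos assms by blast
  have dnn: "?d i \<ge> 0" if "i < m" for i using less[OF that] by simp
  have rec: "?d m * a = real (Suc m) * ?s (Suc m) - (\<Sum>i<m. ?d i * ?s (m - i))"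
    using log_deriv_fps_rec[OF assms(1), of m]
    by (simp add: lessThan_Suc_atMost[symmetric] shifted_binomial_0)
  have "(\<Sum>i<m. ?d i * ?s (m - i)) \<le> real m * ?s (Suc m)"
  proof (cases m)
    case (Suc l)
    have "(\<Sum>i<m. ?d i * ?s (m - i)) \<le> (\<Sum>i<m. (?d i * ?s (l - i)) * \<rho> m)"
    proof (intro sum_mono)
      fix i assume i: "i \<in> {..<m}"
      then have "m - i = Suc (l - i)" using Suc by auto
      then have "?s (m - i) = ?s (l - i) * \<rho> (l - i)" by (simp only: \<rho>)
      also have "\<dots> \<le> ?s (l - i) * \<rho> m"
        using Suc by (intro mult_left_mono \<rho>mono less_imp_le[OF spos]) auto
      finally have "?d i * ?s (m - i) \<le> ?d i * (?s (l - i) * \<rho> m)"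
        using dnn i by (intro mult_left_mono) auto
      then show "?d i * ?s (m - i) \<le> (?d i * ?s (l - i)) * \<rho> m" by (simp add: mult.assoc)
    qed
    also have "\<dots> = (\<Sum>i\<le>l. ?d i * ?s (l - i)) * \<rho> m"
      using Suc by (simp add: sum_distrib_right lessThan_Suc_atMost)
    also have "\<dots> = real m * ?s m * \<rho> m"
      using log_deriv_fps_rec[OF assms(1), of l] Suc by simp
    finally show ?thesis by (simp add: \<rho>)
  qed simp
  then have "?d m * a \<ge> ?s (Suc m)" using rec by (simp add: algebra_simps)
  then have "?d m * a > 0" using spos[of "Suc m"] by linarith
  then have "?d m > 0" using assms by (simp add: zero_less_mult_iff)
  have "(\<Sum>i<m. ?d i * ?s (m - i)) \<ge> 0"
    using dnn spos by (intro sum_nonneg mult_nonneg_nonneg) (auto intro: less_imp_le)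
  then have "?d m * a \<le> real (Suc m) * ?s (Suc m)" using rec by simp
  also have "\<dots> \<le> real (Suc m) * a" using shifted_binomial_le[OF assms] by (intro mult_left_mono) auto
  finally have "?d m \<le> real (Suc m)" using assms by simp
  with \<open>?d m > 0\<close> show ?case by simp
qed

text \<open>The power series of \<open>ln (((1 - x) powr (- a) - 1) / (x * a)) / x\<close>.\<close>

definition log_quot_fps :: "real \<Rightarrow> real fps" where
  "log_quot_fps a = Abs_fps (\<lambda>m. fps_nth (log_deriv_fps a) m / real (Suc m))"

lemma log_quot_fps_bounds:
  assumes "0 < a" "a < 1"
  shows "0 \<le> fps_nth (log_quot_fps a) m" "fps_nth (log_quot_fps a) m \<le> 1"
  using log_deriv_fps_bounds[OF assms, of m] by (auto simp: log_quot_fps_def divide_simps)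

lemma fps_conv_radius_ge_1:
  fixes f :: "real fps"
  assumes "\<And>m. \<bar>fps_nth f m\<bar> \<le> real (Suc m)"
  shows "fps_conv_radius f \<ge> 1"
  unfolding fps_conv_radius_def
proof (rule conv_radius_geI_ex')
  fix r :: real assume r: "0 < r" "ereal r < 1"
  have "summable (\<lambda>m. real (Suc m) * r ^ m)"
    using geometric_deriv_sums[of r] r by (auto simp: sums_iff)
  then show "summable (\<lambda>m. fps_nth f m * of_real r ^ m)"
  proof (rule summable_comparison_test'[where N = 0])
    fix m show "norm (fps_nth f m * of_real r ^ m) \<le> real (Suc m) * r ^ m"
      using assms[of m] r by (auto simp: abs_mult power_abs intro!: mult_right_mono)
  qed
qed

text \<open>For \<open>z > 0\<close> and \<open>z < 0\<close> this describes the two halves of the paired term by the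
  same power series, whose coefficients are nonnegative.\<close>

lemma power_difference_eq_exp:
  fixes a z :: real
  assumes a: "0 < a" "a < 1" and z: "\<bar>z\<bar> < 1"
  shows "(1 - z) powr (- a) - 1 = z * a * exp (z * eval_fps (log_quot_fps a) z)"
proof -
  let ?S = "shifted_binomial_fps a" and ?D = "log_deriv_fps a" and ?K = "log_quot_fps a"
  define P where "P = fps_X * ?K"
  have rS: "fps_conv_radius ?S \<ge> 1"
    using shifted_binomial_le[OF a] shifted_binomial_pos[OF a(1)] a
    by (intro fps_conv_radius_ge_1) (smt (verit) of_nat_0_le_iff of_nat_Suc)
  have rD: "fps_conv_radius ?D \<ge> 1"
    using log_deriv_fps_bounds[OF a] by (intro fps_conv_radius_ge_1) auto
  have rK: "fps_conv_radius ?K \<ge> 1"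
    using log_quot_fps_bounds[OF a] by (intro fps_conv_radius_ge_1) (smt (verit) of_nat_0_le_iff of_nat_Suc)
  have rP: "fps_conv_radius P \<ge> 1"
    unfolding P_def using fps_conv_radius_mult[of "fps_X :: real fps" ?K] rK by (auto intro: order_trans)
  have lt: "ereal (norm x) < fps_conv_radius f" if "\<bar>x\<bar> < 1" "fps_conv_radius f \<ge> 1" for x :: real and f :: "real fps"
    using that by (metis ereal_less(3) less_ereal.simps(1) one_ereal_def order_less_le_trans real_norm_def)
  have dP: "fps_deriv P = ?D"
  proof (rule fps_ext)
    fix n
    have "fps_nth (fps_deriv P) n = real (Suc n) * fps_nth ?K n"
      by (simp only: fps_deriv_nth P_def) simp
    also have "\<dots> = fps_nth ?D n" unfolding log_quot_fps_def fps_nth_Abs_fps by (simp del: of_nat_Suc)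
    finally show "fps_nth (fps_deriv P) n = fps_nth ?D n" .
  qed
  define H where "H x = eval_fps ?S x * exp (- eval_fps P x)" for x
  have dH: "(H has_real_derivative 0) (at x)" if x: "\<bar>x\<bar> < 1" for x
  proof -
    have "(eval_fps ?S has_real_derivative eval_fps ?D x * eval_fps ?S x) (at x)"
      using has_field_derivative_eval_fps[OF lt[OF x rS], of UNIV]
      by (simp add: log_deriv_fps_mult[OF a(1)] eval_fps_mult lt[OF x rS] lt[OF x rD] del: real_norm_def)
    moreover have "(eval_fps P has_real_derivative eval_fps ?D x) (at x)"
      using has_field_derivative_eval_fps[OF lt[OF x rP], of UNIV] dP by simp
    ultimately show ?thesis unfolding H_def
      by (auto intro!: derivative_eq_intros)
  qed
  have "\<exists>c. \<forall>x\<in>{-1<..<1}. H x = c"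
  proof (rule has_field_derivative_zero_constant)
    fix x :: real assume "x \<in> {-1<..<1}"
    then show "(H has_real_derivative 0) (at x within {-1<..<1})"
      by (intro DERIV_subset[OF dH]) auto
  qed simp
  moreover have "z \<in> {-1<..<1}" "0 \<in> {-1<..<(1::real)}" using z by auto
  ultimately have "H z = H 0" by metis
  also have "H 0 = a" by (simp add: H_def eval_fps_at_0 shifted_binomial_0 P_def)
  finally have Sz: "eval_fps ?S z = a * exp (eval_fps P z)"
    by (simp add: H_def exp_minus field_simps)
  have Pz: "eval_fps P z = z * eval_fps ?K z"
    unfolding P_def by (subst eval_fps_mult) (use lt[OF z rK] in auto)
  have "(\<lambda>n. pochhammer a n / fact n * z ^ n) sums (1 + (- z)) powr (- a)"
  proof -
    have "(\<lambda>n. ((- a) gchoose n) * (- z) ^ n) sums (1 + (- z)) powr (- a)"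
      using z by (intro gen_binomial_real) simp
    moreover have "((- a) gchoose n) * (- z) ^ n = pochhammer a n / fact n * z ^ n" for n
    proof -
      have "((- a) gchoose n) * (- z) ^ n = pochhammer a n / fact n * ((- 1) ^ n * (- z) ^ n)"
        by (simp add: gbinomial_pochhammer)
      also have "(- 1) ^ n * (- z) ^ n = z ^ n" unfolding power_mult_distrib[symmetric] by simp
      finally show ?thesis .
    qed
    ultimately show ?thesis by simp
  qed
  then have "(\<lambda>n. pochhammer a (Suc n) / fact (Suc n) * z ^ Suc n) sums ((1 + (- z)) powr (- a) - 1)"
    using sums_Suc_iff[of "\<lambda>n. pochhammer a n / fact n * z ^ n" "(1 + (- z)) powr (- a) - 1"] by simp
  moreover have "(\<lambda>n. z * (fps_nth ?S n * z ^ n)) sums (z * eval_fps ?S z)"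
    by (intro sums_mult sums_eval_fps lt z rS)
  moreover have "z * (fps_nth ?S n * z ^ n) = pochhammer a (Suc n) / fact (Suc n) * z ^ Suc n" for n
    by (simp add: shifted_binomial_fps_def)
  ultimately have "(1 - z) powr (- a) - 1 = z * eval_fps ?S z"
    by (simp add: sums_iff)
  then show ?thesis by (simp add: Sz Pz)
qed

text \<open>Functions \<open>c + x * N x\<close> on the unit interval with \<open>N\<close> nonnegative and increasing. After
  multiplication by \<open>x powr e\<close> with \<open>- 1 < e < 0\<close> they are still the sum of a decreasing function,
  \<open>c * x powr e\<close>, and an increasing one. The class contains the sums of power series with
  nonnegative coefficients and is closed under products; and such series may be evaluated
  at \<open>x * M x\<close> with \<open>M\<close> nonnegative and increasing.\<close>

definition affine_mono :: "(real \<Rightarrow> real) \<Rightarrow> bool" where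
  "affine_mono Q \<longleftrightarrow> (\<exists>c N. c \<ge> 0 \<and> mono_on {0<..<1} N \<and> (\<forall>x\<in>{0<..<1}. N x \<ge> 0 \<and> Q x = c + x * N x))"

lemma affine_monoI:
  assumes "c \<ge> 0" "mono_on {0<..<1} N" "\<And>x. 0 < x \<Longrightarrow> x < 1 \<Longrightarrow> N x \<ge> 0"
    "\<And>x. 0 < x \<Longrightarrow> x < 1 \<Longrightarrow> Q x = c + x * N x"
  shows "affine_mono Q"
  unfolding affine_mono_def using assms by (intro exI[of _ c] exI[of _ N]) auto

lemma mono_on_mult_nonneg:
  fixes f g :: "real \<Rightarrow> real"
  assumes "mono_on A f" "mono_on A g" "\<And>x. x \<in> A \<Longrightarrow> f x \<ge> 0" "\<And>x. x \<in> A \<Longrightarrow> g x \<ge> 0"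
  shows "mono_on A (\<lambda>x. f x * g x)"
  by (rule mono_onI) (use assms in \<open>auto intro!: mult_mono dest: mono_onD\<close>)

lemma affine_mono_nonneg: "affine_mono Q \<Longrightarrow> 0 < x \<Longrightarrow> x < 1 \<Longrightarrow> Q x \<ge> 0"
  unfolding affine_mono_def by force

lemma affine_mono_mono: 
  assumes "affine_mono Q" shows "mono_on {0<..<1} Q"
proof -
  obtain c N where N: "c \<ge> 0" "mono_on {0<..<1} N" "\<forall>x\<in>{0<..<1}. N x \<ge> 0 \<and> Q x = c + x * N x"
    using assms unfolding affine_mono_def by blast
  show ?thesis
  proof (rule mono_onI)
    fix x y :: real assume "x \<in> {0<..<1}" "y \<in> {0<..<1}" "x \<le> y"
    then show "Q x \<le> Q y" using N mono_onD[OF N(2), of x y] by (auto intro!: mult_mono)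
  qed
qed

lemma affine_mono_mult:
  assumes "affine_mono P" "affine_mono Q"
  shows "affine_mono (\<lambda>x. P x * Q x)"
proof -
  obtain c M where M: "c \<ge> 0" "mono_on {0<..<1} M" "\<And>x. x \<in> {0<..<1} \<Longrightarrow> M x \<ge> 0 \<and> P x = c + x * M x"
    using assms unfolding affine_mono_def by blast
  obtain d N where N: "d \<ge> 0" "mono_on {0<..<1} N" "\<And>x. x \<in> {0<..<1} \<Longrightarrow> N x \<ge> 0 \<and> Q x = d + x * N x"
    using assms unfolding affine_mono_def by blast
  show ?thesis
  proof (rule affine_monoI[of "c * d" "\<lambda>x. c * N x + M x * Q x"])
    have "mono_on {0<..<1} (\<lambda>x. M x * Q x)"
      using M affine_mono_mono[OF assms(2)] affine_mono_nonneg[OF assms(2)] by (intro mono_on_mult_nonneg) auto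
    then show "mono_on {0<..<1} (\<lambda>x. c * N x + M x * Q x)"
      using M(1) N(2) by (auto simp: mono_on_def intro!: add_mono mult_left_mono)
    fix x :: real assume x: "0 < x" "x < 1"
    show "c * N x + M x * Q x \<ge> 0"
      using M N x affine_mono_nonneg[OF assms(2) x] by (intro add_nonneg_nonneg mult_nonneg_nonneg) auto
    show "P x * Q x = c * d + x * (c * N x + M x * Q x)"
      using M(3)[of x] N(3)[of x] x by (simp add: algebra_simps)
  qed (use M N in auto)
qed

lemma affine_mono_power_series:
  assumes c: "\<And>m. c m \<ge> 0" and M: "mono_on {0<..<1} M" "\<And>x. 0 < x \<Longrightarrow> x < 1 \<Longrightarrow> M x \<ge> 0"
    and S: "\<And>x. 0 < x \<Longrightarrow> x < 1 \<Longrightarrow> summable (\<lambda>m. c m * (x * M x) ^ m)"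
  shows "affine_mono (\<lambda>x. \<Sum>m. c m * (x * M x) ^ m)"
proof -
  have xM: "x * M x \<ge> 0" "y \<ge> x \<Longrightarrow> y < 1 \<Longrightarrow> x * M x \<le> y * M y" if "0 < x" "x < 1" for x y
    using that M(2)[of x] M(1) by (auto intro!: mult_mono simp: mono_on_def)
  have S': "summable (\<lambda>m. M x * (c (Suc m) * (x * M x) ^ m))" if "0 < x" "x < 1" for x
  proof -
    have "summable (\<lambda>m. inverse x * (c (Suc m) * (x * M x) ^ Suc m))"
      using S[OF that] by (intro summable_mult) (subst summable_Suc_iff)
    then show ?thesis using that by (simp add: field_simps)
  qed
  define N where "N x = (\<Sum>m. M x * (c (Suc m) * (x * M x) ^ m))" for x
  show ?thesis
  proof (rule affine_monoI[of "c 0" N])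
    show "mono_on {0<..<1} N" unfolding N_def
    proof (rule mono_onI)
      fix x y :: real assume xy: "x \<in> {0<..<1}" "y \<in> {0<..<1}" "x \<le> y"
      show "(\<Sum>m. M x * (c (Suc m) * (x * M x) ^ m)) \<le> (\<Sum>m. M y * (c (Suc m) * (y * M y) ^ m))"
        using xy xM(1)[of x] xM(2)[of x y] M(2) mono_onD[OF M(1) xy] c
        by (intro suminf_le S' mult_mono power_mono mult_nonneg_nonneg zero_le_power order_refl) auto
    qed
    fix x :: real assume x: "0 < x" "x < 1"
    show "N x \<ge> 0" unfolding N_def
      using x xM(1)[OF x] M(2)[OF x] c by (intro suminf_nonneg S' mult_nonneg_nonneg zero_le_power) auto
    have "(\<Sum>m. c m * (x * M x) ^ m) = c 0 + (\<Sum>m. c (Suc m) * (x * M x) ^ Suc m)"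
      using suminf_split_head[OF S[OF x]] by simp
    also have "(\<Sum>m. c (Suc m) * (x * M x) ^ Suc m) = (\<Sum>m. x * (M x * (c (Suc m) * (x * M x) ^ m)))"
      by (simp add: algebra_simps)
    also have "\<dots> = x * N x" unfolding N_def using S'[OF x] by (rule suminf_mult)
    finally show "(\<Sum>m. c m * (x * M x) ^ m) = c 0 + x * N x" .
  qed (rule c)
qed

lemma affine_mono_cong:
  "affine_mono P \<Longrightarrow> (\<And>x. 0 < x \<Longrightarrow> x < 1 \<Longrightarrow> P x = Q x) \<Longrightarrow> affine_mono Q"
  unfolding affine_mono_def by force

lemma affine_mono_exp:
  assumes "mono_on {0<..<1} M" "\<And>x. 0 < x \<Longrightarrow> x < 1 \<Longrightarrow> M x \<ge> 0"
  shows "affine_mono (\<lambda>x. exp (x * M x))"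
proof (rule affine_mono_cong[OF affine_mono_power_series[of "\<lambda>m. inverse (fact m)", OF _ assms]])
  fix x :: real
  have "(\<lambda>m. inverse (fact m) * (x * M x) ^ m) sums exp (x * M x)"
    using exp_converges[of "x * M x"] by simp
  then show "summable (\<lambda>m. inverse (fact m) * (x * M x) ^ m)" "(\<Sum>m. inverse (fact m) * (x * M x) ^ m) = exp (x * M x)"
    by (auto simp: sums_iff)
qed auto

lemma affine_mono_sinhc:
  assumes "mono_on {0<..<1} M" "\<And>x. 0 < x \<Longrightarrow> x < 1 \<Longrightarrow> M x > 0"
  shows "affine_mono (\<lambda>x. sinh (x * M x) / (x * M x))"
proof (rule affine_mono_cong[OF affine_mono_power_series[of "\<lambda>m. if even m then inverse (fact (Suc m)) else 0", OF _ assms(1)]])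
  fix x :: real assume x: "0 < x" "x < 1"
  define z where "z = x * M x"
  have z: "z \<noteq> 0" using x assms(2)[OF x] by (simp add: z_def)
  have "(\<lambda>n. if even n then 0 else z ^ n /\<^sub>R fact n) sums sinh z" by (rule sinh_converges)
  then have "(\<lambda>n. if even (Suc n) then 0 else z ^ Suc n /\<^sub>R fact (Suc n)) sums sinh z"
    using sums_Suc_iff[of "\<lambda>n. if even n then 0 else z ^ n /\<^sub>R fact n" "sinh z"] by simp
  then have "(\<lambda>n. (if even (Suc n) then 0 else z ^ Suc n /\<^sub>R fact (Suc n)) / z) sums (sinh z / z)"
    by (rule sums_divide)
  moreover have "(if even (Suc n) then 0 else z ^ Suc n /\<^sub>R fact (Suc n)) / z
      = (if even n then inverse (fact (Suc n)) else 0) * z ^ n" for n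
    using z by (simp add: field_simps)
  ultimately have "(\<lambda>n. (if even n then inverse (fact (Suc n)) else 0) * z ^ n) sums (sinh z / z)" by simp
  then show "summable (\<lambda>m. (if even m then inverse (fact (Suc m)) else 0) * (x * M x) ^ m)"
    "(\<Sum>m. (if even m then inverse (fact (Suc m)) else 0) * (x * M x) ^ m) = sinh (x * M x) / (x * M x)"
    unfolding z_def by (auto simp: sums_iff)
qed (use assms in \<open>auto intro: less_imp_le\<close>)

lemma affine_mono_cmult: "k \<ge> 0 \<Longrightarrow> affine_mono Q \<Longrightarrow> affine_mono (\<lambda>x. k * Q x)"
  using affine_mono_mult[of "\<lambda>_. k" Q] affine_monoI[of k "\<lambda>_. 0" "\<lambda>_. k"] by (auto simp: mono_on_def)

text \<open>Split \<open>K\<close>, the series of the previous representation, into its even part \<open>E\<close> and its odd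
  part \<open>V\<close>. The two powers are \<open>(x * a) powr r\<close> times \<open>exp (r x (V x + E x))\<close> and
  \<open>exp (r x (V x - E x))\<close>, so that their difference is a product of \<open>exp (r x V x)\<close> and
  \<open>2 sinh (r x E x)\<close>.\<close>

lemma pair_difference_affine_mono:
  fixes a r :: real
  assumes a: "0 < a" "a < 1" and r: "r > 0"
  obtains Q where "affine_mono Q"
    "\<And>x. 0 < x \<Longrightarrow> x < 1 \<Longrightarrow> ((1 - x) powr (- a) - 1) powr r - (1 - (1 + x) powr (- a)) powr r = x powr (r + 1) * Q x"
proof -
  let ?k = "\<lambda>m. fps_nth (log_quot_fps a) m" and ?K = "eval_fps (log_quot_fps a)"
  define E where "E x = (\<Sum>m. (if even m then ?k m else 0) * x ^ m)" for x
  define V where "V x = (\<Sum>m. (if odd m then ?k m else 0) * x ^ m)" for x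
  have k: "0 \<le> ?k m" "?k m \<le> 1" for m using log_quot_fps_bounds[OF a] by auto
  have S: "summable (\<lambda>m. c m * x ^ m)" if "\<And>m. \<bar>c m\<bar> \<le> 1" "\<bar>x\<bar> < 1" for c and x :: real
  proof (rule summable_comparison_test'[where N = 0])
    show "summable (\<lambda>m. \<bar>x\<bar> ^ m)" using that by (intro summable_geometric) auto
    fix m show "norm (c m * x ^ m) \<le> \<bar>x\<bar> ^ m"
      using mult_right_mono[OF that(1)[of m], of "\<bar>x\<bar> ^ m"] by (simp add: abs_mult power_abs)
  qed
  have SE: "summable (\<lambda>m. (if even m then ?k m else 0) * x ^ m)" if "\<bar>x\<bar> < 1" for x :: real
    using that k by (intro S) auto
  have SO: "summable (\<lambda>m. (if odd m then ?k m else 0) * x ^ m)" if "\<bar>x\<bar> < 1" for x :: real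
    using that k by (intro S) auto
  have Kx: "?K x = E x + V x" "?K (- x) = E x - V x" if "\<bar>x\<bar> < 1" for x
  proof -
    show "?K x = E x + V x"
      unfolding E_def V_def eval_fps_def suminf_add[OF SE[OF that] SO[OF that]]
      by (intro suminf_cong) auto
    show "?K (- x) = E x - V x"
      unfolding E_def V_def eval_fps_def suminf_diff[OF SE[OF that] SO[OF that]]
      by (intro suminf_cong) (auto simp: power_minus_odd)
  qed
  have one: "mono_on {0<..<1::real} (\<lambda>_. 1::real)" by (simp add: mono_on_def)
  have aE: "affine_mono E"
    using affine_mono_power_series[of "\<lambda>m. if even m then ?k m else 0" "\<lambda>_. 1", OF _ one] k SE
    unfolding E_def by simp
  have aO: "affine_mono V"
    using affine_mono_power_series[of "\<lambda>m. if odd m then ?k m else 0" "\<lambda>_. 1", OF _ one] k SO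
    unfolding V_def by simp
  have Epos: "E x > 0" if x: "0 < x" "x < 1" for x
  proof -
    have "0 < (if even (0::nat) then ?k 0 else 0) * x ^ 0"
    proof -
      have "fps_nth (log_deriv_fps a) 0 * a = fps_nth (shifted_binomial_fps a) 1"
        using log_deriv_fps_rec[OF a(1), of 0] by (simp add: shifted_binomial_0)
      then have "fps_nth (log_deriv_fps a) 0 * a > 0" using shifted_binomial_pos[OF a(1)] by simp
      then show ?thesis using a by (simp add: log_quot_fps_def zero_less_mult_iff)
    qed
    then show ?thesis unfolding E_def
      using x k SE[of x] by (intro suminf_pos2[where i = 0]) auto
  qed
  define Q where "Q x = 2 * a powr r * r * (E x * (exp (x * (r * V x)) * (sinh (x * (r * E x)) / (x * (r * E x)))))" for x
  have mono_r: "mono_on {0<..<1} (\<lambda>x. r * f x)" if "affine_mono f" for f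
    using affine_mono_mono[OF that] r by (auto simp: mono_on_def)
  have "affine_mono Q" unfolding Q_def
    using r a Epos affine_mono_nonneg[OF aO]
    by (intro affine_mono_cmult affine_mono_mult aE affine_mono_exp affine_mono_sinhc mono_r aO) auto
  moreover have "((1 - x) powr (- a) - 1) powr r - (1 - (1 + x) powr (- a)) powr r = x powr (r + 1) * Q x"
    if x: "0 < x" "x < 1" for x
  proof -
    have A: "(1 - x) powr (- a) - 1 = x * a * exp (x * (E x + V x))"
      using power_difference_eq_exp[OF a, of x] Kx[of x] x by simp
    have B: "1 - (1 + x) powr (- a) = x * a * exp (x * (V x - E x))"
      using power_difference_eq_exp[OF a, of "- x"] Kx[of x] x by (simp add: algebra_simps)
    have ep: "(x * a * exp t) powr r = x powr r * a powr r * exp (r * t)" for t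
      using x a by (simp add: powr_mult powr_def[of "exp t"])
    have "((1 - x) powr (- a) - 1) powr r - (1 - (1 + x) powr (- a)) powr r
       = x powr r * a powr r * (exp (r * (x * (E x + V x))) - exp (r * (x * (V x - E x))))"
      unfolding A B ep by (simp add: algebra_simps)
    also have "exp (r * (x * (E x + V x))) - exp (r * (x * (V x - E x)))
       = exp (x * (r * V x)) * (2 * sinh (x * (r * E x)))"
      by (simp add: sinh_def algebra_simps flip: exp_add)
    also have "x powr r * a powr r * (exp (x * (r * V x)) * (2 * sinh (x * (r * E x)))) = x powr (r + 1) * Q x"
      using x Epos[OF x] r by (simp add: Q_def powr_add)
    finally show ?thesis .
  qed
  ultimately show ?thesis using that by blast
qed

text \<open>With \<open>d = 1 + s\<close> the power of \<open>x\<close> in front of the \<open>affine_mono\<close> factor is \<open>r - s\<close>. It may be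
  negative, and then the paired term is unbounded at both ends of the interval and not monotone.\<close>

lemma pair_term_decomposition:
  fixes a r e :: real
  assumes a: "0 < a" "a < 1" and r: "r > 0" and d: "d < r + 2"
  obtains D U where "antimono_on {0<..<1} D" "mono_on {0<..<1} U"
    "\<And>x. 0 < x \<Longrightarrow> x < 1 \<Longrightarrow> D x \<ge> 0 \<and> U x \<ge> 0 \<and>
       x powr (- d) * (((1 - x) powr (- a) - 1) powr r - (1 - (1 + x) powr (- a)) powr r) = D x + U x"
proof -
  obtain Q where Q: "affine_mono Q"
    "\<And>x. 0 < x \<Longrightarrow> x < 1 \<Longrightarrow> ((1 - x) powr (- a) - 1) powr r - (1 - (1 + x) powr (- a)) powr r = x powr (r + 1) * Q x"
    using pair_difference_affine_mono[OF a r] by metis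
  obtain c N where N: "c \<ge> 0" "mono_on {0<..<1} N" "\<And>x. x \<in> {0<..<1} \<Longrightarrow> N x \<ge> 0 \<and> Q x = c + x * N x"
    using Q(1) unfolding affine_mono_def by blast
  define e where "e = r + 1 - d"
  have e: "e > -1" using d by (simp add: e_def)
  have eq: "x powr (- d) * (((1 - x) powr (- a) - 1) powr r - (1 - (1 + x) powr (- a)) powr r) = x powr e * Q x"
    if "0 < x" "x < 1" for x
    unfolding Q(2)[OF that] using that by (simp add: e_def powr_diff powr_minus field_simps)
  have mp: "mono_on {0<..<1} (\<lambda>x::real. x powr t)" if "t \<ge> 0" for t
    using that by (auto simp: mono_on_def intro: powr_mono2)
  show ?thesis
  proof (cases "e \<ge> 0")
    case True
    show ?thesis
    proof (rule that[of "\<lambda>_. 0" "\<lambda>x. x powr e * Q x"])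
      show "mono_on {0<..<1} (\<lambda>x. x powr e * Q x)"
        using True affine_mono_mono[OF Q(1)] affine_mono_nonneg[OF Q(1)] by (intro mono_on_mult_nonneg mp) auto
    qed (use eq affine_mono_nonneg[OF Q(1)] in \<open>auto simp: monotone_on_def\<close>)
  next
    case False
    show ?thesis
    proof (rule that[of "\<lambda>x. c * x powr e" "\<lambda>x. x powr (e + 1) * N x"])
      show "antimono_on {0<..<1} (\<lambda>x. c * x powr e)"
        using False N(1) by (auto simp: monotone_on_def intro!: mult_left_mono powr_mono2')
      show "mono_on {0<..<1} (\<lambda>x. x powr (e + 1) * N x)"
        using e N by (intro mono_on_mult_nonneg mp) auto
    next
      fix x :: real assume x: "0 < x" "x < 1"
      have "x powr e * Q x = c * x powr e + x powr (e + 1) * N x"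
        using N(3)[of x] x by (simp add: powr_add algebra_simps)
      then show "0 \<le> c * x powr e \<and> 0 \<le> x powr (e + 1) * N x \<and>
         x powr (- d) * (((1 - x) powr (- a) - 1) powr r - (1 - (1 + x) powr (- a)) powr r) = c * x powr e + x powr (e + 1) * N x"
        using eq[OF x] N x by auto
    qed
  qed
qed

section \<open>Comparison of sums and integrals\<close>

text \<open>Nonnegative integrals avoid all integrability questions: finiteness of the integrals follows
  from the comparison with convergent sums.\<close>

definition nn_int :: "(real \<Rightarrow> real) \<Rightarrow> real set \<Rightarrow> ennreal" where
  "nn_int f A = (\<integral>\<^sup>+x. ennreal (f x) * indicator A x \<partial>lborel)"

lemma nn_int_mono: "(\<And>x. x \<in> A \<Longrightarrow> f x \<le> g x) \<Longrightarrow> nn_int f A \<le> nn_int g A"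
  unfolding nn_int_def by (intro nn_integral_mono) (auto split: split_indicator intro: ennreal_leI)

lemma nn_int_cong: "(\<And>x. x \<in> A \<Longrightarrow> f x = g x) \<Longrightarrow> nn_int f A = nn_int g A"
  unfolding nn_int_def by (intro nn_integral_cong) (auto split: split_indicator)

lemma nn_int_subset: "A \<subseteq> B \<Longrightarrow> nn_int f A \<le> nn_int f B"
  unfolding nn_int_def by (intro nn_integral_mono) (auto split: split_indicator)

lemma nn_int_add:
  assumes [measurable]: "f \<in> borel_measurable borel" "g \<in> borel_measurable borel" "A \<in> sets borel"
    and "\<And>x. x \<in> A \<Longrightarrow> f x \<ge> 0" "\<And>x. x \<in> A \<Longrightarrow> g x \<ge> 0"
  shows "nn_int (\<lambda>x. f x + g x) A = nn_int f A + nn_int g A"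
proof -
  have "nn_int (\<lambda>x. f x + g x) A = (\<integral>\<^sup>+x. ennreal (f x) * indicator A x + ennreal (g x) * indicator A x \<partial>lborel)"
    unfolding nn_int_def using assms(4,5) by (intro nn_integral_cong) (auto split: split_indicator simp: ennreal_plus)
  also have "\<dots> = nn_int f A + nn_int g A" unfolding nn_int_def by (intro nn_integral_add) auto
  finally show ?thesis .
qed

lemma nn_int_Un:
  assumes [measurable]: "f \<in> borel_measurable borel" "A \<in> sets borel" "B \<in> sets borel" and "A \<inter> B = {}"
  shows "nn_int f (A \<union> B) = nn_int f A + nn_int f B"
proof -
  have "nn_int f (A \<union> B) = (\<integral>\<^sup>+x. ennreal (f x) * indicator A x + ennreal (f x) * indicator B x \<partial>lborel)"
    unfolding nn_int_def using assms(4) by (intro nn_integral_cong) (auto split: split_indicator)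
  also have "\<dots> = nn_int f A + nn_int f B" unfolding nn_int_def by (intro nn_integral_add) auto
  finally show ?thesis .
qed

lemma nn_int_const: "a \<le> b \<Longrightarrow> c \<ge> 0 \<Longrightarrow> nn_int (\<lambda>_. c) {a..b} = ennreal (c * (b - a))"
  unfolding nn_int_def by (subst nn_integral_cmult_indicator) (auto simp: ennreal_mult)

lemma nn_int_incseq:
  assumes [measurable]: "f \<in> borel_measurable borel" "\<And>k::nat. A k \<in> sets borel" and "incseq A"
  shows "nn_int f (\<Union>k. A k) = (SUP k. nn_int f (A k))"
proof -
  let ?M = "density lborel (\<lambda>x. ennreal (f x))"
  have "emeasure ?M B = nn_int f B" if "B \<in> sets borel" for B
    unfolding nn_int_def using that by (intro emeasure_density) auto
  then show ?thesis
    using SUP_emeasure_incseq[of A ?M] assms by (auto simp: image_subset_iff)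
qed

lemma nn_int_affine:
  assumes [measurable]: "f \<in> borel_measurable borel" "A \<in> sets borel" and c: "\<bar>c\<bar> = 1"
  shows "nn_int f A = nn_int (\<lambda>x. f (t + c * x)) {x. t + c * x \<in> A}"
proof -
  have "c \<noteq> 0" using c by auto
  then show ?thesis unfolding nn_int_def using c
    by (subst nn_integral_real_affine[where c = c and t = t]) (auto intro!: nn_integral_cong split: split_indicator)
qed

lemma sum_cells_le_nn_int:
  fixes f :: "real \<Rightarrow> real" and c :: "nat \<Rightarrow> real" and n :: nat
  assumes n: "n \<ge> 1" and c: "\<And>i. i < n \<Longrightarrow> c i \<ge> 0"
    and le: "\<And>i x. i < n \<Longrightarrow> real i / real n < x \<Longrightarrow> x < real (Suc i) / real n \<Longrightarrow> c i \<le> f x"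
  shows "ennreal (\<Sum>i<n. c i) \<le> ennreal (real n) * nn_int f {0<..<1}"
proof -
  let ?A = "\<lambda>i. {real i / real n<..<real (Suc i) / real n}"
  have disj: "i = k" if "x \<in> ?A i" "x \<in> ?A k" for i k x
  proof -
    have "real i < x * real n" "x * real n < real (Suc i)" "real k < x * real n" "x * real n < real (Suc k)"
      using that n by (auto simp: field_simps)
    then show ?thesis by linarith
  qed
  have "(\<Sum>i<n. ennreal (c i) * indicator (?A i) x) \<le> ennreal (f x) * indicator {0<..<1} x" for x
  proof (cases "\<exists>k<n. x \<in> ?A k")
    case True
    then obtain k where k: "k < n" "x \<in> ?A k" by blast
    have "ennreal (c i) * indicator (?A i) x = (if i = k then ennreal (c k) else 0)" for i
    proof (cases "i = k")
      case False
      then have "x \<notin> ?A i" using disj[of x i k] k(2) by blast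
      then show ?thesis using False by simp
    qed (use k in simp)
    then have "(\<Sum>i<n. ennreal (c i) * indicator (?A i) x) = (\<Sum>i<n. if i = k then ennreal (c k) else 0)"
      by simp
    also have "\<dots> = ennreal (c k)" using k by simp
    also have "\<dots> \<le> ennreal (f x)" using le[of k x] k by (intro ennreal_leI) auto
    also have "\<dots> = ennreal (f x) * indicator {0<..<1} x"
    proof -
      have "0 \<le> real k / real n" "real (Suc k) / real n \<le> 1" using k n by (auto simp: divide_le_eq_1)
      then have "0 < x" "x < 1" using k(2) unfolding greaterThanLessThan_iff by linarith+
      then show ?thesis by simp
    qed
    finally show ?thesis .
  next
    case False
    then have "(\<Sum>i<n. ennreal (c i) * indicator (?A i) x) = 0" by (intro sum.neutral) auto
    then show ?thesis by simp
  qed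
  then have "(\<integral>\<^sup>+x. (\<Sum>i<n. ennreal (c i) * indicator (?A i) x) \<partial>lborel) \<le> nn_int f {0<..<1}"
    unfolding nn_int_def by (intro nn_integral_mono)
  also have "(\<integral>\<^sup>+x. (\<Sum>i<n. ennreal (c i) * indicator (?A i) x) \<partial>lborel) = (\<Sum>i<n. ennreal (c i) * ennreal (1 / real n))"
    using n by (subst nn_integral_sum) (auto simp: nn_integral_cmult_indicator field_simps intro!: sum.cong)
  also have "\<dots> = ennreal ((\<Sum>i<n. c i) / real n)"
  proof -
    have c0: "(\<Sum>i<n. c i) \<ge> 0" using c by (intro sum_nonneg) auto
    have "(\<Sum>i<n. ennreal (c i) * ennreal (1 / real n)) = ennreal (\<Sum>i<n. c i) * ennreal (1 / real n)"
      using c by (subst sum_distrib_right[symmetric], subst sum_ennreal) auto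
    also have "\<dots> = ennreal ((\<Sum>i<n. c i) * (1 / real n))" using c0 by (intro ennreal_mult[symmetric]) auto
    finally show ?thesis by simp
  qed
  finally have "ennreal (real n) * ennreal ((\<Sum>i<n. c i) / real n) \<le> ennreal (real n) * nn_int f {0<..<1}"
    by (intro mult_left_mono) auto
  moreover have "ennreal (real n) * ennreal ((\<Sum>i<n. c i) / real n) = ennreal (\<Sum>i<n. c i)"
  proof -
    have "(\<Sum>i<n. c i) \<ge> 0" using c by (intro sum_nonneg) auto
    then have "ennreal (real n) * ennreal ((\<Sum>i<n. c i) / real n) = ennreal (real n * ((\<Sum>i<n. c i) / real n))"
      by (intro ennreal_mult[symmetric]) auto
    then show ?thesis using n by simp
  qed
  ultimately show ?thesis by simp
qed

lemma nn_int_le_sum_cells: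
  fixes f :: "real \<Rightarrow> real" and c :: "nat \<Rightarrow> real" and n :: nat
  assumes n: "n \<ge> 1" and c: "\<And>j. c j \<ge> 0" and S: "summable c"
    and le: "\<And>j x. real (n + j) / real n \<le> x \<Longrightarrow> x < real (n + Suc j) / real n \<Longrightarrow> f x \<le> c j"
  shows "ennreal (real n) * nn_int f {1..} \<le> ennreal (\<Sum>j. c j)"
proof -
  let ?A = "\<lambda>j. {real (n + j) / real n..<real (n + Suc j) / real n}"
  have "ennreal (f x) * indicator {1..} x \<le> (\<Sum>j. ennreal (c j) * indicator (?A j) x)" for x
  proof (cases "x \<ge> 1")
    case True
    define k where "k = nat \<lfloor>x * real n\<rfloor>"
    have nx: "real n \<le> x * real n" using True n by simp
    have k: "real k \<le> x * real n" "x * real n < real (Suc k)"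
      unfolding k_def using nx n real_of_int_floor_add_one_gt[of "x * real n"] by (auto simp: add.commute)
    have "n \<le> k" unfolding k_def using nx by (simp add: le_nat_floor)
    then obtain j where j: "k = n + j" using le_Suc_ex by blast
    have xj: "x \<in> ?A j" using k n unfolding j by (auto simp: field_simps)
    have "ennreal (f x) * indicator {1..} x \<le> ennreal (c j)"
      using le[of j x] xj True by (auto intro: ennreal_leI)
    also have "\<dots> = (\<Sum>i\<in>{j}. ennreal (c i) * indicator (?A i) x)" using xj by simp
    also have "\<dots> \<le> (\<Sum>j. ennreal (c j) * indicator (?A j) x)"
      by (intro sum_le_suminf) auto
    finally show ?thesis .
  qed simp
  then have "nn_int f {1..} \<le> (\<integral>\<^sup>+x. (\<Sum>j. ennreal (c j) * indicator (?A j) x) \<partial>lborel)"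
    unfolding nn_int_def by (intro nn_integral_mono)
  also have "\<dots> = (\<Sum>j. ennreal (c j) * ennreal (1 / real n))"
    using n by (subst nn_integral_suminf) (auto simp: nn_integral_cmult_indicator field_simps intro!: suminf_cong)
  also have "\<dots> = (\<Sum>j. ennreal (c j * (1 / real n)))" using c by (simp add: ennreal_mult[symmetric])
  also have "\<dots> = ennreal (\<Sum>j. c j * (1 / real n))"
    using c S n by (intro suminf_ennreal2 summable_mult2) auto
  also have "(\<Sum>j. c j * (1 / real n)) = (\<Sum>j. c j) * (1 / real n)"
    using S by (intro suminf_mult2[symmetric])
  finally have "ennreal (real n) * nn_int f {1..} \<le> ennreal (real n) * ennreal ((\<Sum>j. c j) * (1 / real n))"
    by (intro mult_left_mono) auto
  then show ?thesis using n c S by (simp add: ennreal_mult[symmetric] suminf_nonneg)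
qed

text \<open>On a cell between consecutive points \<open>x j\<close> and \<open>x (Suc j)\<close> the product is at most
  \<open>d (x j) * k (x (Suc j))\<close>. Replacing \<open>x (Suc j)\<close> by \<open>x j\<close> in \<open>k\<close> costs at most \<open>d 1\<close> times the increment of \<open>k\<close>,
  and these increments telescope.\<close>

lemma nn_int_le_sum_product:
  fixes f d k :: "real \<Rightarrow> real" and n :: nat
  assumes n: "n \<ge> 1"
    and d: "antimono_on {1..} d" "\<And>x. x \<ge> 1 \<Longrightarrow> d x \<ge> 0"
    and k: "mono_on {1..} k" "\<And>x. x \<ge> 1 \<Longrightarrow> 0 \<le> k x \<and> k x \<le> 1"
    and f: "\<And>x. x \<ge> 1 \<Longrightarrow> f x = d x * k x"
    and S: "summable (\<lambda>j. f (real (n + j) / real n))"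
  shows "ennreal (real n) * nn_int f {1..} \<le> ennreal ((\<Sum>j. f (real (n + j) / real n)) + d 1 * (1 - k 1))"
proof -
  define x where "x j = real (n + j) / real n" for j
  have x1: "x j \<ge> 1" for j using n by (simp add: x_def)
  have xm: "x j \<le> x (Suc j)" for j using n by (simp add: x_def divide_right_mono)
  define e where "e j = k (x (Suc j)) - k (x j)" for j
  have e0: "e j \<ge> 0" for j using mono_onD[OF k(1), of "x j" "x (Suc j)"] x1 xm by (simp add: e_def)
  have part: "(\<Sum>j<m. e j) \<le> 1 - k 1" for m
  proof -
    have "(\<Sum>j<m. e j) = k (x m) - k (x 0)" unfolding e_def by (rule sum_lessThan_telescope)
    also have "x 0 = 1" using n by (simp add: x_def)
    finally show ?thesis using k(2)[OF x1[of m]] by simp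
  qed
  have Se: "summable e" by (rule summableI_nonneg_bounded[OF e0 part])
  define c where "c j = f (x j) + d 1 * e j" for j
  have d1: "d 1 \<ge> 0" using d(2) by simp
  have Sc: "summable c" unfolding c_def using S Se unfolding x_def by (intro summable_add summable_mult)
  have c0: "c j \<ge> 0" for j
    unfolding c_def using f[OF x1] d(2)[OF x1] k(2)[OF x1] d1 e0 by (simp add: mult_nonneg_nonneg)
  have "ennreal (real n) * nn_int f {1..} \<le> ennreal (\<Sum>j. c j)"
  proof (rule nn_int_le_sum_cells[OF n c0 Sc])
    fix j y assume y: "real (n + j) / real n \<le> y" "y < real (n + Suc j) / real n"
    then have y': "x j \<le> y" "y \<le> x (Suc j)" by (auto simp: x_def)
    then have y1: "y \<ge> 1" using x1[of j] by linarith
    have "f y = d y * k y" by (rule f[OF y1])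
    also have "\<dots> \<le> d (x j) * k (x (Suc j))"
      using y' y1 x1 d k(2) mono_onD[OF k(1), of y "x (Suc j)"]
      by (intro mult_mono) (auto simp: monotone_on_def)
    also have "\<dots> = f (x j) + d (x j) * e j" using f[OF x1[of j]] by (simp add: e_def algebra_simps)
    also have "\<dots> \<le> c j" unfolding c_def
      using d(1) x1[of j] e0[of j] by (intro add_left_mono mult_right_mono) (auto simp: monotone_on_def)
    finally show "f y \<le> c j" .
  qed
  also have "(\<Sum>j. c j) = (\<Sum>j. f (x j)) + d 1 * (\<Sum>j. e j)"
    unfolding c_def using S Se unfolding x_def
    by (subst suminf_add[symmetric]) (auto simp: suminf_mult intro: summable_mult)
  also have "\<dots> \<le> (\<Sum>j. f (x j)) + d 1 * (1 - k 1)"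
    using d1 suminf_le_const[OF Se part] by (intro add_left_mono mult_left_mono)
  finally show ?thesis by (simp add: x_def ennreal_leI)
qed

text \<open>The decreasing part at a grid point is charged to the cell on its left, the
  increasing part to the cell on its right.\<close>

lemma sum_decreasing_increasing_le_nn_int:
  fixes f D U :: "real \<Rightarrow> real" and n :: nat
  assumes n: "n \<ge> 1" and DU: "antimono_on {0<..<1} D" "mono_on {0<..<1} U"
    and f: "\<And>x. 0 < x \<Longrightarrow> x < 1 \<Longrightarrow> D x \<ge> 0 \<and> U x \<ge> 0 \<and> f x = D x + U x"
  shows "ennreal (\<Sum>i\<in>{1..<n}. f (real i / real n)) \<le> ennreal (real n) * nn_int f {0<..<1}"
proof -
  define c where "c i = (if Suc i < n then D (real (Suc i) / real n) else 0) + (if i > 0 then U (real i / real n) else 0)" for i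
  have in01: "0 < real i / real n \<and> real i / real n < 1" if "0 < i" "i < n" for i
    using that by simp
  have "(\<Sum>i\<in>{1..<n}. f (real i / real n)) = (\<Sum>i\<in>{1..<n}. D (real i / real n)) + (\<Sum>i\<in>{1..<n}. U (real i / real n))"
    unfolding sum.distrib[symmetric] using f in01 by (intro sum.cong) auto
  also have "(\<Sum>i\<in>{1..<n}. D (real i / real n)) = (\<Sum>i<n. if Suc i < n then D (real (Suc i) / real n) else 0)"
  proof -
    obtain m where m: "n = Suc m" using n by (cases n) auto
    have "(\<Sum>i\<in>{1..<n}. D (real i / real n)) = (\<Sum>i\<in>{0..<m}. D (real (Suc i) / real n))"
      unfolding m One_nat_def by (subst sum.shift_bounds_Suc_ivl) simp
    then show ?thesis unfolding m by (simp add: atLeast0LessThan)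
  qed
  also have "(\<Sum>i\<in>{1..<n}. U (real i / real n)) = (\<Sum>i<n. if i > 0 then U (real i / real n) else 0)"
  proof -
    have "{i \<in> {..<n}. i > 0} = {1..<n}" by auto
    then show ?thesis by (simp add: sum.inter_filter[symmetric])
  qed
  finally have eq: "(\<Sum>i\<in>{1..<n}. f (real i / real n)) = (\<Sum>i<n. c i)"
    by (simp add: c_def sum.distrib)
  show ?thesis unfolding eq
  proof (rule sum_cells_le_nn_int[OF n])
    fix i assume i: "i < n"
    show "c i \<ge> 0" unfolding c_def using f[OF in01[THEN conjunct1] in01[THEN conjunct2]] i
      by (intro add_nonneg_nonneg) (auto simp del: of_nat_Suc)
    fix x assume x: "real i / real n < x" "x < real (Suc i) / real n"
    have "0 \<le> real i / real n" "real (Suc i) / real n \<le> 1" using i n by (auto simp: divide_le_eq_1)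
    then have x01: "0 < x" "x < 1" using x by linarith+
    have "(if Suc i < n then D (real (Suc i) / real n) else 0) \<le> D x"
      using DU(1) x x01 in01[of "Suc i"] f[OF x01] by (auto simp: monotone_on_def simp del: of_nat_Suc)
    moreover have "(if i > 0 then U (real i / real n) else 0) \<le> U x"
      using DU(2) x x01 in01[of i] f[OF x01] i by (auto simp: monotone_on_def)
    ultimately show "c i \<le> f x" unfolding c_def using f[OF x01] by linarith
  qed
qed

lemma powr_le_affine:
  fixes t l :: real
  assumes "t > 0" "0 \<le> l" "l \<le> 1"
  shows "t powr l \<le> 1 - l + l * t"
proof -
  have "exp ((1 - l) *\<^sub>R 0 + l *\<^sub>R ln t) \<le> (1 - l) * exp 0 + l * exp (ln t)"
    using assms by (intro convex_onD[OF exp_convex]) auto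
  then show ?thesis using assms by (simp add: powr_def)
qed

text \<open>Slopes of the concave function \<open>1 - (1 + x) powr (- a)\<close> at the origin.\<close>

lemma negative_power_slope_antimono:
  fixes a :: real
  assumes a: "0 < a"
  shows "antimono_on {0<..} (\<lambda>x. (1 - (1 + x) powr (- a)) / x)"
proof (rule monotone_onI)
  fix x y :: real assume "x \<in> {0<..}" "y \<in> {0<..}" and xy: "x \<le> y"
  then have x: "x > 0" and y: "y > 0" by auto
  define l where "l = x / y"
  have l: "0 \<le> l" "l \<le> 1" "x = l * y" using x y xy by (auto simp: l_def)
  have "(1 + y) powr l \<le> 1 + x" using powr_le_affine[of "1 + y" l] l y by (simp add: algebra_simps)
  then have "(1 + x) powr (- a) \<le> ((1 + y) powr l) powr (- a)" using a y by (intro powr_mono2') auto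
  also have "\<dots> = ((1 + y) powr (- a)) powr l" by (simp add: powr_powr mult.commute)
  also have "\<dots> \<le> 1 - l + l * (1 + y) powr (- a)" using l y by (intro powr_le_affine) auto
  finally have "l * (1 - (1 + y) powr (- a)) \<le> 1 - (1 + x) powr (- a)" by (simp add: algebra_simps)
  then show "(1 - (1 + x) powr (- a)) / x \<ge> (1 - (1 + y) powr (- a)) / y"
    using x y by (simp add: l_def field_simps)
qed

text \<open>Slopes at the origin of a convex function; concavity of \<open>t powr b\<close> is convexity of its
  inverse \<open>t powr (1 / b)\<close>.\<close>

lemma concave_power_slope_mono:
  fixes b :: real
  assumes b: "0 < b" "b < 1"
  shows "mono_on {0<..} (\<lambda>x. ((1 + x) - (1 + x) powr b) / x)"
proof (rule mono_onI)
  fix x y :: real assume "x \<in> {0<..}" "y \<in> {0<..}" and xy: "x \<le> y"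
  then have x: "x > 0" and y: "y > 0" by auto
  define l where "l = x / y"
  have l: "0 < l" "l \<le> 1" "x = l * y" using x y xy by (auto simp: l_def)
  have "(1 - l) * 1 + l * (1 + y) powr b \<le> (1 + x) powr b"
  proof (cases "l = 1")
    case False
    have "((1 - l) * 1 + l * (1 + y) powr b) powr (1 / b) \<le> (1 - l) * 1 powr (1 / b) + l * ((1 + y) powr b) powr (1 / b)"
      using b l False by (intro powr_convex_combination) auto
    also have "\<dots> = 1 + x" using b y l by (simp add: powr_powr algebra_simps)
    finally have "(((1 - l) * 1 + l * (1 + y) powr b) powr (1 / b)) powr b \<le> (1 + x) powr b"
      using b by (intro powr_mono2) auto
    moreover have "(1 - l) * 1 + l * (1 + y) powr b \<ge> 0" using l by (intro add_nonneg_nonneg) auto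
    ultimately show ?thesis using b by (simp add: powr_powr)
  qed (use l in simp)
  then have "(1 + x) - (1 + x) powr b \<le> l * ((1 + y) - (1 + y) powr b)"
    using l by (simp add: algebra_simps)
  then show "((1 + x) - (1 + x) powr b) / x \<le> ((1 + y) - (1 + y) powr b) / y"
    using x y by (simp add: l_def field_simps)
qed

text \<open>The loss must stay at \<open>1 / 2\<close> for all \<open>r\<close>. For \<open>r \<le> 1\<close> the integrand decreases and nothing is lost. For
  \<open>r > 1\<close> it need not, and the factors are chosen with care: moving \<open>x / (1 + x)\<close> from the
  increasing factor to the decreasing one makes the latter \<open>1 / 2\<close> at \<open>x = 1\<close>, while the increasing factor
  remains increasing and bounded by \<open>1\<close>.\<close>

lemma far_integral_le_sum:
  fixes a s r :: real and n :: nat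
  assumes n: "n \<ge> 1" and a: "0 < a" "a < 1" and s: "0 < s" and r: "r > 0"
  defines "f \<equiv> \<lambda>x. x powr (- 1 - s) * (1 - (1 + x) powr (- a)) powr r"
  assumes S: "summable (\<lambda>j. f (real (n + j) / real n))"
  shows "ennreal (real n) * nn_int f {1..} \<le> ennreal ((\<Sum>j. f (real (n + j) / real n)) + 1 / 2)"
proof -
  define B where "B x = 1 - (1 + x) powr (- a)" for x :: real
  have B: "0 \<le> B x" "B x \<le> 1" if "x \<ge> 0" for x
    using that a powr_mono[of "- a" 0 "1 + x"] by (auto simp: B_def)
  have Bpos: "0 < B x" if "x > 0" for x
    using that a powr_less_mono[of "- a" 0 "1 + x"] by (auto simp: B_def)
  have fB: "f x = x powr (- 1 - s) * B x powr r" for x by (simp add: f_def B_def)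
  show ?thesis
  proof (cases "r \<le> 1")
    case True
    have anti: "antimono_on {1..} f"
    proof (rule monotone_onI)
      fix x y :: real assume "x \<in> {1..}" "y \<in> {1..}" and xy: "x \<le> y"
      then have x: "x \<ge> 1" and y: "y \<ge> 1" by auto
      have e: "f z = z powr (r - 1 - s) * (B z / z) powr r" if "z \<ge> 1" for z
      proof -
        have "z powr (- 1 - s) = z powr (r - 1 - s) / z powr r"
          unfolding powr_diff[symmetric] by simp
        then show ?thesis unfolding fB using that B[of z] by (simp add: powr_divide)
      qed
      have "B y / y \<le> B x / x"
        using negative_power_slope_antimono[OF a(1)] x y xy by (auto simp: monotone_on_def B_def)
      then have "(B y / y) powr r \<le> (B x / x) powr r" using B[of y] y r by (intro powr_mono2) auto
      then show "f x \<ge> f y" unfolding e[OF x] e[OF y]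
        using powr_mono2'[of "r - 1 - s" x y] True s x xy by (intro mult_mono) auto
    qed
    have "ennreal (real n) * nn_int f {1..} \<le> ennreal ((\<Sum>j. f (real (n + j) / real n)) + f 1 * (1 - 1))"
      by (rule nn_int_le_sum_product[where d = f and k = "\<lambda>_. 1", OF n anti _ _ _ _ S]) (auto simp: fB mono_on_def)
    also have "\<dots> \<le> ennreal ((\<Sum>j. f (real (n + j) / real n)) + 1 / 2)" by (intro ennreal_leI) simp
    finally show ?thesis .
  next
    case False
    define k where "k x = ((1 + x) - (1 + x) powr (1 - a)) / x * B x powr (r - 1)" for x
    define d where "d x = 1 / (x powr s * (1 + x))" for x :: real
    \<comment> \<open>This slope is \<open>B x\<close> without its factor \<open>x / (1 + x)\<close>, which goes into \<open>d\<close>.\<close>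
    have q: "((1 + x) - (1 + x) powr (1 - a)) / x = (1 + x) * B x / x" if "x \<ge> 1" for x
      using that by (simp add: B_def powr_diff powr_minus field_simps)
    have k1: "0 \<le> k x \<and> k x \<le> 1" if x: "x \<ge> 1" for x
    proof -
      have "(1 + x) powr (1 - a) \<ge> 1" using x a by (intro ge_one_powr_ge_zero) auto
      then have "((1 + x) - (1 + x) powr (1 - a)) / x \<le> 1" using x by (simp add: field_simps)
      moreover have "((1 + x) - (1 + x) powr (1 - a)) / x \<ge> 0" unfolding q[OF x] using x B[of x] by simp
      moreover have "B x powr (r - 1) \<le> 1" using B[of x] x False by (intro powr_le1) auto
      ultimately show ?thesis unfolding k_def by (intro conjI mult_nonneg_nonneg mult_le_one) (auto simp del: zero_le_divide_iff)
    qed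
    have km: "mono_on {1..} k"
    proof (rule mono_onI)
      fix x y :: real assume "x \<in> {1..}" "y \<in> {1..}" and xy: "x \<le> y"
      then have x: "x \<ge> 1" and y: "y \<ge> 1" by auto
      have "B x \<le> B y" unfolding B_def using x xy a by (intro diff_left_mono powr_mono2') auto
      moreover have "((1 + x) - (1 + x) powr (1 - a)) / x \<le> ((1 + y) - (1 + y) powr (1 - a)) / y"
        using concave_power_slope_mono[of "1 - a"] a x y xy by (auto simp: mono_on_def)
      moreover have "((1 + x) - (1 + x) powr (1 - a)) / x \<ge> 0" "((1 + y) - (1 + y) powr (1 - a)) / y \<ge> 0"
        unfolding q[OF x] q[OF y] using x y B[of x] B[of y] by auto
      ultimately show "k x \<le> k y" unfolding k_def
        using B[of x] x False by (intro mult_mono powr_mono2) auto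
    qed
    have dm: "antimono_on {1..} d"
    proof (rule monotone_onI)
      fix x y :: real assume "x \<in> {1..}" "y \<in> {1..}" and xy: "x \<le> y"
      then have "x powr s * (1 + x) \<le> y powr s * (1 + y)" "x powr s * (1 + x) > 0"
        using s by (auto intro!: mult_mono powr_mono2)
      then show "d x \<ge> d y" unfolding d_def by (intro divide_left_mono) auto
    qed
    have fd: "f x = d x * k x" if x: "x \<ge> 1" for x
    proof -
      have "B x powr r = B x * B x powr (r - 1)"
        using Bpos[of x] x by (simp add: powr_mult_base)
      moreover have "x powr (- 1 - s) = 1 / (x * x powr s)"
        using x by (simp add: powr_diff powr_minus field_simps)
      ultimately have "f x = 1 / (x * x powr s) * (B x * B x powr (r - 1))" unfolding fB by (simp only:)
      also have "\<dots> = d x * k x"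
      proof -
        have "x powr s > 0" using x by simp
        then have "1 / (x * X) * (b * c) = 1 / (X * (1 + x)) * ((1 + x) * b / x * c)"
          if "X = x powr s" for X b c :: real
          using x that by (simp add: divide_simps)
        then show ?thesis unfolding d_def k_def q[OF x] by simp
      qed
      finally show ?thesis .
    qed
    have "ennreal (real n) * nn_int f {1..} \<le> ennreal ((\<Sum>j. f (real (n + j) / real n)) + d 1 * (1 - k 1))"
      by (rule nn_int_le_sum_product[OF n dm _ km k1 fd S]) (auto simp: d_def)
    also have "\<dots> \<le> ennreal ((\<Sum>j. f (real (n + j) / real n)) + 1 / 2)"
      using k1[of 1] by (intro ennreal_leI) (simp add: d_def)
    finally show ?thesis .
  qed
qed

lemma reflected_integral_le_sum:
  fixes a s r :: real and n :: nat
  assumes n: "n \<ge> 1" and a: "0 < a" and s: "0 < s" and r: "r > 0"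
  defines "f \<equiv> \<lambda>x. (1 + x) powr (- 1 - s) * (1 - x powr (- a)) powr r"
  assumes S: "summable (\<lambda>j. f (real (n + j) / real n))"
  shows "ennreal (real n) * nn_int f {1..} \<le> ennreal ((\<Sum>j. f (real (n + j) / real n)) + 1 / 2)"
proof -
  have le1: "x powr (- a) \<le> 1" if "x \<ge> 1" for x :: real using that a powr_mono[of "- a" 0 x] by simp
  have "ennreal (real n) * nn_int f {1..} \<le> ennreal ((\<Sum>j. f (real (n + j) / real n)) +
      (1 + 1) powr (- 1 - s) * (1 - (1 - 1 powr (- a)) powr r))"
  proof (rule nn_int_le_sum_product[OF n, where d = "\<lambda>x. (1 + x) powr (- 1 - s)" and k = "\<lambda>x. (1 - x powr (- a)) powr r"])
    show "antimono_on {1..} (\<lambda>x::real. (1 + x) powr (- 1 - s))"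
      using s by (auto simp: monotone_on_def intro!: powr_mono2')
    show "mono_on {1..} (\<lambda>x::real. (1 - x powr (- a)) powr r)"
    proof (rule mono_onI)
      fix x y :: real assume "x \<in> {1..}" "y \<in> {1..}" "x \<le> y"
      then show "(1 - x powr (- a)) powr r \<le> (1 - y powr (- a)) powr r"
        using a r le1[of x] by (intro powr_mono2 diff_left_mono powr_mono2') auto
    qed
    show "0 \<le> (1 - x powr (- a)) powr r \<and> (1 - x powr (- a)) powr r \<le> 1" if "x \<ge> 1" for x :: real
      using le1[OF that] r by (auto intro: powr_le1)
  qed (use S in \<open>auto simp: f_def\<close>)
  also have "\<dots> \<le> ennreal ((\<Sum>j. f (real (n + j) / real n)) + 1 / 2)"
  proof -
    have "2 powr (- 1 - s) \<le> 2 powr (- 1 :: real)" using s by (intro powr_mono) auto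
    then show ?thesis by (intro ennreal_leI) (simp add: powr_minus)
  qed
  finally show ?thesis .
qed

section \<open>Inversion and the sign of the integrals\<close>

text \<open>The substitution \<open>t = x / (1 + x)\<close>; in terms of \<open>1 - t\<close> and \<open>1 + x\<close> it is the inversion
  \<open>1 - t = 1 / (1 + x)\<close>.\<close>

lemma nn_int_substitution:
  fixes h :: "real \<Rightarrow> real" and c :: real
  assumes [measurable]: "h \<in> borel_measurable borel" and c: "0 \<le> c" "c < 1"
  shows "nn_int h {c<..<1} = nn_int (\<lambda>x. h (x / (1 + x)) / (1 + x)\<^sup>2) {c / (1 - c)<..}"
proof -
  define b where "b = c / (1 - c)"
  have b: "b \<ge> 0" using c by (simp add: b_def)
  define g where "g x = x / (1 + x)" for x :: real
  have gb: "g b = c" using c by (simp add: g_def b_def field_simps)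
  define l where "l k = b + 1 / real (Suc k)" for k
  define u where "u k = b + real (Suc k)" for k
  have l: "b < l k" for k by (simp add: l_def)
  have lu: "l k \<le> u k" for k by (simp add: l_def u_def field_simps)
  have lm: "l (Suc k) \<le> l k" "u k \<le> u (Suc k)" for k by (auto simp: l_def u_def frac_le)
  have g_mono: "g x < g y" if "0 \<le> x" "x < y" for x y using that by (simp add: g_def field_simps)
  have g_mono': "g x \<le> g y" if "0 \<le> x" "x \<le> y" for x y using g_mono[of x y] that by (cases "x = y") auto
  \<comment> \<open>Substitution on compact intervals; the half-line follows by monotone convergence.\<close>
  have step: "nn_int h {g (l k)..g (u k)} = nn_int (\<lambda>x. h (g x) / (1 + x)\<^sup>2) {l k..u k}" for k
  proof -
    have m: "set_borel_measurable borel {g (l k)..g (u k)} h"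
      unfolding set_borel_measurable_def by measurable
    have "(\<integral>\<^sup>+x. ennreal (h x * indicator {g (l k)..g (u k)} x) \<partial>lborel) =
          (\<integral>\<^sup>+x. ennreal (h (g x) * (1 / (1 + x)\<^sup>2) * indicator {l k..u k} x) \<partial>lborel)"
    proof (rule nn_integral_substitution[OF m _ _ _ lu])
      fix x assume "x \<in> {l k..u k}"
      then have "x > 0" using l[of k] b by auto
      then show "(g has_real_derivative 1 / (1 + x)\<^sup>2) (at x)"
        unfolding g_def by (auto intro!: derivative_eq_intros simp: power2_eq_square field_simps)
    next
      show "continuous_on {l k..u k} (\<lambda>x. 1 / (1 + x)\<^sup>2)"
        using l[of k] b by (intro continuous_intros) auto
    qed auto
    then show ?thesis unfolding nn_int_def nn_integral_set_ennreal by simp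
  qed
  have "nn_int h (\<Union>k. {g (l k)..g (u k)}) = (SUP k. nn_int h {g (l k)..g (u k)})"
  proof (rule nn_int_incseq)
    show "incseq (\<lambda>k. {g (l k)..g (u k)})"
    proof (rule incseq_SucI)
      fix k
      have "g (l (Suc k)) \<le> g (l k)" "g (u k) \<le> g (u (Suc k))"
        using l[of "Suc k"] lm[of k] b lu[of k] l[of k] by (auto intro!: g_mono')
      then show "{g (l k)..g (u k)} \<subseteq> {g (l (Suc k))..g (u (Suc k))}" by auto
    qed
  qed auto
  also have "\<dots> = (SUP k. nn_int (\<lambda>x. h (g x) / (1 + x)\<^sup>2) {l k..u k})" by (simp only: step)
  also have "\<dots> = nn_int (\<lambda>x. h (g x) / (1 + x)\<^sup>2) (\<Union>k. {l k..u k})"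
  proof (rule nn_int_incseq[symmetric])
    show "(\<lambda>x. h (g x) / (1 + x)\<^sup>2) \<in> borel_measurable borel" unfolding g_def by measurable
    show "incseq (\<lambda>k. {l k..u k})"
      using lm by (intro incseq_SucI) (auto intro: order_trans)
  qed auto
  also have lu_eq: "(\<Union>k. {l k..u k}) = {b<..}"
  proof (intro equalityI subsetI)
    fix x assume "x \<in> {b<..}"
    then have x: "x > b" by simp
    obtain k1 where k1: "1 / real (Suc k1) < x - b" using x reals_Archimedean[of "x - b"] by (auto simp: inverse_eq_divide)
    obtain k2 where k2: "x - b < real k2" using reals_Archimedean2 by blast
    have "1 / real (Suc (max k1 k2)) \<le> 1 / real (Suc k1)" by (simp add: frac_le)
    then have "l (max k1 k2) \<le> x" "x \<le> u (max k1 k2)" using k1 k2 by (auto simp: l_def u_def)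
    then show "x \<in> (\<Union>k. {l k..u k})" by auto
  next
    fix x assume "x \<in> (\<Union>k. {l k..u k})"
    then obtain k where "l k \<le> x" by auto
    then show "x \<in> {b<..}" using l[of k] by simp
  qed
  also have "(\<Union>k. {g (l k)..g (u k)}) = {c<..<1}"
  proof (intro equalityI subsetI)
    fix t assume t: "t \<in> {c<..<1}"
    define x where "x = t / (1 - t)"
    have x: "x \<ge> 0" "g x = t" using t c by (auto simp: x_def g_def field_simps)
    have "x > b"
    proof (rule ccontr)
      assume "\<not> x > b"
      then have "g x \<le> g b" using x by (intro g_mono') auto
      then show False using x gb t by simp
    qed
    then have "x \<in> (\<Union>k. {l k..u k})" unfolding lu_eq by simp
    then obtain k where "l k \<le> x" "x \<le> u k" by auto
    then have "t \<in> {g (l k)..g (u k)}" using x l[of k] b by (auto intro!: g_mono' simp flip: x(2))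
    then show "t \<in> (\<Union>k. {g (l k)..g (u k)})" by blast
  next
    fix t assume "t \<in> (\<Union>k. {g (l k)..g (u k)})"
    then obtain k where k: "g (l k) \<le> t" "t \<le> g (u k)" by auto
    have "c < g (l k)" using g_mono[OF b l[of k]] gb by simp
    moreover have "g (u k) < 1" using lu[of k] l[of k] b by (simp add: g_def)
    ultimately show "t \<in> {c<..<1}" using k by simp
  qed
  finally show ?thesis by (simp add: g_def b_def)
qed

text \<open>The pair is \<open>f = f1 - F\<close>, and neither part is integrable at \<open>0\<close> in general, so both are cut
  off at \<open>\<delta>\<close>. The inversion turns \<open>f1\<close> on \<open>\<delta> < x < 1\<close> into \<open>F x * (1 + x) powr \<mu>\<close> on
  \<open>x > \<delta> / (1 - \<delta>)\<close>, where \<open>\<mu> = \<kappa> - 1 < 0\<close>. Enlarging this range to \<open>x > \<delta>\<close>, one may cancel the finite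
  integral of \<open>F\<close> over \<open>\<delta> < x < 1\<close>. The factor \<open>1 - (1 + x) powr \<mu>\<close> leaves the gain \<open>c\<close>, read off from
  \<open>1 \<le> x \<le> 2\<close>.\<close>

lemma pair_integral_less_far_integral:
  fixes a s r :: real
  assumes a: "0 < a" and s: "0 < s" and r: "r > 0" and \<kappa>: "s + a * r < 1"
  defines "f \<equiv> \<lambda>x. x powr (- 1 - s) * (((1 - x) powr (- a) - 1) powr r - (1 - (1 + x) powr (- a)) powr r)"
  defines "F \<equiv> \<lambda>x. x powr (- 1 - s) * (1 - (1 + x) powr (- a)) powr r"
  shows "\<exists>c>0. nn_int f {0<..<1} + ennreal c \<le> nn_int F {1..}"
proof -
  define f1 where "f1 x = x powr (- 1 - s) * ((1 - x) powr (- a) - 1) powr r" for x :: real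
  define \<mu> where "\<mu> = s + a * r - 1"
  have \<mu>: "\<mu> < 0" using \<kappa> by (simp add: \<mu>_def)
  have [measurable]: "f \<in> borel_measurable borel" "F \<in> borel_measurable borel" "f1 \<in> borel_measurable borel"
    unfolding f_def F_def f1_def[abs_def] by measurable
  have F0: "F x \<ge> 0" for x by (simp add: F_def)
  have ff: "f x + F x = f1 x" for x by (simp add: f_def F_def f1_def algebra_simps)
  have f0: "f x \<ge> 0" if x: "0 < x" "x < 1" for x
  proof -
    have "(1 + x) powr (- a) \<le> (1 + x) powr 0" using x a by (intro powr_mono) auto
    then have "1 - (1 + x) powr (- a) \<ge> 0" using x by simp
    have "1 / (1 - x) \<ge> 1 + x" using x by (simp add: field_simps)
    have "(1 - (1 + x) powr (- a)) \<le> (1 - x) powr (- a) - 1"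
    proof -
      define v where "v = (1 + x) powr a"
      have v: "v > 0" using x by (simp add: v_def)
      have "v \<le> (1 / (1 - x)) powr a" unfolding v_def using x a \<open>1 / (1 - x) \<ge> 1 + x\<close> by (intro powr_mono2) auto
      also have "\<dots> = (1 - x) powr (- a)" using x by (simp add: powr_divide powr_minus field_simps)
      finally have "v \<le> (1 - x) powr (- a)" .
      moreover have "(1 + x) powr (- a) = 1 / v" using x by (simp add: v_def powr_minus field_simps)
      moreover have "v + 1 / v \<ge> 2"
      proof -
        have "v + 1 / v - 2 = (v - 1)\<^sup>2 / v" using v by (simp add: power2_eq_square field_simps)
        also have "\<dots> \<ge> 0" using v by simp
        finally show ?thesis by simp
      qed
      ultimately show ?thesis by simp
    qed
    then have "(1 - (1 + x) powr (- a)) powr r \<le> ((1 - x) powr (- a) - 1) powr r"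
      using r \<open>1 - (1 + x) powr (- a) \<ge> 0\<close> by (intro powr_mono2) auto
    then show ?thesis by (simp add: f_def)
  qed
  have sub: "f1 (x / (1 + x)) / (1 + x)\<^sup>2 = F x * (1 + x) powr \<mu>" if x: "x > 0" for x
  proof -
    have e1: "1 - x / (1 + x) = 1 / (1 + x)" using x by (simp add: field_simps)
    have e2: "(1 / (1 + x)) powr (- a) - 1 = (1 + x) powr a * (1 - (1 + x) powr (- a))"
      using x by (simp add: powr_divide powr_minus field_simps)
    have nn: "1 - (1 + x) powr (- a) \<ge> 0"
      using x a powr_mono[of "- a" 0 "1 + x"] by simp
    have "f1 (x / (1 + x)) / (1 + x)\<^sup>2 = (x powr (- 1 - s) / (1 + x) powr (- 1 - s)) *
       ((1 + x) powr (a * r) * (1 - (1 + x) powr (- a)) powr r) / (1 + x) powr 2"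
      unfolding f1_def e1 e2 using x nn by (simp add: powr_divide powr_mult powr_powr)
    also have "\<dots> = F x * ((1 + x) powr (a * r) / (1 + x) powr (- 1 - s) / (1 + x) powr 2)"
      by (simp add: F_def)
    also have "(1 + x) powr (a * r) / (1 + x) powr (- 1 - s) / (1 + x) powr 2 = (1 + x) powr \<mu>"
      unfolding powr_diff[symmetric] by (rule arg_cong[where f = "\<lambda>t. (1 + x) powr t"]) (simp add: \<mu>_def)
    finally show ?thesis .
  qed
  have m1: "(1 + x) powr \<mu> \<le> 1" if "x \<ge> 0" for x
    using that \<mu> powr_mono[of \<mu> 0 "1 + x"] by simp
  define c where "c = 2 powr (- 1 - s) * (1 - 2 powr (- a)) powr r * (1 - 2 powr \<mu>)"
  have c: "c > 0"
  proof -
    have "2 powr (- a) < 2 powr (0::real)" "2 powr \<mu> < 2 powr (0::real)"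
      using a \<mu> by (intro powr_less_mono; simp)+
    then show ?thesis unfolding c_def by (intro mult_pos_pos) auto
  qed
  define G where "G x = F x * (1 + x) powr \<mu>" for x
  define E where "E x = F x * (1 - (1 + x) powr \<mu>)" for x
  have [measurable]: "G \<in> borel_measurable borel" "E \<in> borel_measurable borel"
    unfolding G_def[abs_def] E_def[abs_def] by measurable
  have GE: "G x + E x = F x" for x by (simp add: G_def E_def algebra_simps)
  have G0: "G x \<ge> 0" for x using F0[of x] by (simp add: G_def)
  have E0: "E x \<ge> 0" if "x \<ge> 0" for x using F0[of x] m1[OF that] by (simp add: E_def)
  have Ec: "E x \<ge> c" if x: "x \<in> {1..2}" for x
  proof -
    have "2 powr (- 1 - s) \<le> x powr (- 1 - s)" using x s by (intro powr_mono2') auto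
    moreover have "(1 - 2 powr (- a)) powr r \<le> (1 - (1 + x) powr (- a)) powr r"
      using x a r powr_mono[of "- a" 0 "2::real"] by (intro powr_mono2 diff_left_mono powr_mono2') auto
    moreover have "1 - 2 powr \<mu> \<le> 1 - (1 + x) powr \<mu>" using x \<mu> by (intro diff_left_mono powr_mono2') auto
    moreover have "1 - 2 powr \<mu> \<ge> 0" using m1[of 1] by simp
    ultimately show ?thesis unfolding c_def E_def F_def by (intro mult_mono) auto
  qed
  have bound: "nn_int f {\<delta><..<1} + ennreal c \<le> nn_int F {1..}" if \<delta>: "0 < \<delta>" "\<delta> < 1" for \<delta>
  proof -
    have "nn_int f {\<delta><..<1} + nn_int F {\<delta><..<1} = nn_int f1 {\<delta><..<1}"
      unfolding ff[symmetric] using \<delta> f0 F0 by (intro nn_int_add[symmetric]) auto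
    also have "\<dots> = nn_int (\<lambda>x. f1 (x / (1 + x)) / (1 + x)\<^sup>2) {\<delta> / (1 - \<delta>)<..}"
      using \<delta> by (intro nn_int_substitution) auto
    also have "\<dots> = nn_int G {\<delta> / (1 - \<delta>)<..}"
    proof (rule nn_int_cong)
      fix x assume "x \<in> {\<delta> / (1 - \<delta>)<..}"
      moreover have "\<delta> / (1 - \<delta>) > 0" using \<delta> by simp
      ultimately have "x > 0" by (metis greaterThan_iff order_less_trans)
      then show "f1 (x / (1 + x)) / (1 + x)\<^sup>2 = G x" using sub by (simp add: G_def)
    qed
    also have "\<dots> \<le> nn_int G {\<delta><..}"
    proof (rule nn_int_subset)
      have "\<delta> \<le> \<delta> / (1 - \<delta>)" using \<delta> by (simp add: field_simps)
      then show "{\<delta> / (1 - \<delta>)<..} \<subseteq> {\<delta><..}" by auto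
    qed
    finally have A: "nn_int f {\<delta><..<1} + nn_int F {\<delta><..<1} \<le> nn_int G {\<delta><..}" .
    have "ennreal c \<le> nn_int E {\<delta><..}"
    proof -
      have "ennreal c = nn_int (\<lambda>_. c) {1..2}" using c by (subst nn_int_const) auto
      also have "\<dots> \<le> nn_int E {1..2}" by (intro nn_int_mono Ec)
      also have "\<dots> \<le> nn_int E {\<delta><..}" using \<delta> by (intro nn_int_subset) auto
      finally show ?thesis .
    qed
    then have "nn_int f {\<delta><..<1} + nn_int F {\<delta><..<1} + ennreal c \<le> nn_int G {\<delta><..} + nn_int E {\<delta><..}"
      using A by (intro add_mono)
    also have "\<dots> = nn_int F {\<delta><..}"
      unfolding GE[symmetric] using \<delta> G0 E0 by (intro nn_int_add[symmetric]) auto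
    also have "{\<delta><..} = {\<delta><..<1} \<union> {1..}" using \<delta> by auto
    also have "nn_int F ({\<delta><..<1} \<union> {1..}) = nn_int F {\<delta><..<1} + nn_int F {1..}"
      by (intro nn_int_Un) auto
    finally have "nn_int F {\<delta><..<1} + (nn_int f {\<delta><..<1} + ennreal c) \<le> nn_int F {\<delta><..<1} + nn_int F {1..}"
      by (simp add: add_ac)
    moreover have "nn_int F {\<delta><..<1} \<noteq> \<infinity>"
    proof -
      have "nn_int F {\<delta><..<1} \<le> nn_int (\<lambda>_. \<delta> powr (- 1 - s)) {\<delta><..<1}"
      proof (rule nn_int_mono)
        fix x assume x: "x \<in> {\<delta><..<1}"
        have "x powr (- 1 - s) \<le> \<delta> powr (- 1 - s)" using x \<delta> s by (intro powr_mono2') auto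
        moreover have "(1 - (1 + x) powr (- a)) powr r \<le> 1"
          using x \<delta> a r powr_mono[of "- a" 0 "1 + x"] by (intro powr_le1) auto
        ultimately have "F x \<le> \<delta> powr (- 1 - s) * 1" unfolding F_def by (intro mult_mono) auto
        then show "F x \<le> \<delta> powr (- 1 - s)" by simp
      qed
      also have "\<dots> \<le> nn_int (\<lambda>_. \<delta> powr (- 1 - s)) {\<delta>..1}" by (intro nn_int_subset) auto
      also have "\<dots> < \<infinity>" using \<delta> by (subst nn_int_const) auto
      finally show ?thesis by simp
    qed
    ultimately show ?thesis by (simp add: ennreal_add_left_cancel_le)
  qed
  have "nn_int f {0<..<1} = (SUP k. nn_int f {1 / real (k + 2)<..<1})"
  proof -
    have "incseq (\<lambda>k. {1 / real (k + 2)<..<1})"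
      by (intro incseq_SucI) (auto elim!: order.strict_trans1[rotated] intro!: frac_le)
    moreover have "(\<Union>k. {1 / real (k + 2)<..<1}) = {0<..<1}"
    proof (intro equalityI subsetI)
      fix x :: real assume x: "x \<in> {0<..<1}"
      then obtain k where "1 / real (Suc k) < x" using reals_Archimedean[of x] by (auto simp: inverse_eq_divide)
      moreover have "1 / real (k + 2) \<le> 1 / real (Suc k)" by (intro frac_le) auto
      ultimately have "1 / real (k + 2) < x" by linarith
      then show "x \<in> (\<Union>k. {1 / real (k + 2)<..<1})" using x by auto
    next
      fix x :: real assume "x \<in> (\<Union>k. {1 / real (k + 2)<..<1})"
      then obtain k where "1 / real (k + 2) < x" "x < 1" by auto
      moreover have "1 / real (k + 2) > 0" by simp
      ultimately show "x \<in> {0<..<1}" by (metis greaterThanLessThan_iff order_less_trans)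
    qed
    ultimately show ?thesis using nn_int_incseq[of f "\<lambda>k. {1 / real (k + 2)<..<1}"] by simp
  qed
  then have "nn_int f {0<..<1} + ennreal c = (SUP k. nn_int f {1 / real (k + 2)<..<1} + ennreal c)"
    by (simp add: ennreal_SUP_add_left)
  also have "\<dots> \<le> nn_int F {1..}"
    by (intro SUP_least bound) auto
  finally show ?thesis using c by blast
qed

lemma reflected_integral_le:
  fixes a s r :: real
  assumes a: "0 < a" and s: "0 < s" and r: "r > 0" and \<kappa>: "s + a * r < 1"
  shows "nn_int (\<lambda>x. (1 + x) powr (- 1 - s) * (x powr (- a) - 1) powr r) {0<..<1}
     \<le> nn_int (\<lambda>x. (1 + x) powr (- 1 - s) * (1 - x powr (- a)) powr r) {1..}"
proof -
  define h where "h x = (1 + x) powr (- 1 - s) * (x powr (- a) - 1) powr r" for x :: real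
  define F where "F x = (1 + x) powr (- 1 - s) * (1 - x powr (- a)) powr r" for x :: real
  define \<mu> where "\<mu> = s + a * r - 1"
  have \<mu>: "\<mu> < 0" using \<kappa> by (simp add: \<mu>_def)
  have [measurable]: "h \<in> borel_measurable borel" "F \<in> borel_measurable borel"
    unfolding h_def[abs_def] F_def[abs_def] by measurable
  have "nn_int h {0<..<1} = nn_int (\<lambda>x. h (1 + (- 1) * x)) {x. 1 + (- 1) * x \<in> {0<..<1}}"
    by (intro nn_int_affine) auto
  also have "{x. 1 + (- 1) * x \<in> {0<..<1}} = {0<..<(1::real)}" by auto
  also have "nn_int (\<lambda>x. h (1 + (- 1) * x)) {0<..<1} =
      nn_int (\<lambda>x. h (1 + (- 1) * (x / (1 + x))) / (1 + x)\<^sup>2) {0 / (1 - 0)<..}"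
    by (rule nn_int_substitution) auto
  also have "\<dots> \<le> nn_int (\<lambda>x. F (1 + 1 * x)) {0 / (1 - 0)<..}"
  proof (rule nn_int_mono)
    fix x :: real assume "x \<in> {0 / (1 - 0)<..}"
    then have x: "x > 0" by simp
    have e1: "1 + (- 1) * (x / (1 + x)) = 1 / (1 + x)" using x by (simp add: field_simps)
    have e2: "(1 / (1 + x)) powr (- a) - 1 = (1 + x) powr a * (1 - (1 + x) powr (- a))"
      using x by (simp add: powr_divide powr_minus field_simps)
    have e3: "1 + 1 / (1 + x) = (1 + (1 + x)) / (1 + x)" using x by (simp add: field_simps)
    have nn: "1 - (1 + x) powr (- a) \<ge> 0"
      using x a powr_mono[of "- a" 0 "1 + x"] by simp
    have "h (1 + (- 1) * (x / (1 + x))) / (1 + x)\<^sup>2 = ((1 + (1 + x)) powr (- 1 - s) / (1 + x) powr (- 1 - s)) *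
       ((1 + x) powr (a * r) * (1 - (1 + x) powr (- a)) powr r) / (1 + x) powr 2"
      unfolding h_def e1 e2 e3 using x nn by (simp add: powr_divide powr_mult powr_powr)
    also have "\<dots> = F (1 + x) * ((1 + x) powr (a * r) / (1 + x) powr (- 1 - s) / (1 + x) powr 2)"
      by (simp add: F_def)
    also have "(1 + x) powr (a * r) / (1 + x) powr (- 1 - s) / (1 + x) powr 2 = (1 + x) powr \<mu>"
      unfolding powr_diff[symmetric] by (rule arg_cong[where f = "\<lambda>t. (1 + x) powr t"]) (simp add: \<mu>_def)
    also have "F (1 + x) * (1 + x) powr \<mu> \<le> F (1 + x) * 1"
      using x \<mu> powr_mono[of \<mu> 0 "1 + x"] by (intro mult_left_mono) (auto simp: F_def)
    finally show "h (1 + (- 1) * (x / (1 + x))) / (1 + x)\<^sup>2 \<le> F (1 + 1 * x)" by simp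
  qed
  also have "\<dots> = nn_int (\<lambda>x. F (1 + 1 * x)) {x. 1 + 1 * x \<in> {1<..}}"
    by (rule arg_cong[where f = "nn_int _"]) auto
  also have "\<dots> = nn_int F {1<..}" by (rule nn_int_affine[symmetric]) auto
  also have "\<dots> \<le> nn_int F {1..}" by (intro nn_int_subset) auto
  finally show ?thesis unfolding h_def F_def .
qed

section \<open>The lower bound for the fractional Laplacian\<close>

lemma sum_pairs_about:
  fixes g :: "nat \<Rightarrow> real" and n :: nat
  assumes "n \<ge> 1"
  shows "(\<Sum>j<2 * n - 1. g (Suc j)) = g n + (\<Sum>i\<in>{1..<n}. g (n - i) + g (n + i))"
proof -
  have "(\<Sum>j<2 * n - 1. g (Suc j)) = sum g {1..<2 * n}"
    by (rule sum.reindex_bij_witness[where i = "\<lambda>y. y - 1" and j = Suc]) auto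
  also have "{1..<2 * n} = insert n ({1..<n} \<union> {Suc n..<2 * n})" using assms by auto
  also have "sum g \<dots> = g n + (sum g {1..<n} + sum g {Suc n..<2 * n})"
    by (subst sum.insert) (auto simp: sum.union_disjoint)
  also have "sum g {1..<n} = (\<Sum>i\<in>{1..<n}. g (n - i))"
    by (rule sum.reindex_bij_witness[where i = "\<lambda>y. n - y" and j = "\<lambda>y. n - y"]) auto
  also have "sum g {Suc n..<2 * n} = (\<Sum>i\<in>{1..<n}. g (n + i))"
    by (rule sum.reindex_bij_witness[where i = "\<lambda>i. n + i" and j = "\<lambda>y. y - n"]) auto
  finally show ?thesis by (simp add: sum.distrib)
qed

lemma laplacian_even:
  assumes "\<And>y. u (- y) = u y"
  shows "frac_p_Laplacian p \<sigma> u (- x) = frac_p_Laplacian p \<sigma> u x"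
proof -
  have "bij_betw uminus UNIV (UNIV :: int set)"
    by (rule bij_betw_byWitness[where f' = uminus]) auto
  from infsum_reindex_bij_betw[OF this, of "\<lambda>y. edge_weight p \<sigma> (- x) y * signed_pow (u (- x) - u y) (p - 1)"]
  have "frac_p_Laplacian p \<sigma> u (- x) = (\<Sum>\<^sub>\<infinity>y. edge_weight p \<sigma> (- x) (- y) * signed_pow (u x - u y) (p - 1))"
    by (simp add: frac_p_Laplacian_def assms)
  moreover have "edge_weight p \<sigma> (- x) (- y) = edge_weight p \<sigma> x y" for y
    by (simp add: edge_weight_alt abs_minus_commute)
  ultimately show ?thesis by (simp add: frac_p_Laplacian_def)
qed

text \<open>The integers are split into \<open>y = 0\<close>, the pairs \<open>n - i\<close> and \<open>n + i\<close> with \<open>i < n\<close>, the range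
  \<open>y \<ge> 2 n\<close>, the range \<open>- n < y < 0\<close> and the range \<open>y \<le> - n\<close>. After division by \<open>N\<close> the summands of the last four are
  given by \<open>- f\<close>, \<open>F\<close>, \<open>- H\<close> and \<open>G\<close>, and the summand at \<open>y = 0\<close> is \<open>1\<close>.\<close>

lemma laplacian_lower_bound:
  fixes p \<sigma> a :: real
  assumes p: "p > 1" and s: "0 < p * \<sigma>" and a: "0 < a" "a < 1" and \<kappa>: "p * \<sigma> + (p - 1) * a < 1"
  shows "\<exists>c>0. \<forall>x. x \<noteq> 0 \<longrightarrow>
     c * \<bar>real_of_int x\<bar> powr (- (p * \<sigma> + (p - 1) * a)) \<le> frac_p_Laplacian p \<sigma> (pow_fun a 0) x"
proof -
  define s where "s = p * \<sigma>"
  define r where "r = p - 1"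
  have r: "r > 0" and s0: "s > 0" and \<kappa>': "s + a * r < 1"
    using assms by (auto simp: r_def s_def mult.commute)
  define u where "u = pow_fun a 0"
  define f where "f = (\<lambda>x::real. x powr (- 1 - s) * (((1 - x) powr (- a) - 1) powr r - (1 - (1 + x) powr (- a)) powr r))"
  define F where "F = (\<lambda>x::real. x powr (- 1 - s) * (1 - (1 + x) powr (- a)) powr r)"
  define G where "G = (\<lambda>x::real. (1 + x) powr (- 1 - s) * (1 - x powr (- a)) powr r)"
  define H where "H = (\<lambda>x::real. (1 + x) powr (- 1 - s) * (x powr (- a) - 1) powr r)"
  obtain c where c: "c > 0" "nn_int f {0<..<1} + ennreal c \<le> nn_int F {1..}"
    using pair_integral_less_far_integral[OF a(1) s0 r \<kappa>'] unfolding f_def F_def by blast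
  have HG: "nn_int H {0<..<1} \<le> nn_int G {1..}"
    unfolding H_def G_def by (rule reflected_integral_le[OF a(1) s0 r \<kappa>'])
  obtain D U where DU: "antimono_on {0<..<1} D" "mono_on {0<..<1} U"
    "\<And>x. 0 < x \<Longrightarrow> x < 1 \<Longrightarrow> D x \<ge> 0 \<and> U x \<ge> 0 \<and> f x = D x + U x"
    using pair_term_decomposition[OF a r, of "1 + s"] r \<kappa>' a
    unfolding f_def by (smt (verit) mult_nonneg_nonneg)
  have main: "c * real n powr (- (s + a * r)) \<le> frac_p_Laplacian p \<sigma> u (int n)" if n: "n \<ge> 1" for n :: nat
  proof -
    define k where "k y = edge_weight p \<sigma> (int n) y * signed_pow (u (int n) - u y) (p - 1)" for y
    define N where "N = real n powr (- 1 - s - a * r)"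
    have N: "N > 0" using n by (simp add: N_def)
    have Nsplit: "N = real n powr (- 1 - s) * (real n powr (- a)) powr r"
      using n by (simp add: N_def powr_powr flip: powr_add)
    have ks: "k summable_on UNIV"
      unfolding k_def u_def by (intro F_space_summable pow_fun_F_space p s a) auto
    have scale: "(real n * x) powr e = real n powr e * x powr e" if "x \<ge> 0" for x e
      using that by (simp add: powr_mult)
    have un: "u (int n) = real n powr (- a)" using n by (simp add: u_def pow_fun_def)
    have um: "u (int m) = real n powr (- a) * (real m / real n) powr (- a)" if "m \<ge> 1" for m
      using scale[of "real m / real n" "- a"] that n by (simp add: u_def pow_fun_def)
    have um': "u (- int m) = u (int m)" for m by (simp add: u_def pow_fun_def)
    have pos: "signed_pow (real n powr (- a) - real n powr (- a) * y) (p - 1)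
        = (real n powr (- a)) powr r * (1 - y) powr r" if "y \<le> 1" for y
    proof -
      have "real n powr (- a) - real n powr (- a) * y = real n powr (- a) * (1 - y)" by (simp add: algebra_simps)
      moreover have "signed_pow z r = z powr r" if "z \<ge> 0" for z
        using that r by (cases "z = 0") (auto simp: signed_pow_def)
      ultimately show ?thesis using that by (simp add: powr_mult r_def)
    qed
    have neg: "signed_pow (real n powr (- a) - real n powr (- a) * y) (p - 1)
        = - ((real n powr (- a)) powr r * (y - 1) powr r)" if "y \<ge> 1" for y
    proof -
      have "real n powr (- a) - real n powr (- a) * y = - (real n powr (- a) * (y - 1))" by (simp add: algebra_simps)
      moreover have "signed_pow z r = z powr r" if "z \<ge> 0" for z
        using that r by (cases "z = 0") (auto simp: signed_pow_def)
      ultimately show ?thesis using that by (simp only: signed_pow_minus) (simp add: powr_mult r_def)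
    qed
    have k0: "k 0 = N"
      unfolding k_def Nsplit using n pos[of 0] r
      by (simp add: un edge_weight_alt s_def) (simp add: u_def pow_fun_def)
    have kn: "k (int n) = 0" by (simp add: k_def edge_weight_def)
    have edge: "edge_weight p \<sigma> (int n) y = real n powr (- 1 - s) * x powr (- 1 - s)"
      if "\<bar>real_of_int (int n - y)\<bar> = real n * x" "x \<ge> 0" for y x
      unfolding edge_weight_alt that(1) s_def[symmetric] using that(2) by (rule scale)
    have le1: "x powr (- a) \<le> 1" if "x \<ge> 1" for x :: real using that a powr_mono[of "- a" 0 x] by simp
    have ge1: "x powr (- a) \<ge> 1" if "0 < x" "x \<le> 1" for x :: real
      using that a powr_mono2'[of "- a" x 1] by simp
    have kp: "k (int (n + i)) = N * F (real i / real n)" for i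
    proof -
      have "edge_weight p \<sigma> (int n) (int (n + i)) = real n powr (- 1 - s) * (real i / real n) powr (- 1 - s)"
        using n by (intro edge) auto
      moreover have "u (int (n + i)) = real n powr (- a) * (1 + real i / real n) powr (- a)"
        using um[of "n + i"] n by (simp add: add_divide_distrib)
      ultimately show ?thesis
        unfolding k_def un using pos[of "(1 + real i / real n) powr (- a)"] le1[of "1 + real i / real n"]
        by (simp add: Nsplit F_def)
    qed
    have kpair: "k (int (n - i)) + k (int (n + i)) = - (N * f (real i / real n))" if i: "1 \<le> i" "i < n" for i
    proof -
      have "edge_weight p \<sigma> (int n) (int (n - i)) = real n powr (- 1 - s) * (real i / real n) powr (- 1 - s)"
        using n i by (intro edge) auto
      moreover have "real (n - i) / real n = 1 - real i / real n" using n i by (simp add: of_nat_diff field_simps)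
      then have "u (int (n - i)) = real n powr (- a) * (1 - real i / real n) powr (- a)"
        using um[of "n - i"] i by simp
      moreover have "0 < 1 - real i / real n" "1 - real i / real n \<le> 1" using i n by auto
      ultimately have "k (int (n - i)) = - (N * ((real i / real n) powr (- 1 - s) * ((1 - real i / real n) powr (- a) - 1) powr r))"
        unfolding k_def un using neg[of "(1 - real i / real n) powr (- a)"] ge1[of "1 - real i / real n"]
        by (simp add: Nsplit)
      then show ?thesis unfolding kp by (simp add: f_def F_def algebra_simps)
    qed
    have kG: "k (- int (n + j)) = N * G (real (n + j) / real n)" for j
    proof -
      have "edge_weight p \<sigma> (int n) (- int (n + j)) = real n powr (- 1 - s) * (1 + real (n + j) / real n) powr (- 1 - s)"
        using n by (intro edge) (auto simp: field_simps)
      moreover have "real (n + j) / real n \<ge> 1" using n by simp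
      ultimately show ?thesis
        unfolding k_def un um' um[of "n + j", OF trans_le_add1[OF n]]
        using pos[of "(real (n + j) / real n) powr (- a)"] le1[of "real (n + j) / real n"]
        by (simp add: Nsplit G_def del: of_nat_add)
    qed
    have kH: "k (- int i) = - (N * H (real i / real n))" if i: "1 \<le> i" "i < n" for i
    proof -
      have "edge_weight p \<sigma> (int n) (- int i) = real n powr (- 1 - s) * (1 + real i / real n) powr (- 1 - s)"
        using n by (intro edge) (auto simp: field_simps)
      moreover have "0 < real i / real n" "real i / real n \<le> 1" using i by auto
      ultimately show ?thesis
        unfolding k_def un um' um[OF i(1)]
        using neg[of "(real i / real n) powr (- a)"] ge1[of "real i / real n"]
        by (simp add: Nsplit H_def)
    qed
    note split = int_infsum_split[OF ks]
    define SF where "SF = (\<Sum>j. F (real (n + j) / real n))"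
    define SG where "SG = (\<Sum>j. G (real (n + j) / real n))"
    define Sf where "Sf = (\<Sum>i\<in>{1..<n}. f (real i / real n))"
    define SH where "SH = (\<Sum>i\<in>{1..<n}. H (real i / real n))"
    have Feq: "k (int (Suc (j + (2 * n - 1)))) = N * F (real (n + j) / real n)" for j
    proof -
      have "Suc (j + (2 * n - 1)) = n + (n + j)" using n by simp
      then show ?thesis using kp[of "n + j"] by (simp only:)
    qed
    have FS: "summable (\<lambda>j. N * F (real (n + j) / real n))"
    proof -
      have "summable (\<lambda>j. k (int (Suc (j + (2 * n - 1)))))"
        using summable_iff_shift[of "\<lambda>j. k (int (Suc j))" "2 * n - 1"] split(1) by simp
      then show ?thesis by (simp only: Feq)
    qed
    have S1: "(\<Sum>j. k (int (Suc j))) = - (N * Sf) + N * SF"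
    proof -
      have "(\<Sum>j. k (int (Suc j))) = (\<Sum>j. k (int (Suc (j + (2 * n - 1))))) + (\<Sum>j<2 * n - 1. k (int (Suc j)))"
        using suminf_split_initial_segment[OF split(1), of "2 * n - 1"] by simp
      also have "(\<Sum>j. k (int (Suc (j + (2 * n - 1))))) = N * SF"
        unfolding SF_def Feq using FS N by (intro suminf_mult) (simp add: summable_cmult_iff)
      also have "(\<Sum>j<2 * n - 1. k (int (Suc j))) = k (int n) + (\<Sum>i\<in>{1..<n}. k (int (n - i)) + k (int (n + i)))"
        by (rule sum_pairs_about[OF n])
      also have "\<dots> = - (N * Sf)" using kpair by (simp add: kn Sf_def sum_distrib_left sum_negf)
      finally show ?thesis by simp
    qed
    have Geq: "k (- int (Suc (j + (n - 1)))) = N * G (real (n + j) / real n)" for j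
    proof -
      have "Suc (j + (n - 1)) = n + j" using n by simp
      then show ?thesis using kG[of j] by (simp only:)
    qed
    have GS: "summable (\<lambda>j. N * G (real (n + j) / real n))"
    proof -
      have "summable (\<lambda>j. k (- int (Suc (j + (n - 1)))))"
        using summable_iff_shift[of "\<lambda>j. k (- int (Suc j))" "n - 1"] split(2) by simp
      then show ?thesis by (simp only: Geq)
    qed
    have S2: "(\<Sum>j. k (- int (Suc j))) = - (N * SH) + N * SG"
    proof -
      have "(\<Sum>j. k (- int (Suc j))) = (\<Sum>j. k (- int (Suc (j + (n - 1))))) + (\<Sum>j<n - 1. k (- int (Suc j)))"
        using suminf_split_initial_segment[OF split(2), of "n - 1"] by simp
      also have "(\<Sum>j. k (- int (Suc (j + (n - 1))))) = N * SG"
        unfolding SG_def Geq using GS N by (intro suminf_mult) (simp add: summable_cmult_iff)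
      also have "(\<Sum>j<n - 1. k (- int (Suc j))) = (\<Sum>i\<in>{1..<n}. k (- int i))"
        by (rule sum.reindex_bij_witness[where i = "\<lambda>y. y - 1" and j = Suc]) auto
      also have "\<dots> = - (N * SH)" using kH by (simp add: SH_def sum_distrib_left sum_negf)
      finally show ?thesis by simp
    qed
    have FS': "summable (\<lambda>j. F (real (n + j) / real n))" and GS': "summable (\<lambda>j. G (real (n + j) / real n))"
      using FS GS N by (auto simp: summable_cmult_iff)
    have in01: "0 < real i / real n \<and> real i / real n < 1" if "i \<in> {1..<n}" for i using that by simp
    have f0: "Sf \<ge> 0" unfolding Sf_def using DU(3) in01 by (intro sum_nonneg) (metis add_nonneg_nonneg)
    have SF0: "SF \<ge> 0" unfolding SF_def using FS' by (intro suminf_nonneg) (auto simp: F_def)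
    have SG0: "SG \<ge> 0" unfolding SG_def using GS' by (intro suminf_nonneg) (auto simp: G_def)
    have SH0: "SH \<ge> 0" unfolding SH_def by (intro sum_nonneg) (auto simp: H_def)
    have I1: "Sf + real n * c \<le> SF + 1 / 2"
    proof -
      have "ennreal Sf + ennreal (real n) * ennreal c \<le> ennreal (real n) * nn_int f {0<..<1} + ennreal (real n) * ennreal c"
        unfolding Sf_def by (intro add_right_mono sum_decreasing_increasing_le_nn_int[OF n DU])
      also have "\<dots> = ennreal (real n) * (nn_int f {0<..<1} + ennreal c)" by (simp add: distrib_left)
      also have "\<dots> \<le> ennreal (real n) * nn_int F {1..}" by (intro mult_left_mono c) auto
      also have "\<dots> \<le> ennreal (SF + 1 / 2)"
        unfolding SF_def F_def using FS' by (intro far_integral_le_sum[OF n a s0 r]) (simp add: F_def)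
      finally have "ennreal (Sf + real n * c) \<le> ennreal (SF + 1 / 2)"
        using c f0 by (simp add: ennreal_mult ennreal_plus)
      moreover have "SF + 1 / 2 \<ge> 0" using SF0 by simp
      ultimately show ?thesis by (simp only: ennreal_le_iff)
    qed
    have I2: "SH \<le> SG + 1 / 2"
    proof -
      have "antimono_on {0<..<1} H"
      proof (rule monotone_onI)
        fix x y :: real assume xy: "x \<in> {0<..<1}" "y \<in> {0<..<1}" "x \<le> y"
        then show "H x \<ge> H y" unfolding H_def
          using s0 a r ge1[of y] by (intro mult_mono powr_mono2 powr_mono2' diff_right_mono) auto
      qed
      then have "ennreal SH \<le> ennreal (real n) * nn_int H {0<..<1}"
        unfolding SH_def by (intro sum_decreasing_increasing_le_nn_int[OF n, where U = "\<lambda>_. 0" and D = H])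
          (auto simp: mono_on_def H_def)
      also have "\<dots> \<le> ennreal (real n) * nn_int G {1..}" by (intro mult_left_mono HG) auto
      also have "\<dots> \<le> ennreal (SG + 1 / 2)"
        unfolding SG_def G_def using GS' by (intro reflected_integral_le_sum[OF n a(1) s0 r]) (simp add: G_def)
      finally have "ennreal SH \<le> ennreal (SG + 1 / 2)" .
      moreover have "SG + 1 / 2 \<ge> 0" using SG0 by simp
      ultimately show ?thesis by (simp only: ennreal_le_iff)
    qed
    have "frac_p_Laplacian p \<sigma> u (int n) = infsum k UNIV"
      unfolding frac_p_Laplacian_def by (intro infsum_cong) (simp add: k_def)
    also have "\<dots> = N + (- (N * Sf) + N * SF) + (- (N * SH) + N * SG)"
      using split(3) unfolding S1 S2 k0 .
    also have "\<dots> = N * (1 + (SF - Sf) + (SG - SH))" by (simp add: algebra_simps)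
    also have "\<dots> \<ge> N * (real n * c)" using I1 I2 N by (intro mult_left_mono) auto
    also have "N * (real n * c) = c * real n powr (- (s + a * r))"
      using powr_mult_base[of "real n" "- 1 - s - a * r"] by (simp add: N_def algebra_simps)
    finally show ?thesis .
  qed
  have "c * \<bar>real_of_int x\<bar> powr (- (p * \<sigma> + (p - 1) * a)) \<le> frac_p_Laplacian p \<sigma> (pow_fun a 0) x"
    if x: "x \<noteq> 0" for x
  proof -
    define n where "n = nat \<bar>x\<bar>"
    have n: "n \<ge> 1" "real n = \<bar>real_of_int x\<bar>" using x by (auto simp: n_def)
    have "frac_p_Laplacian p \<sigma> u x = frac_p_Laplacian p \<sigma> u (int n)"
    proof (cases "x \<ge> 0")
      case False
      then have "x = - int n" by (simp add: n_def)
      then show ?thesis by (simp only:) (rule laplacian_even, simp add: u_def pow_fun_def)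
    qed (simp add: n_def)
    then show ?thesis using main[OF n(1)] n(2) by (simp add: u_def s_def r_def mult.commute)
  qed
  then show ?thesis using c(1) by blast
qed

section \<open>The weights\<close>

lemma pow_fun_even: "pow_fun a \<beta> (- x) = pow_fun a \<beta> x"
  by (simp add: pow_fun_def)

lemma laplacian_change_at_0:
  assumes "p > 1" "p * \<sigma> > 0" "a > 0" "\<beta> \<ge> 0" "x \<noteq> 0"
  shows "frac_p_Laplacian p \<sigma> (pow_fun a \<beta>) x = frac_p_Laplacian p \<sigma> (pow_fun a 0) x +
     edge_weight p \<sigma> x 0 * (signed_pow (pow_fun a 0 x - \<beta>) (p - 1) - signed_pow (pow_fun a 0 x) (p - 1))"
    (is "_ = _ + ?d")
proof -
  let ?h = "\<lambda>y. edge_weight p \<sigma> x y * signed_pow (pow_fun a 0 x - pow_fun a 0 y) (p - 1)"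
  have h: "?h summable_on UNIV" by (intro F_space_summable pow_fun_F_space assms) auto
  have "((\<lambda>y. if y = 0 then ?d else 0) has_sum ?d) {0}"
    by (rule has_sum_finiteI) auto
  then have d: "((\<lambda>y::int. if y = 0 then ?d else 0) has_sum ?d) UNIV"
    by (subst has_sum_cong_neutral[where S = UNIV and T = "{0}"]) auto
  have "((\<lambda>y. ?h y + (if y = 0 then ?d else 0)) has_sum (infsum ?h UNIV + ?d)) UNIV"
    by (intro has_sum_add has_sum_infsum h d)
  moreover have "?h y + (if y = 0 then ?d else 0)
      = edge_weight p \<sigma> x y * signed_pow (pow_fun a \<beta> x - pow_fun a \<beta> y) (p - 1)" for y
    using assms(5) by (auto simp: pow_fun_def algebra_simps)
  ultimately show ?thesis
    unfolding frac_p_Laplacian_def by (simp add: infsumI)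
qed

text \<open>Changing the value at \<open>0\<close> changes the Laplacian at \<open>x\<close> by \<open>O(\<bar>x\<bar> powr (- 1 - s))\<close>, which is of
  smaller order than \<open>\<bar>x\<bar> powr (- \<kappa>)\<close> because \<open>\<kappa> < 1 + s\<close>.\<close>

lemma quotient_lower_bound:
  fixes p \<sigma> a \<beta> :: real
  assumes p: "p > 1" and s: "0 < p * \<sigma>" and a: "0 < a" "a < 1" and \<kappa>: "p * \<sigma> + (p - 1) * a < 1" and \<beta>: "\<beta> \<ge> 0"
  shows "\<exists>c>0. \<exists>N\<ge>1. \<forall>x. \<bar>x\<bar> \<ge> N \<longrightarrow>
     c * \<bar>real_of_int x\<bar> powr (- p * \<sigma>) \<le> frac_p_Laplacian p \<sigma> (pow_fun a \<beta>) x / pow_fun a \<beta> x powr (p - 1)"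
proof -
  define \<kappa>' where "\<kappa>' = p * \<sigma> + (p - 1) * a"
  obtain c where c: "c > 0" "\<And>x. x \<noteq> 0 \<Longrightarrow> c * \<bar>real_of_int x\<bar> powr (- \<kappa>') \<le> frac_p_Laplacian p \<sigma> (pow_fun a 0) x"
    using laplacian_lower_bound[OF p s a \<kappa>] unfolding \<kappa>'_def by blast
  define M where "M = 2 * (1 + \<beta>) powr (p - 1)"
  have M: "M > 0" using \<beta> by (simp add: M_def)
  define N where "N = max 1 \<lceil>(2 * M / c) powr (1 / (p * \<sigma>))\<rceil>"
  have "c / 2 * \<bar>real_of_int x\<bar> powr (- p * \<sigma>) \<le> frac_p_Laplacian p \<sigma> (pow_fun a \<beta>) x / pow_fun a \<beta> x powr (p - 1)"
    if x: "\<bar>x\<bar> \<ge> N" for x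
  proof -
    define X where "X = \<bar>real_of_int x\<bar>"
    have x0: "x \<noteq> 0" and X1: "X \<ge> 1" using x by (auto simp: N_def X_def)
    have XN: "X \<ge> (2 * M / c) powr (1 / (p * \<sigma>))"
    proof -
      have "\<lceil>(2 * M / c) powr (1 / (p * \<sigma>))\<rceil> \<le> \<bar>x\<bar>" using x by (simp add: N_def)
      then have "(2 * M / c) powr (1 / (p * \<sigma>)) \<le> real_of_int \<bar>x\<bar>" by (simp add: ceiling_le_iff)
      then show ?thesis by (simp add: X_def)
    qed
    have small: "M * X powr (- (p * \<sigma>)) \<le> c / 2"
    proof -
      have "((2 * M / c) powr (1 / (p * \<sigma>))) powr (p * \<sigma>) \<le> X powr (p * \<sigma>)"
        using XN s by (intro powr_mono2) auto
      moreover have "p \<noteq> 0" "\<sigma> \<noteq> 0" using s by auto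
      ultimately have "2 * M / c \<le> X powr (p * \<sigma>)" using M c by (simp add: powr_powr)
      then show ?thesis using c X1 by (simp add: powr_minus field_simps)
    qed
    have u: "pow_fun a 0 x = X powr (- a)" "pow_fun a \<beta> x = X powr (- a)" "X powr (- a) \<le> 1"
      using x0 pow_fun_le_1[OF a(1) x0, of 0] by (auto simp: pow_fun_def X_def)
    have "edge_weight p \<sigma> x 0 * (signed_pow (pow_fun a 0 x - \<beta>) (p - 1) - signed_pow (pow_fun a 0 x) (p - 1))
        \<ge> edge_weight p \<sigma> x 0 * (- M)"
    proof (rule mult_left_mono[OF _ edge_weight_nonneg])
      have "\<bar>signed_pow t (p - 1)\<bar> \<le> (1 + \<beta>) powr (p - 1)" if "\<bar>t\<bar> \<le> 1 + \<beta>" for t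
        unfolding signed_pow_abs using that p by (intro powr_mono2) auto
      moreover have "\<bar>X powr (- a) - \<beta>\<bar> \<le> 1 + \<beta>" "\<bar>X powr (- a)\<bar> \<le> 1 + \<beta>"
        using u(3) \<beta> powr_ge_zero[of X "- a"] by linarith+
      ultimately have "\<bar>signed_pow (X powr (- a) - \<beta>) (p - 1)\<bar> \<le> (1 + \<beta>) powr (p - 1)"
          "\<bar>signed_pow (X powr (- a)) (p - 1)\<bar> \<le> (1 + \<beta>) powr (p - 1)" by blast+
      then show "- M \<le> signed_pow (pow_fun a 0 x - \<beta>) (p - 1) - signed_pow (pow_fun a 0 x) (p - 1)"
        unfolding u M_def by linarith
    qed
    moreover have "edge_weight p \<sigma> x 0 * M \<le> c / 2 * X powr (- \<kappa>')"
    proof -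
      have "edge_weight p \<sigma> x 0 * M = (M * X powr (- (p * \<sigma>))) * X powr (- 1)"
      proof -
        have "edge_weight p \<sigma> x 0 = X powr (- 1 - p * \<sigma>)" by (simp add: edge_weight_alt X_def)
        also have "\<dots> = X powr (- (p * \<sigma>)) * X powr (- 1)"
          unfolding powr_add[symmetric] by (rule arg_cong[where f = "\<lambda>t. X powr t"]) simp
        finally show ?thesis by simp
      qed
      also have "\<dots> \<le> c / 2 * X powr (- \<kappa>')"
        using small X1 \<kappa> c unfolding \<kappa>'_def by (intro mult_mono powr_mono) auto
      finally show ?thesis .
    qed
    ultimately have "c / 2 * X powr (- \<kappa>') \<le> frac_p_Laplacian p \<sigma> (pow_fun a \<beta>) x"
      using laplacian_change_at_0[OF p s a(1) \<beta> x0] c(2)[OF x0] by (simp add: X_def)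
    moreover have "c / 2 * X powr (- p * \<sigma>) * pow_fun a \<beta> x powr (p - 1) = c / 2 * X powr (- \<kappa>')"
      using X1 unfolding u \<kappa>'_def by (simp add: powr_powr algebra_simps flip: powr_add)
    moreover have "pow_fun a \<beta> x powr (p - 1) > 0" using X1 unfolding u by simp
    ultimately show ?thesis unfolding X_def[symmetric] by (simp only: pos_le_divide_eq)
  qed
  moreover have "N \<ge> 1" by (simp add: N_def)
  ultimately show ?thesis using c(1) by (intro exI[of _ "c / 2"]) auto
qed

text \<open>By the previous bound the summands are at least \<open>c \<bar>x\<bar> powr (- s - p a)\<close>, hence at least
  \<open>c / \<bar>x\<bar>\<close>, for large \<open>\<bar>x\<bar>\<close>.\<close>

lemma not_in_weighted_lp:
  fixes p \<sigma> a \<beta> :: real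
  assumes p: "p > 1" and s: "0 < p * \<sigma>" and a: "0 < a" "a < 1" and crit: "p * \<sigma> + p * a \<le> 1" and \<beta>: "\<beta> \<ge> 0"
    and Y: "UNIV - {0} \<subseteq> Y"
  shows "pow_fun a \<beta> \<notin> weighted_lp p Y (\<lambda>x. \<bar>frac_p_Laplacian p \<sigma> (pow_fun a \<beta>) x / pow_fun a \<beta> x powr (p - 1)\<bar>)"
proof
  let ?w = "\<lambda>x. frac_p_Laplacian p \<sigma> (pow_fun a \<beta>) x / pow_fun a \<beta> x powr (p - 1)"
  let ?f = "\<lambda>x. \<bar>?w x\<bar> * \<bar>pow_fun a \<beta> x\<bar> powr p"
  assume "pow_fun a \<beta> \<in> weighted_lp p Y (\<lambda>x. \<bar>?w x\<bar>)"
  then have S: "?f summable_on Y" by (simp add: weighted_lp_def)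
  have "p * \<sigma> + (p - 1) * a < 1" using crit a by (simp add: algebra_simps)
  from quotient_lower_bound[OF p s a this \<beta>] obtain c N where c: "c > 0" "N \<ge> 1"
    "\<And>x. \<bar>x\<bar> \<ge> N \<Longrightarrow> c * \<bar>real_of_int x\<bar> powr (- p * \<sigma>) \<le> ?w x" by blast
  define m where "m = nat N"
  have m: "m \<ge> 1" "int m = N" using c(2) by (auto simp: m_def)
  have "(?f \<circ> (\<lambda>j. int (j + m))) summable_on UNIV"
  proof (subst summable_on_reindex[symmetric])
    show "?f summable_on range (\<lambda>j. int (j + m))"
      by (rule summable_on_subset_banach[OF S]) (use Y m in auto)
  qed (auto simp: inj_on_def)
  then have sm: "summable (\<lambda>j. ?f (int (j + m)))"
    by (simp add: o_def summable_on_UNIV_nonneg_real_iff)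
  have le: "c * inverse (real (j + m)) \<le> ?f (int (j + m))" for j
  proof -
    define X where "X = real (j + m)"
    have X: "X \<ge> 1" using m by (simp add: X_def)
    have "c * inverse X = c * X powr (- 1)" using X by (simp add: powr_minus)
    also have "\<dots> \<le> c * X powr (- p * \<sigma> + - (a * p))"
      using X crit c by (intro mult_left_mono powr_mono) (auto simp: mult.commute)
    also have "\<dots> = (c * X powr (- p * \<sigma>)) * (X powr (- a)) powr p"
      unfolding powr_add by (simp add: powr_powr)
    also have "\<dots> \<le> \<bar>?w (int (j + m))\<bar> * \<bar>pow_fun a \<beta> (int (j + m))\<bar> powr p"
    proof (rule mult_mono)
      show "c * X powr (- p * \<sigma>) \<le> \<bar>?w (int (j + m))\<bar>"
        by (rule order_trans[OF _ abs_ge_self]) (use c(3)[of "int (j + m)"] in \<open>simp add: X_def flip: m(2)\<close>)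
      show "(X powr (- a)) powr p \<le> \<bar>pow_fun a \<beta> (int (j + m))\<bar> powr p"
        using m(1) by (simp add: pow_fun_def X_def)
    qed auto
    finally show ?thesis by (simp add: X_def)
  qed
  have "summable (\<lambda>j. c * inverse (real (j + m)))"
  proof (rule summable_comparison_test'[OF sm, where N = 0], goal_cases)
    case (1 j)
    have "c * inverse (real (j + m)) \<ge> 0" using c(1) by simp
    then show ?case using le[of j] by simp
  qed
  then have "summable (\<lambda>j. inverse (real (j + m)))" using c(1) by (simp add: summable_cmult_iff)
  then have "summable (\<lambda>j. inverse (real j))" using summable_iff_shift[of "\<lambda>j. inverse (real j)" m] by simp
  then show False using not_summable_harmonic[where ?'a = real] by simp
qed

lemma laplacian_zero_neg:
  assumes "p > 1" "p * \<sigma> > 0" "a > 0"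
  shows "frac_p_Laplacian p \<sigma> (pow_fun a 0) 0 < 0"
proof -
  let ?k = "\<lambda>y. edge_weight p \<sigma> 0 y * signed_pow (pow_fun a 0 0 - pow_fun a 0 y) (p - 1)"
  have S: "(\<lambda>y. - ?k y) summable_on UNIV"
    unfolding summable_on_uminus by (intro F_space_summable pow_fun_F_space assms) auto
  have "sum (\<lambda>y. - ?k y) {1} \<le> infsum (\<lambda>y. - ?k y) UNIV"
    by (rule finite_sum_le_infsum[OF S]) (auto simp: pow_fun_def signed_pow_def edge_weight_nonneg mult_nonneg_nonpos sgn_if)
  then have "1 \<le> - infsum ?k UNIV"
    by (simp add: infsum_uminus pow_fun_def edge_weight_def signed_pow_def)
  then show ?thesis by (simp add: frac_p_Laplacian_def)
qed

lemma laplacian_zero_pos: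
  assumes "p > 1" "p * \<sigma> > 0" "a > 0" "\<beta> \<ge> 1"
  shows "frac_p_Laplacian p \<sigma> (pow_fun a \<beta>) 0 > 0"
proof -
  let ?k = "\<lambda>y. edge_weight p \<sigma> 0 y * signed_pow (pow_fun a \<beta> 0 - pow_fun a \<beta> y) (p - 1)"
  have S: "?k summable_on UNIV"
    using assms by (intro F_space_summable pow_fun_F_space) auto
  have k0: "?k y \<ge> 0" for y
  proof (cases "y = 0")
    case False
    then have "pow_fun a \<beta> y \<le> pow_fun a \<beta> 0"
      using pow_fun_le_1[OF assms(3) False, of \<beta>] assms(4) by (simp add: pow_fun_def)
    then show ?thesis by (simp add: signed_pow_def edge_weight_nonneg)
  qed (simp add: edge_weight_def)
  have "sum ?k {2} \<le> infsum ?k UNIV"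
    by (rule finite_sum_le_infsum[OF S]) (use k0 in auto)
  moreover have "?k 2 > 0"
  proof -
    have "2 powr (- a) < 2 powr (0::real)" using assms by (intro powr_less_mono) auto
    then have "pow_fun a \<beta> 2 < pow_fun a \<beta> 0" using assms(4) by (simp add: pow_fun_def)
    then show ?thesis using edge_weight_pos[of 0 2 p \<sigma>] by (simp add: signed_pow_def)
  qed
  ultimately show ?thesis by (simp add: frac_p_Laplacian_def)
qed

lemma telescoping_decrement_le_powr:
  fixes \<kappa> x :: real
  assumes "\<kappa> > 0" "x \<ge> 1"
  shows "(x powr (- \<kappa>) - (x + 1) powr (- \<kappa>)) / \<kappa> \<le> x powr (- 1 - \<kappa>)"
proof -
  obtain z where z: "x < z" "z < x + 1" "(x + 1) powr (- \<kappa>) - x powr (- \<kappa>) = (x + 1 - x) * (- \<kappa> * z powr (- \<kappa> - 1))"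
    using MVT2[of x "x + 1" "\<lambda>z. z powr (- \<kappa>)" "\<lambda>z. - \<kappa> * z powr (- \<kappa> - 1)"] assms
    by (force intro!: derivative_eq_intros)
  have "z powr (- \<kappa> - 1) \<le> x powr (- \<kappa> - 1)" using z assms by (intro powr_mono2') auto
  then have "\<kappa> * z powr (- \<kappa> - 1) \<le> \<kappa> * x powr (- \<kappa> - 1)" using assms by simp
  then have "x powr (- \<kappa>) - (x + 1) powr (- \<kappa>) \<le> \<kappa> * x powr (- \<kappa> - 1)" using z(3) by simp
  moreover have "x powr (- \<kappa> - 1) = x powr (- 1 - \<kappa>)" by (rule arg_cong[where f = "\<lambda>t. x powr t"]) simp
  ultimately show ?thesis using assms by (simp add: divide_le_eq mult.commute)
qed

text \<open>For \<open>\<bar>y\<bar> \<ge> 2\<close> one has \<open>1 - \<bar>y\<bar> powr (- a) \<ge> (2 powr a - 1) * \<bar>y\<bar> powr (- a)\<close> and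
  \<open>\<bar>y\<bar> + 1 \<le> (3 / 2) \<bar>y\<bar>\<close>, and the remaining sum of \<open>\<bar>y\<bar> powr (- 1 - \<kappa>)\<close> is bounded below by a telescoping
  sum. The factor \<open>1 + (2 / 3) powr (1 + s)\<close> accounts for \<open>y > 0\<close> and \<open>y < 0\<close>.\<close>

lemma laplacian_one_lower_bound:
  fixes p \<sigma> a \<beta> :: real
  assumes p: "p > 1" and s: "0 < p * \<sigma>" and a: "0 < a" and \<beta>: "\<beta> \<ge> 1"
  defines "\<kappa> \<equiv> p * \<sigma> + (p - 1) * a"
  shows "frac_p_Laplacian p \<sigma> (pow_fun a \<beta>) 1 \<ge>
     (1 + (2 / 3) powr (1 + p * \<sigma>)) * (2 powr a - 1) powr (p - 1) * (2 powr (- \<kappa>) / \<kappa>) - (\<beta> - 1) powr (p - 1)"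
proof -
  define k where "k y = edge_weight p \<sigma> 1 y * signed_pow (pow_fun a \<beta> 1 - pow_fun a \<beta> y) (p - 1)" for y
  define D where "D = (2 powr a - 1) powr (p - 1)"
  define E where "E = (2 / 3 :: real) powr (1 + p * \<sigma>)"
  define V where "V x = x powr (- \<kappa>) / \<kappa>" for x :: real
  have \<kappa>: "\<kappa> > 0" using p s a by (simp add: \<kappa>_def add_pos_nonneg)
  have S: "k summable_on UNIV"
    unfolding k_def using assms by (intro F_space_summable pow_fun_F_space) auto
  note split = int_infsum_split[OF S]
  have Vstep: "V x - V (x + 1) \<le> x powr (- 1 - \<kappa>)" if x: "x \<ge> 1" for x
    using telescoping_decrement_le_powr[OF \<kappa>, of x] x by (simp add: V_def diff_divide_distrib)
  define l where "l j = (if j = 0 then 0 else D * (V (real (Suc j)) - V (real (Suc (Suc j)))))" for j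
  have Vlim: "(\<lambda>j. V (real (j + 2))) \<longlonglongrightarrow> 0"
  proof -
    have "(\<lambda>j. real j powr (- \<kappa>)) \<longlonglongrightarrow> 0"
      using \<kappa> by (intro tendsto_neg_powr filterlim_real_sequentially) auto
    then have "(\<lambda>j. real (j + 2) powr (- \<kappa>)) \<longlonglongrightarrow> 0" by (rule LIMSEQ_ignore_initial_segment)
    then have "(\<lambda>j. real (j + 2) powr (- \<kappa>) / \<kappa>) \<longlonglongrightarrow> 0 / \<kappa>" by (intro tendsto_divide) (use \<kappa> in auto)
    then show ?thesis by (simp add: V_def)
  qed
  have "(\<lambda>j. V (real (j + 2)) - V (real (Suc j + 2))) sums (V (real (0 + 2)) - 0)"
    by (rule telescope_sums'[OF Vlim])
  then have "(\<lambda>j. D * (V (real (j + 2)) - V (real (Suc j + 2)))) sums (D * V 2)"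
    by (intro sums_mult) simp
  then have "(\<lambda>j. l (Suc j)) sums (D * V 2)" by (simp add: l_def add.commute)
  then have lsum: "l sums (D * V 2)" using sums_Suc[of l "D * V 2"] by (simp add: l_def)
  have term_eq: "k y = edge_weight p \<sigma> 1 y * (1 - X powr (- a)) powr (p - 1)"
    if "X = \<bar>real_of_int y\<bar>" "X \<ge> 1" for y X
  proof -
    have "X powr (- a) \<le> X powr 0" using that(2) a by (intro powr_mono) auto
    then have "X powr (- a) \<le> 1" using that(2) by simp
    then show ?thesis using that p by (cases "X powr (- a) = 1") (auto simp: k_def pow_fun_def signed_pow_def)
  qed
  have base: "D * X powr (- ((p - 1) * a)) \<le> (1 - X powr (- a)) powr (p - 1)" if X: "X \<ge> 2" for X
  proof -
    have "(2 powr a - 1) * X powr (- a) \<le> 1 - X powr (- a)"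
    proof -
      have "2 powr a * X powr (- a) \<le> X powr a * X powr (- a)"
        using X a by (intro mult_right_mono powr_mono2) auto
      also have "\<dots> = 1" using X by (simp flip: powr_add)
      finally show ?thesis by (simp add: algebra_simps)
    qed
    moreover have "2 powr a \<ge> 1" using a by (intro ge_one_powr_ge_zero) auto
    ultimately have "((2 powr a - 1) * X powr (- a)) powr (p - 1) \<le> (1 - X powr (- a)) powr (p - 1)"
      using p by (intro powr_mono2) auto
    then show ?thesis using \<open>2 powr a \<ge> 1\<close> by (simp add: D_def powr_mult powr_powr mult.commute)
  qed
  have D0: "D \<ge> 0" "E \<ge> 0" by (auto simp: D_def E_def)
  have step: "l j \<le> D * (X powr (- 1 - p * \<sigma>) * X powr (- ((p - 1) * a)))" if "j > 0" "X = real (Suc j)" for j X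
  proof -
    have "V X - V (X + 1) \<le> X powr (- 1 - \<kappa>)" using that by (intro Vstep) auto
    also have "X powr (- 1 - \<kappa>) = X powr (- 1 - p * \<sigma>) * X powr (- ((p - 1) * a))"
      unfolding powr_add[symmetric] \<kappa>_def by (rule arg_cong[where f = "\<lambda>t. X powr t"]) simp
    finally show ?thesis using that D0 by (auto simp: l_def add.commute intro!: mult_left_mono)
  qed
  have right: "l j \<le> k (int (Suc j))" for j
  proof (cases "j = 0")
    case False
    define X where "X = real (Suc j)"
    have X: "X \<ge> 2" using False by (simp add: X_def)
    have "edge_weight p \<sigma> 1 (int (Suc j)) = (X - 1) powr (- 1 - p * \<sigma>)"
      by (simp add: edge_weight_alt X_def)
    moreover have "X powr (- 1 - p * \<sigma>) \<le> (X - 1) powr (- 1 - p * \<sigma>)"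
      using X s by (intro powr_mono2') auto
    ultimately have "X powr (- 1 - p * \<sigma>) * (D * X powr (- ((p - 1) * a))) \<le> k (int (Suc j))"
      using base[OF X] X D0 by (subst term_eq[where X = X]) (auto simp: X_def intro!: mult_mono)
    then show ?thesis using step[of j X] False by (simp add: X_def algebra_simps)
  qed (simp add: l_def k_def edge_weight_def)
  have left: "E * l j \<le> k (- int (Suc j))" for j
  proof (cases "j = 0")
    case True
    then show ?thesis by (simp add: l_def k_def pow_fun_def signed_pow_def)
  next
    case False
    define X where "X = real (Suc j)"
    have X: "X \<ge> 2" using False by (simp add: X_def)
    have "edge_weight p \<sigma> 1 (- int (Suc j)) = (X + 1) powr (- 1 - p * \<sigma>)"
      by (simp add: edge_weight_alt X_def add.commute)
    moreover have "E * X powr (- 1 - p * \<sigma>) \<le> (X + 1) powr (- 1 - p * \<sigma>)"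
    proof -
      have "E * X powr (- 1 - p * \<sigma>) = (3 / 2 * X) powr (- 1 - p * \<sigma>)"
      proof -
        have "E = (3 / 2) powr (- 1 - p * \<sigma>)"
        proof -
          have "E = inverse ((3 / 2) powr (1 + p * \<sigma>))" unfolding E_def by (simp add: powr_divide)
          also have "\<dots> = (3 / 2) powr (- (1 + p * \<sigma>))" by (rule powr_minus[symmetric])
          finally show ?thesis by simp
        qed
        then show ?thesis using X by (simp only: powr_mult)
      qed
      also have "\<dots> \<le> (X + 1) powr (- 1 - p * \<sigma>)" using X s by (intro powr_mono2') auto
      finally show ?thesis .
    qed
    ultimately have "(E * X powr (- 1 - p * \<sigma>)) * (D * X powr (- ((p - 1) * a))) \<le> k (- int (Suc j))"
      using base[OF X] X D0 by (subst term_eq[where X = X]) (auto simp: X_def intro!: mult_mono)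
    moreover have "E * l j \<le> E * (D * (X powr (- 1 - p * \<sigma>) * X powr (- ((p - 1) * a))))"
      using step[of j X] False D0 by (intro mult_left_mono) (auto simp: X_def)
    ultimately show ?thesis by (simp add: algebra_simps)
  qed
  have "D * V 2 \<le> (\<Sum>j. k (int (Suc j)))"
    using suminf_le[OF right sums_summable[OF lsum] split(1)] sums_unique[OF lsum] by simp
  moreover have "E * (D * V 2) \<le> (\<Sum>j. k (- int (Suc j)))"
    using suminf_le[OF left sums_summable[OF sums_mult[OF lsum]] split(2)] sums_unique[OF sums_mult[OF lsum, of E]] by simp
  moreover have "k 0 = - ((\<beta> - 1) powr (p - 1))"
  proof -
    have "k 0 = signed_pow (- (\<beta> - 1)) (p - 1)" by (simp add: k_def edge_weight_def pow_fun_def)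
    also have "\<dots> = - ((\<beta> - 1) powr (p - 1))"
      unfolding signed_pow_minus using \<beta> p by (cases "\<beta> = 1") (auto simp: signed_pow_def)
    finally show ?thesis .
  qed
  moreover have "frac_p_Laplacian p \<sigma> (pow_fun a \<beta>) 1 = infsum k UNIV"
    unfolding frac_p_Laplacian_def by (intro infsum_cong) (simp add: k_def)
  ultimately have "frac_p_Laplacian p \<sigma> (pow_fun a \<beta>) 1 \<ge> - ((\<beta> - 1) powr (p - 1)) + D * V 2 + E * (D * V 2)"
    using split(3) by linarith
  then show ?thesis by (simp add: D_def E_def V_def algebra_simps)
qed

theorem theoremB1:
  fixes p q \<sigma> \<alpha> \<gamma> :: real
  assumes "p > 1" and "q > 1"
    and "0 < \<sigma>" and "\<sigma> < 1 / p"
    and "0 < \<alpha>" and "\<alpha> < 1 / q"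
    and "\<gamma> \<ge> 1"
  shows "(p * (\<sigma> + 1 - q * \<alpha>) \<ge> 1 \<longrightarrow>
            p_critical p \<sigma> (UNIV - {0}) (w_fun p \<sigma> q \<alpha> 0) \<and>
            p_critical p \<sigma> UNIV (w_fun p \<sigma> q \<alpha> \<gamma>)) \<and>
         (p * (\<sigma> + 1 - q * \<alpha>) \<le> 1 \<longrightarrow>
            (\<forall>\<beta>\<in>{0, \<gamma>}.
               u_fun q \<alpha> \<beta> \<notin> weighted_lp p (UNIV - {0}) (\<lambda>x. \<bar>w_fun p \<sigma> q \<alpha> \<beta> x\<bar>))) \<and>
         (p * (\<sigma> + 1 - q * \<alpha>) = 1 \<longrightarrow>
            optimal_hardy_type_weight p \<sigma> (UNIV - {0}) (w_fun p \<sigma> q \<alpha> 0) \<and>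
            optimal_hardy_type_weight p \<sigma> UNIV (w_fun p \<sigma> q \<alpha> \<gamma>)) \<and>
         (\<alpha> > (p - 2 + p * \<sigma>) / ((p - 1) * q) \<longrightarrow>
            (\<forall>\<beta>\<in>{0, \<gamma>}.
               (\<exists>K. finite K \<and> (\<forall>x. x \<notin> K \<longrightarrow> w_fun p \<sigma> q \<alpha> \<beta> x > 0)) \<and>
               (\<exists>c>0. \<exists>N. \<forall>x. \<bar>x\<bar> \<ge> N \<longrightarrow>
                  w_fun p \<sigma> q \<alpha> \<beta> x \<ge> c * \<bar>real_of_int x\<bar> powr (- p * \<sigma>))) \<and>
            (frac_p_Laplacian p \<sigma> (u_fun q \<alpha> 0) 0 < 0 \<and>
             (\<forall>x. x \<noteq> 0 \<longrightarrow> frac_p_Laplacian p \<sigma> (u_fun q \<alpha> 0) x > 0) \<and>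
             hardy_weight p \<sigma> (UNIV - {0}) (w_fun p \<sigma> q \<alpha> 0)) \<and>
            (w_fun p \<sigma> q \<alpha> \<gamma> 0 > 0 \<and>
             (\<forall>\<beta>\<in>{0} \<union> {1..<1 + C_const p \<sigma> q \<alpha> powr (1 / (p - 1))}.
                w_fun p \<sigma> q \<alpha> \<beta> 1 > 0 \<and> w_fun p \<sigma> q \<alpha> \<beta> (-1) > 0)))"
proof -
  define a where "a = 1 - q * \<alpha>"
  have p: "p > 1" and \<gamma>: "\<gamma> \<ge> 1" using assms by auto
  have s: "0 < p * \<sigma>" "p * \<sigma> < 1" using assms by (auto simp: field_simps)
  have a: "0 < a" "a < 1" using assms by (auto simp: a_def field_simps)
  have u: "u_fun q \<alpha> \<beta> = pow_fun a \<beta>" for \<beta> by (simp add: u_fun_eq a_def)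
  have w: "w_fun p \<sigma> q \<alpha> \<beta> = (\<lambda>x. frac_p_Laplacian p \<sigma> (pow_fun a \<beta>) x / pow_fun a \<beta> x powr (p - 1))" for \<beta>
    by (simp add: fun_eq_iff w_fun_def u)
  have e: "p * (\<sigma> + 1 - q * \<alpha>) = p * \<sigma> + p * a" by (simp add: a_def algebra_simps)
  have critical: "p_critical p \<sigma> (UNIV - {0}) (w_fun p \<sigma> q \<alpha> 0)" "agmon_ground_state p \<sigma> (UNIV - {0}) (w_fun p \<sigma> q \<alpha> 0) (u_fun q \<alpha> 0)"
      "p_critical p \<sigma> UNIV (w_fun p \<sigma> q \<alpha> \<gamma>)" "agmon_ground_state p \<sigma> UNIV (w_fun p \<sigma> q \<alpha> \<gamma>) (u_fun q \<alpha> \<gamma>)"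
    if "p * (\<sigma> + 1 - q * \<alpha>) \<ge> 1"
    using pow_fun_critical[OF p s a, of 0 "UNIV - {0}"] pow_fun_critical[OF p s a, of \<gamma> UNIV] that \<gamma>
    unfolding u w e by auto
  have null: "u_fun q \<alpha> \<beta> \<notin> weighted_lp p Y (\<lambda>x. \<bar>w_fun p \<sigma> q \<alpha> \<beta> x\<bar>)"
    if "p * (\<sigma> + 1 - q * \<alpha>) \<le> 1" "\<beta> \<ge> 0" "UNIV - {0} \<subseteq> Y" for \<beta> Y
    using not_in_weighted_lp[OF p s(1) a _ that(2,3)] that(1) unfolding u w e by simp
  have optimal: "optimal_hardy_type_weight p \<sigma> (UNIV - {0}) (w_fun p \<sigma> q \<alpha> 0)"
      "optimal_hardy_type_weight p \<sigma> UNIV (w_fun p \<sigma> q \<alpha> \<gamma>)"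
    if eq: "p * (\<sigma> + 1 - q * \<alpha>) = 1"
  proof -
    from eq have ge: "p * (\<sigma> + 1 - q * \<alpha>) \<ge> 1" and le: "p * (\<sigma> + 1 - q * \<alpha>) \<le> 1" by auto
    show "optimal_hardy_type_weight p \<sigma> (UNIV - {0}) (w_fun p \<sigma> q \<alpha> 0)"
      using critical(1,2)[OF ge] null[OF le, of 0 "UNIV - {0}"]
      by (auto simp: optimal_hardy_type_weight_def p_null_critical_def p_critical_def)
    show "optimal_hardy_type_weight p \<sigma> UNIV (w_fun p \<sigma> q \<alpha> \<gamma>)"
      using critical(3,4)[OF ge] null[OF le, of \<gamma> UNIV] \<gamma>
      by (auto simp: optimal_hardy_type_weight_def p_null_critical_def p_critical_def)
  qed
  let ?H = "\<alpha> > (p - 2 + p * \<sigma>) / ((p - 1) * q)"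
  \<comment> \<open>The additional assumption on \<open>\<alpha>\<close> says that \<open>\<kappa> < 1\<close>.\<close>
  have \<kappa>: "p * \<sigma> + (p - 1) * a < 1" if ?H
  proof -
    have "(p - 1) * q > 0" using assms by simp
    then have "p - 2 + p * \<sigma> < \<alpha> * ((p - 1) * q)" using that by (simp add: pos_divide_less_eq)
    then show ?thesis by (simp add: a_def algebra_simps)
  qed
  have asym: "(\<exists>K. finite K \<and> (\<forall>x. x \<notin> K \<longrightarrow> w_fun p \<sigma> q \<alpha> \<beta> x > 0)) \<and>
             (\<exists>c>0. \<exists>N. \<forall>x. \<bar>x\<bar> \<ge> N \<longrightarrow> w_fun p \<sigma> q \<alpha> \<beta> x \<ge> c * \<bar>real_of_int x\<bar> powr (- p * \<sigma>))"
    if H: ?H and b: "\<beta> \<ge> 0" for \<beta>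
  proof -
    obtain c N where c: "c > 0" "N \<ge> 1" "\<And>x. \<bar>x\<bar> \<ge> N \<Longrightarrow> c * \<bar>real_of_int x\<bar> powr (- p * \<sigma>) \<le> w_fun p \<sigma> q \<alpha> \<beta> x"
      using quotient_lower_bound[OF p s(1) a \<kappa>[OF H] b] unfolding w by blast
    have "w_fun p \<sigma> q \<alpha> \<beta> x > 0" if "x \<notin> {- N..N}" for x
    proof -
      have "\<bar>x\<bar> \<ge> N" "x \<noteq> 0" using that c(2) by auto
      then have "c * \<bar>real_of_int x\<bar> powr (- p * \<sigma>) > 0" using c(1) by simp
      then show ?thesis using c(3)[OF \<open>\<bar>x\<bar> \<ge> N\<close>] by linarith
    qed
    then have "\<exists>K. finite K \<and> (\<forall>x. x \<notin> K \<longrightarrow> w_fun p \<sigma> q \<alpha> \<beta> x > 0)" by blast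
    then show ?thesis using c by blast
  qed
  have L0: "frac_p_Laplacian p \<sigma> (pow_fun a 0) x > 0" if H: ?H and x: "x \<noteq> 0" for x
  proof -
    obtain c where c: "c > 0" "\<And>x. x \<noteq> 0 \<Longrightarrow> c * \<bar>real_of_int x\<bar> powr (- (p * \<sigma> + (p - 1) * a)) \<le> frac_p_Laplacian p \<sigma> (pow_fun a 0) x"
      using laplacian_lower_bound[OF p s(1) a \<kappa>[OF H]] by blast
    have "c * \<bar>real_of_int x\<bar> powr (- (p * \<sigma> + (p - 1) * a)) > 0" using c(1) x by simp
    then show ?thesis using c(2)[OF x] by linarith
  qed
  have upos: "pow_fun a \<beta> x > 0" if "x \<noteq> 0 \<or> \<beta> > 0" for \<beta> x using that by (auto simp: pow_fun_def)
  have super: "positive_supersolution p \<sigma> (UNIV - {0}) (w_fun p \<sigma> q \<alpha> 0) (pow_fun a 0)"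
    unfolding positive_supersolution_def w using pow_fun_F_space[OF p s(1) a(1)] upos[of _ 0]
    by (auto simp: pow_fun_def)
  have hw: "hardy_weight p \<sigma> (UNIV - {0}) (w_fun p \<sigma> q \<alpha> 0)" if ?H
  proof -
    have "w_fun p \<sigma> q \<alpha> 0 x > 0" if "x \<noteq> 0" for x
      unfolding w using L0[OF \<open>?H\<close> that] upos[of x 0] that by simp
    then show ?thesis unfolding hardy_weight_def using supersolution_hardy[OF p s(1) super] by auto
  qed
  have wg: "w_fun p \<sigma> q \<alpha> \<gamma> 0 > 0"
    unfolding w using laplacian_zero_pos[OF p s(1) a(1) \<gamma>] upos[of 0 \<gamma>] \<gamma> by simp
  have w1: "w_fun p \<sigma> q \<alpha> \<beta> 1 > 0 \<and> w_fun p \<sigma> q \<alpha> \<beta> (-1) > 0"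
    if H: ?H and \<beta>: "\<beta> \<in> {0} \<union> {1..<1 + C_const p \<sigma> q \<alpha> powr (1 / (p - 1))}" for \<beta>
  proof -
    have L1: "frac_p_Laplacian p \<sigma> (pow_fun a \<beta>) 1 > 0"
    proof (cases "\<beta> = 0")
      case False
      then have b: "\<beta> \<ge> 1" "\<beta> - 1 < C_const p \<sigma> q \<alpha> powr (1 / (p - 1))" using \<beta> by auto
      have Ceq: "C_const p \<sigma> q \<alpha> = (1 + (2 / 3) powr (1 + p * \<sigma>)) * (2 powr a - 1) powr (p - 1) *
          (2 powr (- (p * \<sigma> + (p - 1) * a)) / (p * \<sigma> + (p - 1) * a))"
        by (simp add: C_const_def a_def algebra_simps)
      have "p * \<sigma> + (p - 1) * a > 0" using p s(1) a by (intro add_pos_nonneg) auto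
      then have "C_const p \<sigma> q \<alpha> \<ge> 0"
        unfolding Ceq by (intro mult_nonneg_nonneg divide_nonneg_nonneg) (auto intro: add_nonneg_nonneg)
      have "(\<beta> - 1) powr (p - 1) < (C_const p \<sigma> q \<alpha> powr (1 / (p - 1))) powr (p - 1)"
        using b p by (intro powr_less_mono2) auto
      also have "\<dots> = C_const p \<sigma> q \<alpha>" using \<open>C_const p \<sigma> q \<alpha> \<ge> 0\<close> p by (simp add: powr_powr)
      finally show ?thesis using laplacian_one_lower_bound[OF p s(1) a(1) b(1)] unfolding Ceq by linarith
    qed (use L0[OF H, of 1] in simp)
    moreover have "frac_p_Laplacian p \<sigma> (pow_fun a \<beta>) (- 1) = frac_p_Laplacian p \<sigma> (pow_fun a \<beta>) 1"
      by (intro laplacian_even pow_fun_even)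
    ultimately show ?thesis unfolding w by (simp add: pow_fun_def)
  qed
  show ?thesis
  proof (intro conjI impI, goal_cases)
    case 1 then show ?case by (rule critical)
  next
    case 2 then show ?case by (rule critical)
  next
    case 3 then show ?case using null \<gamma> by auto
  next
    case 4 then show ?case by (rule optimal)
  next
    case 5 then show ?case by (rule optimal)
  next
    case 6 then show ?case using asym \<gamma> by auto
  next
    case 7 show ?case unfolding u by (rule laplacian_zero_neg[OF p s(1) a(1)])
  next
    case 8 then show ?case unfolding u using L0 by blast
  next
    case 9 then show ?case by (rule hw)
  next
    case 10 show ?case by (rule wg)
  next
    case 11 then show ?case using w1 by blast
  qed
qed

end
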